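(* For every $\lambda \in \mathbb{N}$, $$\sum_{n=1}^{\infty} \left( \frac{1}{16} \right)^{n} \binom{2n}{n}^2 \frac{O_{n}^2}{(1 + 2n - 2 \lambda)^2} = \frac{16^{\lambda}}{\lambda^2 \binom{2\lambda}{\lambda}^2} \left( K + \sum_{k=1}^{\lambda - 1} \left( \frac{1}{16} \right)^{k} \binom{2k}{k}^2 H(k) \right),$$ where $$K:=\frac{1}{4} \left( -\frac{8 G}{\pi}-\frac{8 G \ln (2)}{\pi}-\frac{48 \mathcal{G}}{\pi} + \frac{9 \pi^2}{8}+\frac{\pi}{6}+\frac{4 \ln^2(2)}{\pi}+\frac{3 \ln^2(2)}{2} \right)$$ and, for $m \in \mathbb{N}$, $$H(m):= \frac{2m\,(G(m)-C(m)) + C(m) - A(m)}{2(2m+1)}+ \frac{\pi^2+24\ln^2 (2)}{24(2m+1)\pi} + \frac{1}{4} B(m) + m E(m).$$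
   Context: $\mathbb{N}=\{1,2,3,\dots\}$. $O_n = 1+\frac13+\cdots+\frac{1}{2n-1}$ is the $n$-th odd harmonic number. $G=\sum_{n=1}^\infty \frac{(-1)^{n+1}}{(2n-1)^2}$ (written without an argument) is Catalan's constant; it is not to be confused with the function $G(m)$ defined below. $\mathcal{G}=\Im\left(\mathrm{Li}_3\left(\frac{1+i}{2}\right)\right)$, where $\mathrm{Li}_s(z)=\sum_{n\ge1} z^n/n^s$. An empty sum is $0$. The sequences $A,B$ are defined by $$A(0)=\frac{4G}{\pi},\qquad A(m)=-\frac{16^{m}}{2\pi m^2\binom{2m}{m}^2}\sum_{k=0}^{m-1}\left(\frac1{16}\right)^k\binom{2k}{k}^2\quad (m\in\mathbb{N}),$$ $$B(0)=-\frac{16\mathcal{G}}{\pi}+\frac{3\pi^2}{8}+\frac{\ln^2(2)}{2},\qquad B(m)=\frac{16^{m}}{m^2\binom{2m}{m}^2}\sum_{k=0}^{m-1}\left(\frac1{16}\right)^k\binom{2k}{k}^2\,\frac{kA(k)+\frac1\pi}{2k+1}\quad (m\in\mathbb{N}).$$ The functions $C$, $E$, $G(\cdot)$ are defined for $m\in\mathbb{N}$ by $$C(m):=\sum_{n=1}^{\infty} \left( \frac{1}{16} \right)^{n} \binom{2n}{n}^2 \frac{O_{n}}{1 + 2n - 2 m},\qquad E(m):=\sum_{n=1}^{\infty} \left( \frac{1}{16} \right)^{n} \binom{2n}{n}^2 \frac{O_{n}}{(1 + 2n - 2 m)^2},$$ $$G(m):=\sum_{n=1}^{\infty} \left( \frac{1}{16}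 \right)^{n} \binom{2n}{n}^2 \frac{O_{n}^2}{1 + 2n - 2 m}.$$ *)

theory Defs
  imports "HOL-Analysis.Analysis"
begin

(* Series that mathematically start at n = 1 are written with the summand at Suc n. *)

definition odd_harm :: "nat \<Rightarrow> real" where
  "odd_harm n = (\<Sum>k=1..n. 1 / (2 * real k - 1))"

definition catalan_const :: real where
  "catalan_const = (\<Sum>n. let k = Suc n in (-1) ^ (k + 1) / (2 * real k - 1) ^ 2)"

(* The power series of Li_s, for a natural number s; meaningful where it converges. *)
definition polylog :: "nat \<Rightarrow> complex \<Rightarrow> complex" where
  "polylog s z = (\<Sum>n. z ^ Suc n / of_nat (Suc n) ^ s)"

definition im_trilog :: real where
  "im_trilog = Im (polylog 3 ((1 + \<i>) / 2))"

definition central_sq :: "nat \<Rightarrow> real" where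
  "central_sq n = (1 / 16) ^ n * real ((2 * n) choose n) ^ 2"

definition A_seq :: "nat \<Rightarrow> real" where
  "A_seq m = (if m = 0 then 4 * catalan_const / pi
     else - (16 ^ m / (2 * pi * real m ^ 2 * real ((2 * m) choose m) ^ 2)) *
            (\<Sum>k<m. central_sq k))"

definition B_seq :: "nat \<Rightarrow> real" where
  "B_seq m = (if m = 0 then - (16 * im_trilog / pi) + 3 * pi ^ 2 / 8 + (ln 2) ^ 2 / 2
     else 16 ^ m / (real m ^ 2 * real ((2 * m) choose m) ^ 2) *
            (\<Sum>k<m. central_sq k * ((real k * A_seq k + 1 / pi) / (2 * real k + 1))))"

(* The denominators below are odd integers, hence nonzero. *)

definition C_series :: "nat \<Rightarrow> real" where
  "C_series m = (\<Sum>n. let k = Suc n in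
     central_sq k * (odd_harm k / (1 + 2 * real k - 2 * real m)))"

definition E_series :: "nat \<Rightarrow> real" where
  "E_series m = (\<Sum>n. let k = Suc n in
     central_sq k * (odd_harm k / (1 + 2 * real k - 2 * real m) ^ 2))"

definition G_series :: "nat \<Rightarrow> real" where
  "G_series m = (\<Sum>n. let k = Suc n in
     central_sq k * (odd_harm k ^ 2 / (1 + 2 * real k - 2 * real m)))"

definition K_const :: real where
  "K_const = 1 / 4 *
     (- (8 * catalan_const / pi) - 8 * catalan_const * ln 2 / pi - 48 * im_trilog / pi
      + 9 * pi ^ 2 / 8 + pi / 6 + 4 * (ln 2) ^ 2 / pi + 3 * (ln 2) ^ 2 / 2)"

definition H_seq :: "nat \<Rightarrow> real" where
  "H_seq m =
     (2 * real m * (G_series m - C_series m) + C_series m - A_seq m) / (2 * (2 * real m + 1))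
     + (pi ^ 2 + 24 * (ln 2) ^ 2) / (24 * (2 * real m + 1) * pi)
     + 1 / 4 * B_seq m + real m * E_series m"

end

(*
  Write a_n = binom(2n,n)^2 / 16^n, O_n for the odd harmonic numbers and l = ln 2.  Since
  (n+1)^2 a_(n+1) = (n+1/2)^2 a_n, the differences of n^2 a_n O_n^p / (2n-1-2m)^q telescope and
  yield recurrences in m for all the series; they reduce the theorem to the values at m = 0, 1,
  where sum a_n/(2n+1), sum a_n/(2n+1)^2, sum a_n O_n/(2n+1) and sum a_n O_n^2/(2n-1) remain.

  The convolution identity 4 a_n O_n = sum_(k<n) a_k/(n-k) turns each series with a factor O_n
  into itself plus simpler series, because sum_j 1/(j(2(k+j)-1)) is again linear in O_k.  This
  evaluates the last series and gives sum a_n O_n/(2n+1) = sum a_n/(2n+1)^2 - l sum a_n/(2n+1).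

  With t = tan(phi/2), sum a_n O_n/(2n+1) is a multiple of the integral of
  ln t * ln((1-t^2)/(1+t^2)) / (1+t^2) over (0,1), and Im Li_3((1+i)/2) is half the integral of
  ln(1-t)^2/(1+t^2).  The two are linked by t -> (1-t)/(1+t), by t -> 2t/(1-t^2), and by the
  integral of ln t * ln((1-t)^2/(1+t^2)) / (1+t^2), which is G l: the moments m_n of -ln tan(phi/2)
  against sin^n satisfy (n+1) m_(n+1) = n m_(n-1) - 1/n, so sum m_n/n telescopes to m_0 m_1.
*)
theory Submission
  imports
    Defs
    "HOL-Real_Asymp.Real_Asymp"
    "HOL-Computational_Algebra.Formal_Power_Series"
begin

section \<open>Central binomial squares and odd harmonic numbers\<close>

text \<open>The squared binomial makes the plain generating function elliptic. It is therefore split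
  as a_n = c_n^2 with c_n = binom(2n,n) / 4^n: one c_n is read as a Wallis integral of sin^(2n), the
  other is absorbed by the series of 1/sqrt(1 - x) at x = sin(phi)^2, and the denominator 2n+1 comes
  from integrating -ln tan(phi/2) by parts. The variable t leaves only rational functions and
  logarithms, and the measure dphi is preserved by phi -> pi/2 - phi (the Cayley map) and merely
  scaled by the doubling of phi.

  C, E and G stay unevaluated inside H; only the sums without O_n need closed forms for every m. The
  recurrence with O_n^2 over a first power is the delicate one: its telescoped terms grow like
  O_n^2, so it holds only relative to its own case m = 0. The constant of that case is the source of
  pi^2 + 24 ln(2)^2 in H, and so sum a_n O_n^2/(2n-1) enters H as well as K.\<close>

lemma central_sq_0 [simp]: "central_sq 0 = 1"
  by (simp add: central_sq_def)

lemma central_sq_Suc: "central_sq (Suc n) = central_sq n * ((2 * real n + 1) / (2 * real n + 2)) ^ 2"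
proof -
  have "Suc n * (2 * Suc n choose Suc n) = 2 * (2 * n + 1) * (2 * n choose n)"
  proof -
    have "Suc n * (2 * Suc n choose Suc n) = (2 * n + 2) * (Suc (2 * n) choose n)"
      using Suc_times_binomial_eq[of "Suc (2 * n)" n] by simp
    also have "(Suc (2 * n) choose n) = (Suc (2 * n) choose Suc n)"
      by (subst binomial_symmetric) auto
    also have "(2 * n + 2) * \<dots> = 2 * (Suc n * (Suc (2 * n) choose Suc n))"
      by simp
    also have "Suc n * (Suc (2 * n) choose Suc n) = Suc (2 * n) * (2 * n choose n)"
      using Suc_times_binomial_eq[of "2 * n" n] by simp
    finally show ?thesis by simp
  qed
  then have "real (Suc n * (2 * Suc n choose Suc n)) = real (2 * (2 * n + 1) * (2 * n choose n))"
    by presburger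
  then have "real (2 * Suc n choose Suc n) = 2 * (2 * real n + 1) * real (2 * n choose n) / (real n + 1)"
    by (simp add: field_simps del: binomial_Suc_Suc)
  then have "central_sq (Suc n)
      = (1 / 16) ^ Suc n * (2 * (2 * real n + 1) * real (2 * n choose n) / (real n + 1)) ^ 2"
    by (simp only: central_sq_def)
  also have "\<dots> = (1 / 16) ^ n * real (2 * n choose n) ^ 2 * ((2 * real n + 1) / (2 * real n + 2)) ^ 2"
  proof -
    have "2 * real n + 2 = 2 * (real n + 1)"
      by simp
    then show ?thesis
      by (simp only: power_divide power_mult_distrib) (simp add: mult_ac)
  qed
  finally show ?thesis
    by (simp only: central_sq_def)
qed

lemma central_sq_pos [simp]: "central_sq n > 0"
  by (simp add: central_sq_def)

lemma central_sq_nonzero [simp]: "central_sq n \<noteq> 0"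
  by (metis central_sq_pos less_irrefl)

lemma central_sq_nonneg [simp]: "central_sq n \<ge> 0"
  by (simp add: less_imp_le)

section \<open>Growth of a_n and O_n, and summability\<close>

lemma central_sq_le: "central_sq n \<le> 1 / (2 * real n + 1)"
proof (induction n)
  case (Suc n)
  have "central_sq (Suc n) \<le> 1 / (2 * real n + 1) * ((2 * real n + 1) / (2 * real n + 2)) ^ 2"
    unfolding central_sq_Suc by (intro mult_right_mono Suc) auto
  also have "\<dots> = (2 * real n + 1) / (2 * real n + 2) ^ 2"
    by (simp add: power_divide power2_eq_square)
  also have "\<dots> \<le> 1 / (2 * real (Suc n) + 1)"
    by (intro mult_imp_div_pos_le) (auto simp: power2_eq_square field_simps add_pos_nonneg)
  finally show ?case .
qed simp

text \<open>The recurrence of a_n gives the reciprocals of the partial Wallis products, whose limit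
  is pi/2.\<close>

lemma central_sq_asymp: "(\<lambda>n. (2 * real n + 1) * central_sq n) \<longlonglongrightarrow> 2 / pi"
proof -
  have eq: "(2 * real n + 1) * central_sq n = inverse (\<Prod>k=1..n. (4*real k^2) / (4*real k^2 - 1))" for n
  proof (induction n)
    case (Suc n)
    have "(2 * real (Suc n) + 1) * central_sq (Suc n)
        = (2 * real n + 3) * (2 * real n + 1) / (2 * real n + 2)^2 * ((2 * real n + 1) * central_sq n)"
      by (simp add: central_sq_Suc power_divide power2_eq_square algebra_simps)
    also have "(2 * real n + 3) * (2 * real n + 1) / (2 * real n + 2)^2
        = inverse ((4*real (Suc n)^2) / (4*real (Suc n)^2 - 1))"
      by (simp add: power2_eq_square field_simps)
    finally show ?case
      unfolding Suc by (subst prod.nat_ivl_Suc') (simp_all only: inverse_mult_distrib)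
  qed simp
  have "(\<lambda>n. inverse (\<Prod>k=1..n. (4*real k^2) / (4*real k^2 - 1))) \<longlonglongrightarrow> inverse (pi / 2)"
    by (intro tendsto_inverse wallis) auto
  then show ?thesis
    by (simp add: eq)
qed

lemma odd_harm_0 [simp]: "odd_harm 0 = 0"
  by (simp add: odd_harm_def)

lemma odd_harm_Suc: "odd_harm (Suc n) = odd_harm n + 1 / (2 * real n + 1)"
  by (simp add: odd_harm_def)

lemma odd_harm_nonneg [simp]: "odd_harm n \<ge> 0"
  by (induction n) (auto simp: odd_harm_Suc)

lemma odd_harm_le: "odd_harm n \<le> 1 + ln (real n + 1)"
proof (cases n)
  case (Suc m)
  have "odd_harm (Suc m) \<le> 1 + ln (real m + 1)"
  proof (induction m)
    case (Suc m)
    have "1 / (2 * real (Suc m) + 1) \<le> 1 / (real m + 2)"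
      by (simp add: field_simps)
    also have "1 / (real m + 2) \<le> ln (real m + 2) - ln (real m + 1)"
    proof -
      have "ln ((real m + 1) / (real m + 2)) \<le> (real m + 1) / (real m + 2) - 1"
        by (intro ln_le_minus_one) auto
      also have "\<dots> = - (1 / (real m + 2))"
        by (simp add: field_simps)
      finally show ?thesis
        by (subst (asm) ln_div) auto
    qed
    finally show ?case
      using Suc by (subst odd_harm_Suc) (simp add: add_ac)
  qed (simp add: odd_harm_Suc)
  also have "\<dots> \<le> 1 + ln (real n + 1)"
    using Suc by simp
  finally show ?thesis
    using Suc by simp
qed simp

lemma odd_harm_sq_ratio: "(\<lambda>n. odd_harm n ^ 2 / real n) \<longlonglongrightarrow> 0"
proof (rule tendsto_sandwich[OF _ _ tendsto_const])
  show "\<forall>\<^sub>F n in sequentially. odd_harm n ^ 2 / real n \<le> (1 + ln (real n + 1)) ^ 2 / real n"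
    by (intro always_eventually allI divide_right_mono power_mono odd_harm_le) auto
  show "(\<lambda>n. (1 + ln (real n + 1)) ^ 2 / real n) \<longlonglongrightarrow> 0"
    by real_asymp
qed auto

lemma odd_denominator_nonzero [simp]: "1 + 2 * real n - 2 * real m \<noteq> 0"
proof
  assume "1 + 2 * real n - 2 * real m = 0"
  then have "real (1 + 2 * n) = real (2 * m)"
    by simp
  then have "1 + 2 * n = 2 * m"
    by (simp only: of_nat_eq_iff)
  then show False
    by presburger
qed

text \<open>The terms are O(ln(n)^2 / n^2) in the worst case; the exponent -3/2 leaves room for the
  squared logarithm.\<close>

lemma summable_central_sq:
  assumes "p \<le> 2" "1 \<le> q"
  shows "summable (\<lambda>n. central_sq n * (odd_harm n ^ p / (1 + 2 * real n - 2 * real m) ^ q))"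
proof (rule summable_comparison_test_ev)
  show "summable (\<lambda>n. real n powr (-3/2))"
    by (subst summable_real_powr_iff) auto
  have "\<forall>\<^sub>F n in sequentially. 1 / (2 * real n + 1) * ((1 + ln (real n + 1)) ^ 2 / (1 + 2 * real n - 2 * real m)) \<le> real n powr (-3/2)"
    by real_asymp
  moreover have "\<forall>\<^sub>F n in sequentially. n \<ge> m"
    by (rule eventually_ge_at_top)
  ultimately show "\<forall>\<^sub>F n in sequentially.
      norm (central_sq n * (odd_harm n ^ p / (1 + 2 * real n - 2 * real m) ^ q)) \<le> real n powr (-3/2)"
  proof eventually_elim
    case (elim n)
    have "odd_harm n ^ p \<le> (1 + ln (real n + 1)) ^ p"
      by (intro power_mono odd_harm_le) auto
    also have "\<dots> \<le> (1 + ln (real n + 1)) ^ 2"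
      by (intro power_increasing assms) auto
    finally have 1: "odd_harm n ^ p \<le> (1 + ln (real n + 1)) ^ 2" .
    have 2: "(1 + 2 * real n - 2 * real m) ^ 1 \<le> (1 + 2 * real n - 2 * real m) ^ q"
      by (intro power_increasing assms) (use elim in auto)
    have "norm (central_sq n * (odd_harm n ^ p / (1 + 2 * real n - 2 * real m) ^ q))
       = central_sq n * (odd_harm n ^ p / (1 + 2 * real n - 2 * real m) ^ q)"
      using elim by (simp add: abs_mult)
    also have "\<dots> \<le> 1 / (2 * real n + 1) * ((1 + ln (real n + 1)) ^ 2 / (1 + 2 * real n - 2 * real m))"
      using elim 1 2 by (intro mult_mono frac_le central_sq_le) auto
    finally show ?case
      using elim by simp
  qed
qed

section \<open>Inverse squares of the odd numbers\<close>

definition odd_harm2 :: "nat \<Rightarrow> real" where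
  "odd_harm2 n = (\<Sum>k<n. 1 / (2 * real k + 1) ^ 2)"

lemma odd_harm2_Suc: "odd_harm2 (Suc n) = odd_harm2 n + 1 / (2 * real n + 1) ^ 2"
  by (simp add: odd_harm2_def)

lemma odd_harm2_0 [simp]: "odd_harm2 0 = 0"
  by (simp add: odd_harm2_def)

lemma odd_harm2_tendsto: "odd_harm2 \<longlonglongrightarrow> pi ^ 2 / 8"
proof -
  define S where "S = (\<lambda>N. \<Sum>n<N. 1 / (real n + 1) ^ 2)"
  have S: "S \<longlonglongrightarrow> pi ^ 2 / 6"
    using inverse_squares_sums by (simp add: sums_def S_def add.commute)
  \<comment> \<open>Splitting by parity: the even terms of the inverse squares form a quarter of the
    sum of half the length.\<close>
  have "S (2 * N) = odd_harm2 N + S N / 4" for N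
  proof (induction N)
    case (Suc N)
    have "S (2 * Suc N) = S (2 * N) + 1 / (2 * real N + 1) ^ 2 + 1 / (2 * (real N + 1)) ^ 2"
    proof -
      have "2 * Suc N = Suc (Suc (2 * N))" "2 * (real N + 1) = real (2 * N + 1) + 1"
        by simp_all
      then show ?thesis
        by (simp only: S_def sum.lessThan_Suc) simp
    qed
    moreover have "S (Suc N) = S N + 1 / (real N + 1) ^ 2"
      by (simp add: S_def)
    ultimately show ?case
      unfolding power_mult_distrib using Suc by (simp add: odd_harm2_Suc)
  qed (simp add: S_def)
  then have "odd_harm2 = (\<lambda>N. S (2 * N) - S N / 4)"
    by (auto simp: fun_eq_iff)
  moreover have "(\<lambda>N. S (2 * N)) \<longlonglongrightarrow> pi ^ 2 / 6"
    by (rule filterlim_compose[OF S]) (rule mult_nat_left_at_top, simp)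
  then have "(\<lambda>N. S (2 * N) - S N / 4) \<longlonglongrightarrow> pi ^ 2 / 6 - pi ^ 2 / 6 / 4"
    by (intro tendsto_intros S) auto
  ultimately show ?thesis
    by simp
qed

section \<open>Recurrences in the shift parameter\<close>

text \<open>One family for everything: exponents (p, q) = (0,1) and (0,2) give A and B for m >= 1,
  (1,1), (1,2) and (2,1) give C, E and G, and (2,2) is the series of the theorem.\<close>

definition central_term :: "nat \<Rightarrow> nat \<Rightarrow> nat \<Rightarrow> nat \<Rightarrow> real" where
  "central_term p q m n = central_sq n * (odd_harm n ^ p / (1 + 2 * real n - 2 * real m) ^ q)"

definition central_series :: "nat \<Rightarrow> nat \<Rightarrow> nat \<Rightarrow> real" where
  "central_series p q m = (\<Sum>n. central_term p q m n)"

lemma central_term_sums: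
  assumes "p \<le> 2" "1 \<le> q"
  shows "central_term p q m sums central_series p q m"
  unfolding central_series_def using summable_central_sq[OF assms, of m]
  by (simp add: central_term_def[abs_def] summable_sums)

lemma telescope_sums_of_tendsto:
  fixes w :: "nat \<Rightarrow> real"
  assumes "w \<longlonglongrightarrow> c" "w 0 = 0" "\<And>n. w (Suc n) - w n = f n" "f sums s"
  shows "s = c"
  using telescope_sums[OF assms(1)] assms by (simp add: sums_unique2)

text \<open>The quantity that is telescoped in n. With the shift \<open>Suc m\<close>, its value at
  n has the denominator of shift m+1 and its value at n+1 that of shift m, so one difference links
  neighbouring shifts.\<close>

definition boundary :: "nat \<Rightarrow> nat \<Rightarrow> nat \<Rightarrow> nat \<Rightarrow> real" where
  "boundary p q m n = (real n) ^ 2 * central_term p q (Suc m) n"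

lemma boundary_0 [simp]: "boundary p q m 0 = 0"
  by (simp add: boundary_def)

lemma square_mult_central_sq_Suc:
  "real (Suc n) ^ 2 * central_sq (Suc n) = (real n + 1 / 2) ^ 2 * central_sq n"
proof -
  have "y ^ 2 * (x * (z / (2 * y)) ^ 2) = (z / 2) ^ 2 * x" if "y \<noteq> 0" for x y z :: real
    using that by (simp add: power_divide power_mult_distrib)
  from this[of "real (Suc n)" "central_sq n" "2 * real n + 1"] show ?thesis
    by (simp add: central_sq_Suc add_divide_distrib algebra_simps)
qed

lemma boundary_Suc:
  "boundary p q m (Suc n) = (real n + 1 / 2) ^ 2 * central_sq n *
     ((odd_harm n + 1 / (2 * real n + 1)) ^ p / (1 + 2 * real n - 2 * real m) ^ q)"
proof -
  have "boundary p q m (Suc n) = (real (Suc n) ^ 2 * central_sq (Suc n)) *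
     (odd_harm (Suc n) ^ p / (1 + 2 * real n - 2 * real m) ^ q)"
  proof -
    have "1 + 2 * real (Suc n) - 2 * real (Suc m) = 1 + 2 * real n - 2 * real m"
      by simp
    then show ?thesis
      by (simp only: boundary_def central_term_def mult.assoc)
  qed
  then show ?thesis
    by (simp only: square_mult_central_sq_Suc odd_harm_Suc)
qed

lemma two_n_plus_1_nonzero: "2 * real n + 1 \<noteq> 0"
  using of_nat_0_le_iff[of n] by linarith

lemma boundary_0_1_tendsto: "boundary 0 1 m \<longlonglongrightarrow> 1 / (2 * pi)"
proof -
  have "(\<lambda>n. real n ^ 2 / ((2 * real n + 1) * (1 + 2 * real n - 2 * real (Suc m)))) \<longlonglongrightarrow> 1 / 4"
    by real_asymp
  from tendsto_mult[OF central_sq_asymp this]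
  have "(\<lambda>n. ((2 * real n + 1) * central_sq n) *
      (real n ^ 2 / ((2 * real n + 1) * (1 + 2 * real n - 2 * real (Suc m))))) \<longlonglongrightarrow> 2 / pi * (1 / 4)" .
  moreover have "((2 * real n + 1) * central_sq n) *
      (real n ^ 2 / ((2 * real n + 1) * (1 + 2 * real n - 2 * real (Suc m)))) = boundary 0 1 m n" for n
    using two_n_plus_1_nonzero[of n] by (simp add: boundary_def central_term_def)
  ultimately show ?thesis
    by simp
qed

lemma boundary_q2_tendsto:
  assumes "p = 0 \<or> p = 2"
  shows "boundary p 2 m \<longlonglongrightarrow> 0"
proof -
  have "(\<lambda>n. odd_harm n ^ p / real n) \<longlonglongrightarrow> 0"
    using assms lim_1_over_n odd_harm_sq_ratio by auto
  moreover have "(\<lambda>n. real n ^ 3 / ((2 * real n + 1) * (1 + 2 * real n - 2 * real (Suc m)) ^ 2)) \<longlonglongrightarrow> 1 / 8"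
    by real_asymp
  ultimately have "(\<lambda>n. ((2 * real n + 1) * central_sq n) * ((odd_harm n ^ p / real n) * 
      (real n ^ 3 / ((2 * real n + 1) * (1 + 2 * real n - 2 * real (Suc m)) ^ 2)))) \<longlonglongrightarrow> 2 / pi * (0 * (1 / 8))"
    by (intro tendsto_mult central_sq_asymp)
  moreover have "((2 * real n + 1) * central_sq n) * ((odd_harm n ^ p / real n) * 
      (real n ^ 3 / ((2 * real n + 1) * (1 + 2 * real n - 2 * real (Suc m)) ^ 2))) = boundary p 2 m n" for n
  proof -
    show ?thesis
      using two_n_plus_1_nonzero[of n] by (cases "n = 0") (simp_all add: boundary_def central_term_def power2_eq_square power3_eq_cube)
  qed
  ultimately show ?thesis
    by simp
qed

definition inv_odd :: "nat \<Rightarrow> nat \<Rightarrow> real" where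
  "inv_odd m n = 1 / (1 + 2 * real n - 2 * real m)"

lemma central_term_inv_odd: "central_term p q m n = central_sq n * odd_harm n ^ p * inv_odd m n ^ q"
  by (simp add: central_term_def inv_odd_def power_divide)

text \<open>These linear relations let n and n + 1/2 be absorbed by the reciprocals, which produces
  the coefficients m, m^2, (2m+1)/2 and (2m+1)^2/4 of the recurrences. With the reciprocal as a
  named quantity, the difference identities are polynomial consequences of them, which
  \<open>algebra\<close> can check.\<close>

lemma inv_odd_shift:
  "(real n + 1 / 2) * inv_odd m n = 1 / 2 + real m * inv_odd m n"
  "real n * inv_odd (Suc m) n = 1 / 2 + (real m + 1 / 2) * inv_odd (Suc m) n"
  using odd_denominator_nonzero[of n m] odd_denominator_nonzero[of n "Suc m"]
  by (simp_all add: inv_odd_def field_simps)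

lemma boundary_diff:
  "boundary p q m (Suc n) - boundary p q m n = (real n + 1 / 2) ^ 2 * central_sq n *
     (odd_harm n + 1 / (2 * real n + 1)) ^ p * inv_odd m n ^ q
     - real n ^ 2 * central_sq n * odd_harm n ^ p * inv_odd (Suc m) n ^ q"
  unfolding boundary_Suc by (simp add: boundary_def central_term_inv_odd) (simp add: inv_odd_def power_divide)

lemma half_shift_odd_harm:
  "(real n + 1 / 2) * (odd_harm n + 1 / (2 * real n + 1)) = (real n + 1 / 2) * odd_harm n + 1 / 2"
  using two_n_plus_1_nonzero[of n] by (simp add: field_simps)

lemma central_series_0_1_Suc:
  "real m ^ 2 * central_series 0 1 m - (2 * real m + 1) ^ 2 / 4 * central_series 0 1 (Suc m) = 1 / (2 * pi)"
proof (rule telescope_sums_of_tendsto[OF boundary_0_1_tendsto boundary_0])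
  show "(\<lambda>n. real m ^ 2 * central_term 0 1 m n - (2 * real m + 1) ^ 2 / 4 * central_term 0 1 (Suc m) n) sums
      (real m ^ 2 * central_series 0 1 m - (2 * real m + 1) ^ 2 / 4 * central_series 0 1 (Suc m))"
    by (intro sums_diff sums_mult central_term_sums) auto
  fix n
  show "boundary 0 1 m (Suc n) - boundary 0 1 m n = real m ^ 2 * central_term 0 1 m n - (2 * real m + 1) ^ 2 / 4 * central_term 0 1 (Suc m) n"
    using inv_odd_shift[of n m] unfolding boundary_diff central_term_inv_odd by algebra
qed

lemma central_series_0_2_Suc:
  "real m * central_series 0 1 m + real m ^ 2 * central_series 0 2 m
   - (2 * real m + 1) / 2 * central_series 0 1 (Suc m) - (2 * real m + 1) ^ 2 / 4 * central_series 0 2 (Suc m) = 0"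
proof (rule telescope_sums_of_tendsto[OF boundary_q2_tendsto boundary_0])
  let ?f = "\<lambda>n. real m * central_term 0 1 m n + real m ^ 2 * central_term 0 2 m n
   - (2 * real m + 1) / 2 * central_term 0 1 (Suc m) n - (2 * real m + 1) ^ 2 / 4 * central_term 0 2 (Suc m) n"
  show "?f sums (real m * central_series 0 1 m + real m ^ 2 * central_series 0 2 m
   - (2 * real m + 1) / 2 * central_series 0 1 (Suc m) - (2 * real m + 1) ^ 2 / 4 * central_series 0 2 (Suc m))"
    by (intro sums_diff sums_add sums_mult central_term_sums) auto
  fix n
  show "boundary 0 2 m (Suc n) - boundary 0 2 m n = ?f n"
    using inv_odd_shift[of n m] unfolding boundary_diff central_term_inv_odd by algebra
qed auto

lemma central_series_2_2_Suc:
  "real m * central_series 2 1 m + real m ^ 2 * central_series 2 2 m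
   - (2 * real m + 1) / 2 * central_series 2 1 (Suc m) - (2 * real m + 1) ^ 2 / 4 * central_series 2 2 (Suc m)
   + central_series 1 1 m / 2 + real m * central_series 1 2 m + central_series 0 2 m / 4 = 0"
proof (rule telescope_sums_of_tendsto[OF boundary_q2_tendsto boundary_0])
  let ?f = "\<lambda>n. real m * central_term 2 1 m n + real m ^ 2 * central_term 2 2 m n
   - (2 * real m + 1) / 2 * central_term 2 1 (Suc m) n - (2 * real m + 1) ^ 2 / 4 * central_term 2 2 (Suc m) n
   + central_term 1 1 m n / 2 + real m * central_term 1 2 m n + central_term 0 2 m n / 4"
  show "?f sums (real m * central_series 2 1 m + real m ^ 2 * central_series 2 2 m
   - (2 * real m + 1) / 2 * central_series 2 1 (Suc m) - (2 * real m + 1) ^ 2 / 4 * central_series 2 2 (Suc m)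
   + central_series 1 1 m / 2 + real m * central_series 1 2 m + central_series 0 2 m / 4)"
    by (intro sums_diff sums_add sums_mult sums_divide central_term_sums) auto
  fix n
  show "boundary 2 2 m (Suc n) - boundary 2 2 m n = ?f n"
    using inv_odd_shift[of n m] half_shift_odd_harm[of n] unfolding boundary_diff central_term_inv_odd by algebra
qed auto

text \<open>Each of the two terms grows like O_n^2, but the difference of the two reciprocals is
  O(1/n^2), which leaves a multiple of O_n^2 / n.\<close>

lemma boundary_2_1_diff_tendsto: "(\<lambda>N. boundary 2 1 m N - boundary 2 1 0 N) \<longlonglongrightarrow> 0"
proof -
  have "(\<lambda>n. real n ^ 3 / (2 * real n + 1) * (1 / (1 + 2 * real n - 2 * real (Suc m)) - 1 / (1 + 2 * real n - 2 * real (Suc 0)))) \<longlonglongrightarrow> (- ((- 1 - 2 * real m) / 4) - 1 / 4) / 2"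
    by real_asymp
  then have "(\<lambda>n. ((2 * real n + 1) * central_sq n) * ((odd_harm n ^ 2 / real n) * 
      (real n ^ 3 / (2 * real n + 1) * (1 / (1 + 2 * real n - 2 * real (Suc m)) - 1 / (1 + 2 * real n - 2 * real (Suc 0))))))
      \<longlonglongrightarrow> 2 / pi * (0 * ((- ((- 1 - 2 * real m) / 4) - 1 / 4) / 2))"
    by (intro tendsto_mult central_sq_asymp odd_harm_sq_ratio)
  moreover have "((2 * real n + 1) * central_sq n) * ((odd_harm n ^ 2 / real n) * 
      (real n ^ 3 / (2 * real n + 1) * (1 / (1 + 2 * real n - 2 * real (Suc m)) - 1 / (1 + 2 * real n - 2 * real (Suc 0)))))
      = boundary 2 1 m n - boundary 2 1 0 n" for n
  proof (cases "n = 0")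
    case False
    have "(x * c) * ((h / n) * (n ^ 3 / x * (u - v))) = n ^ 2 * (c * h * u) - n ^ 2 * (c * h * v)"
      if "x \<noteq> 0" "n \<noteq> 0" for x c h n u v :: real
      using that by (simp add: power2_eq_square power3_eq_cube right_diff_distrib)
    from this[OF two_n_plus_1_nonzero[of n], of "real n"] False show ?thesis
      by (simp add: boundary_def central_term_def)
  qed simp
  ultimately show ?thesis
    by simp
qed

text \<open>The telescoped sum diverges here, but its divergent part does not depend on \<open>m\<close>.\<close>

lemma central_series_2_1_Suc:
  "real m ^ 2 * central_series 2 1 m - (2 * real m + 1) ^ 2 / 4 * central_series 2 1 (Suc m)
     + real m * central_series 1 1 m + central_series 0 1 m / 4
   = (central_series 0 1 0 - central_series 2 1 1) / 4"
proof -
  define f where "f = (\<lambda>m n. real m ^ 2 * central_term 2 1 m n - (2 * real m + 1) ^ 2 / 4 * central_term 2 1 (Suc m) n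
     + real m * central_term 1 1 m n + central_term 0 1 m n / 4)"
  have f: "f m sums (real m ^ 2 * central_series 2 1 m - (2 * real m + 1) ^ 2 / 4 * central_series 2 1 (Suc m)
     + real m * central_series 1 1 m + central_series 0 1 m / 4)" for m
    unfolding f_def by (intro sums_diff sums_add sums_mult sums_divide central_term_sums) auto
  have step: "boundary 2 1 m (Suc n) - boundary 2 1 m n = f m n + central_sq n * odd_harm n / 2" for m n
    using inv_odd_shift[of n m] half_shift_odd_harm[of n]
    unfolding boundary_diff central_term_inv_odd f_def by algebra
  have "(\<Sum>n<N. f m n - f 0 n) = boundary 2 1 m N - boundary 2 1 0 N" for N
    by (induction N) (use step[of m] step[of 0] in \<open>auto simp: algebra_simps\<close>)
  then have "(\<lambda>n. f m n - f 0 n) sums 0"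
    using boundary_2_1_diff_tendsto[of m] by (simp add: sums_def)
  from sums_unique2[OF this sums_diff[OF f[of m] f[of 0]]] show ?thesis
    by simp
qed

section \<open>Closed forms for the series without O_n, and the named series\<close>

lemma A_seq_eq: "1 \<le> m \<Longrightarrow> A_seq m = central_series 0 1 m"
proof -
  \<comment> \<open>m^2 a_m is a summation factor: by \<open>square_mult_central_sq_Suc\<close> its
    next value is (2m+1)^2/4 times a_m, so the recurrence becomes a plain sum. The same factor
    serves for B and for the theorem.\<close>
  have "real m ^ 2 * central_sq m * central_series 0 1 m = - (1 / (2 * pi)) * (\<Sum>k<m. central_sq k)" for m
  proof (induction m)
    case (Suc m)
    have "real (Suc m) ^ 2 * central_sq (Suc m) * central_series 0 1 (Suc m)
        = central_sq m * ((2 * real m + 1) ^ 2 / 4 * central_series 0 1 (Suc m))"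
      unfolding square_mult_central_sq_Suc by (simp add: power2_eq_square field_simps)
    also have "(2 * real m + 1) ^ 2 / 4 * central_series 0 1 (Suc m) = real m ^ 2 * central_series 0 1 m - 1 / (2 * pi)"
      using central_series_0_1_Suc[of m] by simp
    also have "central_sq m * \<dots> = real m ^ 2 * central_sq m * central_series 0 1 m - central_sq m * (1 / (2 * pi))"
      by (simp add: algebra_simps)
    finally show ?case
      using Suc by (simp add: algebra_simps add_divide_distrib)
  qed simp
  note * = this[of m]
  assume "1 \<le> m"
  then have "central_series 0 1 m = - (1 / (2 * pi)) * (\<Sum>k<m. central_sq k) / (real m ^ 2 * central_sq m)"
    using * central_sq_pos[of m] by (intro eq_divide_imp) (simp_all add: mult.commute)
  then show ?thesis
    using \<open>1 \<le> m\<close> by (simp add: A_seq_def central_sq_def field_simps)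
qed

lemma B_seq_eq: "1 \<le> m \<Longrightarrow> B_seq m = central_series 0 2 m"
proof -
  have "real m ^ 2 * central_sq m * central_series 0 2 m
      = (\<Sum>k<m. central_sq k * ((real k * A_seq k + 1 / pi) / (2 * real k + 1)))" for m
  proof (induction m)
    case (Suc m)
    \<comment> \<open>At m = 0 the factor m hides the special value \<open>A_seq 0\<close>.\<close>
    have A: "real m * A_seq m = real m * central_series 0 1 m"
      by (cases "m = 0") (auto simp: A_seq_eq)
    have "real (Suc m) ^ 2 * central_sq (Suc m) * central_series 0 2 (Suc m)
        = central_sq m * ((2 * real m + 1) ^ 2 / 4 * central_series 0 2 (Suc m))"
      unfolding square_mult_central_sq_Suc by (simp add: power2_eq_square field_simps)
    also have "(2 * real m + 1) ^ 2 / 4 * central_series 0 2 (Suc m)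
        = real m ^ 2 * central_series 0 2 m + (real m * central_series 0 1 m - (2 * real m + 1) / 2 * central_series 0 1 (Suc m))"
      using central_series_0_2_Suc[of m] by simp
    also have "real m * central_series 0 1 m - (2 * real m + 1) / 2 * central_series 0 1 (Suc m)
        = (real m * A_seq m + 1 / pi) / (2 * real m + 1)"
    proof -
      \<comment> \<open>The factor 2m+1 completes the coefficient (2m+1)^2, so that
        \<open>central_series_0_1_Suc\<close> can eliminate the series of shift m+1.\<close>
      have "(2 * real m + 1) * (real m * central_series 0 1 m - (2 * real m + 1) / 2 * central_series 0 1 (Suc m))
        = (2 * real m + 1) * (real m * central_series 0 1 m) - 2 * (real m ^ 2 * central_series 0 1 m - 1 / (2 * pi))"
        using central_series_0_1_Suc[of m] by (simp add: algebra_simps power2_eq_square)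
      also have "\<dots> = real m * A_seq m + 1 / pi"
        unfolding A by (simp add: algebra_simps power2_eq_square)
      finally show ?thesis
        using two_n_plus_1_nonzero[of m] by (simp add: eq_divide_eq mult.commute)
    qed
    finally show ?case
      using Suc by (simp add: distrib_left mult.assoc[symmetric] mult.commute[of "central_sq m"])
  qed simp
  note * = this[of m]
  assume "1 \<le> m"
  then have "central_series 0 2 m = (\<Sum>k<m. central_sq k * ((real k * A_seq k + 1 / pi) / (2 * real k + 1))) / (real m ^ 2 * central_sq m)"
    using * central_sq_pos[of m] by (intro eq_divide_imp) (simp_all add: mult.commute)
  then show ?thesis
    using \<open>1 \<le> m\<close> by (simp add: B_seq_def central_sq_def field_simps)
qed

text \<open>O_0 = 0 removes the term at n = 0, so for p >= 1 summation from 0 and from 1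
  agree.\<close>

lemma central_term_Suc_sums:
  assumes "1 \<le> p" "p \<le> 2" "1 \<le> q"
  shows "(\<lambda>n. central_term p q m (Suc n)) sums central_series p q m"
proof -
  have "central_term p q m 0 = 0"
    using assms by (simp add: central_term_def)
  then show ?thesis
    using central_term_sums[OF assms(2,3), of m] by (simp add: sums_Suc_iff)
qed

lemma C_series_eq: "C_series m = central_series 1 1 m"
  using sums_unique[OF central_term_Suc_sums[of 1 1 m]]
  by (simp add: C_series_def central_term_def Let_def)

lemma E_series_eq: "E_series m = central_series 1 2 m"
  using sums_unique[OF central_term_Suc_sums[of 1 2 m]]
  by (simp add: E_series_def central_term_def Let_def)

lemma G_series_eq: "G_series m = central_series 2 1 m"
  using sums_unique[OF central_term_Suc_sums[of 2 1 m]]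
  by (simp add: G_series_def central_term_def Let_def)

section \<open>Integration over the unit interval\<close>

text \<open>The logarithms below are singular at an end point, so the primitive is extended by its
  one-sided limits before the fundamental theorem is applied.\<close>

lemma has_integral_unit_interval:
  fixes F f :: "real \<Rightarrow> real"
  assumes deriv: "\<And>t. 0 < t \<Longrightarrow> t < 1 \<Longrightarrow> (F has_real_derivative f t) (at t)"
    and F0: "(F \<longlongrightarrow> F0) (at_right 0)" and F1: "(F \<longlongrightarrow> F1) (at_left 1)"
  shows "(f has_integral (F1 - F0)) {0<..<1}"
proof -
  define G where "G = (\<lambda>t. if t \<le> 0 then F0 else if t \<ge> 1 then F1 else F t)"
  have G_eq: "eventually (\<lambda>t. G t = F t) (nhds t)" if "0 < t" "t < 1" for t
    using eventually_nhds_in_open[of "{0<..<1}" t] that by (auto elim!: eventually_mono simp: G_def)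
  have "(f has_integral (G 1 - G 0)) {0..1}"
  proof (rule fundamental_theorem_of_calculus_interior)
    show "continuous_on {0..1} G"
    proof (rule continuous_on_IccI)
      have "eventually (\<lambda>t. F t = G t) (at_right 0)"
        using eventually_at_right_less[of 0] eventually_at_right[of 0 1]
        by (auto simp: eventually_at_right[of 0 1] G_def intro!: exI[of _ 1])
      then show "(G \<longlongrightarrow> G 0) (at_right 0)"
        using F0 by (simp add: G_def tendsto_cong)
      have "eventually (\<lambda>t. F t = G t) (at_left 1)"
        by (auto simp: eventually_at_left[of 0 1] G_def intro!: exI[of _ 0])
      then show "(G \<longlongrightarrow> G 1) (at_left 1)"
        using F1 by (simp add: G_def tendsto_cong)
      show "G \<midarrow>t\<rightarrow> G t" if "0 < t" "t < 1" for t
      proof -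
        have "isCont F t"
          using deriv[OF that] by (rule DERIV_isCont)
        then have "isCont G t"
          using isCont_cong[OF G_eq[OF that]] by simp
        then show ?thesis
          by (simp add: isCont_def)
      qed
    qed simp
    show "(G has_vector_derivative f t) (at t)" if "t \<in> {0<..<1}" for t
    proof -
      have "(G has_real_derivative f t) (at t)"
        using deriv[of t] that G_eq[of t] by (subst DERIV_cong_ev[OF refl _ refl]) auto
      then show ?thesis
        by (simp add: has_real_derivative_iff_has_vector_derivative)
    qed
  qed simp
  then show ?thesis
    by (simp add: has_integral_Icc_iff_Ioo G_def)
qed

lemma absolutely_integrable_unit_interval:
  fixes f g :: "real \<Rightarrow> real"
  assumes "continuous_on {0<..<1} f" "g integrable_on {0<..<1}"
    and "\<And>t. 0 < t \<Longrightarrow> t < 1 \<Longrightarrow> \<bar>f t\<bar> \<le> g t"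
  shows "f absolutely_integrable_on {0<..<1}"
  by (rule measurable_bounded_by_integrable_imp_absolutely_integrable[OF _ _ assms(2)])
    (use assms in \<open>auto intro: continuous_imp_measurable_on_sets_lebesgue\<close>)

text \<open>Nonnegative partial sums are dominated by the full sum F itself, so integrability of F
  is the only majorant to be supplied.\<close>

lemma integral_sums_nonneg:
  fixes f :: "nat \<Rightarrow> real \<Rightarrow> real"
  assumes int: "\<And>n. (f n has_integral c n) S" and F: "F integrable_on S"
    and nonneg: "\<And>n t. t \<in> S \<Longrightarrow> f n t \<ge> 0"
    and sums: "\<And>t. t \<in> S \<Longrightarrow> (\<lambda>n. f n t) sums F t"
  shows "c sums integral S F"
proof -
  have part: "((\<lambda>t. \<Sum>n<N. f n t) has_integral (\<Sum>n<N. c n)) S" for N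
    by (intro has_integral_sum int) auto
  have "(\<lambda>N. integral S (\<lambda>t. \<Sum>n<N. f n t)) \<longlonglongrightarrow> integral S F"
  proof (rule dominated_convergence(2)[OF _ F])
    show "norm (\<Sum>n<N. f n t) \<le> F t" if "t \<in> S" for N t
      using sum_le_suminf[of "\<lambda>n. f n t" "{..<N}"] sums[OF that] nonneg[OF that]
      by (auto simp: sums_iff sum_nonneg)
    show "(\<lambda>N. \<Sum>n<N. f n t) \<longlonglongrightarrow> F t" if "t \<in> S" for t
      using sums[OF that] by (simp add: sums_def)
  qed (use part in blast)
  then show ?thesis
    using integral_unique[OF part] by (simp add: sums_def)
qed

section \<open>Square-integrable functions on the unit interval\<close>

definition square_int :: "(real \<Rightarrow> real) \<Rightarrow> bool" where
  "square_int f \<longleftrightarrow> continuous_on {0<..<1} f \<and> (\<lambda>t. f t ^ 2) integrable_on {0<..<1}"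

text \<open>The bound |f g| <= f^2 + g^2 settles the integrability of every product of two
  logarithms at once; continuity supplies measurability.\<close>

lemma square_int_mult:
  assumes "square_int f" "square_int g"
  shows "(\<lambda>t. f t * g t) absolutely_integrable_on {0<..<1}"
proof (rule absolutely_integrable_unit_interval)
  show "(\<lambda>t. f t ^ 2 + g t ^ 2) integrable_on {0<..<1}"
    using assms by (intro integrable_add) (auto simp: square_int_def)
  show "\<bar>f t * g t\<bar> \<le> f t ^ 2 + g t ^ 2" for t
    using sum_squares_bound[of "\<bar>f t\<bar>" "\<bar>g t\<bar>"] abs_ge_zero[of "f t * g t"]
    unfolding power2_abs abs_mult by linarith
qed (use assms in \<open>auto simp: square_int_def intro: continuous_intros\<close>)

lemma square_int_dominated:
  assumes "continuous_on {0<..<1} f" "square_int g" "\<And>t. 0 < t \<Longrightarrow> t < 1 \<Longrightarrow> \<bar>f t\<bar> \<le> C * \<bar>g t\<bar>"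
  shows "square_int f"
  unfolding square_int_def
proof
  have "(\<lambda>t. f t ^ 2) absolutely_integrable_on {0<..<1}"
  proof (rule absolutely_integrable_unit_interval)
    show "(\<lambda>t. C ^ 2 * g t ^ 2) integrable_on {0<..<1}"
      using assms by (intro integrable_on_mult_right) (auto simp: square_int_def)
    show "\<bar>f t ^ 2\<bar> \<le> C ^ 2 * g t ^ 2" if "0 < t" "t < 1" for t
      using power_mono[OF assms(3)[OF that], of 2] by (simp add: power_mult_distrib)
  qed (use assms in \<open>auto intro: continuous_intros\<close>)
  then show "(\<lambda>t. f t ^ 2) integrable_on {0<..<1}"
    by (simp add: set_lebesgue_integral_eq_integral(1))
qed (rule assms)

lemma square_int_const [intro, simp]: "square_int (\<lambda>t. c)"
  unfolding square_int_def using integrable_on_Icc_iff_Ioo[of "\<lambda>_. c ^ 2" 0 1] by auto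

lemma square_int_bounded_mult:
  assumes "continuous_on {0<..<1} f" "\<And>t. 0 < t \<Longrightarrow> t < 1 \<Longrightarrow> \<bar>f t\<bar> \<le> C" "square_int g"
  shows "square_int (\<lambda>t. f t * g t)"
proof (rule square_int_dominated[OF _ assms(3)])
  show "\<bar>f t * g t\<bar> \<le> C * \<bar>g t\<bar>" if "0 < t" "t < 1" for t
    using assms(2)[OF that] by (simp add: abs_mult mult_right_mono)
qed (use assms in \<open>auto simp: square_int_def intro: continuous_intros\<close>)

lemma square_int_bounded:
  assumes "continuous_on {0<..<1} f" "\<And>t. 0 < t \<Longrightarrow> t < 1 \<Longrightarrow> \<bar>f t\<bar> \<le> C"
  shows "square_int f"
  using square_int_bounded_mult[OF assms square_int_const[of 1]] by simp

lemma square_int_add [intro]: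
  assumes "square_int f" "square_int g"
  shows "square_int (\<lambda>t. f t + g t)"
  unfolding square_int_def
proof
  have "(\<lambda>t. f t * f t + 2 * (f t * g t) + g t * g t) integrable_on {0<..<1}"
    by (intro integrable_add integrable_on_mult_right set_lebesgue_integral_eq_integral(1) square_int_mult assms)
  then show "(\<lambda>t. (f t + g t) ^ 2) integrable_on {0<..<1}"
    by (simp add: power2_eq_square algebra_simps)
qed (use assms in \<open>auto simp: square_int_def intro: continuous_intros\<close>)

lemma square_int_cmult [intro]: "square_int f \<Longrightarrow> square_int (\<lambda>t. c * f t)"
  by (rule square_int_bounded_mult[of _ "\<bar>c\<bar>"]) auto

lemma square_int_minus [intro]: "square_int f \<Longrightarrow> square_int (\<lambda>t. - f t)"
  using square_int_cmult[of f "-1"] by simp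

lemma square_int_diff [intro]: "square_int f \<Longrightarrow> square_int g \<Longrightarrow> square_int (\<lambda>t. f t - g t)"
  using square_int_add[of f "\<lambda>t. - g t"] by auto

lemma has_integral_ln_square_power:
  "((\<lambda>t. t ^ n * ln t ^ 2) has_integral (2 / real (Suc n) ^ 3)) {0<..<1}"
proof -
  define c where "c = real (Suc n)"
  have c: "c > 0"
    by (simp add: c_def)
  define F where "F = (\<lambda>t::real. t ^ Suc n * (ln t ^ 2 / c - 2 * ln t / c ^ 2 + 2 / c ^ 3))"
  have "((\<lambda>t. t ^ n * ln t ^ 2) has_integral (2 / c ^ 3 - 0)) {0<..<1}"
  proof (rule has_integral_unit_interval)
    show "(F has_real_derivative t ^ n * ln t ^ 2) (at t)" if "0 < t" "t < 1" for t
    proof -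
      have "((\<lambda>t. ln t ^ 2 / c - 2 * ln t / c ^ 2 + 2 / c ^ 3) has_real_derivative (2 * ln t / c - 2 / c ^ 2) / t) (at t)"
        using that c by (auto intro!: derivative_eq_intros simp: field_simps power2_eq_square)
      from DERIV_mult[OF DERIV_pow[of "Suc n" t] this]
      show ?thesis
        using that c
        by (simp add: F_def c_def[symmetric] field_simps power2_eq_square power3_eq_cube del: of_nat_Suc)
    qed
    have "((\<lambda>t. t * (ln t ^ 2 / c - 2 * ln t / c ^ 2 + 2 / c ^ 3)) \<longlongrightarrow> 0) (at_right 0)"
      using c by real_asymp
    then have "((\<lambda>t. t ^ n * (t * (ln t ^ 2 / c - 2 * ln t / c ^ 2 + 2 / c ^ 3))) \<longlongrightarrow> 0 ^ n * 0) (at_right 0)"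
      by (intro tendsto_mult tendsto_power tendsto_ident_at)
    then show "(F \<longlongrightarrow> 0) (at_right 0)"
      by (simp add: F_def mult_ac)
    show "(F \<longlongrightarrow> 2 / c ^ 3) (at_left 1)"
    proof -
      have "((\<lambda>t. ln t ^ 2 / c - 2 * ln t / c ^ 2 + 2 / c ^ 3) \<longlongrightarrow> 2 / c ^ 3) (at_left 1)"
        using c by real_asymp
      then have "(F \<longlongrightarrow> 1 ^ Suc n * (2 / c ^ 3)) (at_left 1)"
        unfolding F_def by (intro tendsto_mult tendsto_power tendsto_ident_at)
      then show ?thesis
        by simp
    qed
  qed
  then show ?thesis
    by (simp add: c_def)
qed

lemma square_int_ln [intro, simp]: "square_int ln"
  using has_integral_ln_square_power[of 0]
  by (auto simp: square_int_def has_integral_integrable intro!: continuous_intros)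

lemma has_integral_reflect_unit_interval:
  fixes f :: "real \<Rightarrow> real"
  shows "((\<lambda>t. f (1 - t)) has_integral c) {0<..<1} \<longleftrightarrow> (f has_integral c) {0<..<1}"
proof -
  have *: "((\<lambda>t. f (1 - t)) has_integral c) {0..1}" if "(f has_integral c) {0..1}" for f :: "real \<Rightarrow> real"
    using has_integral_affinity[OF that[folded box_real(2)], of "-1" 1] by (simp add: image_affinity_atLeastAtMost_diff)
  show ?thesis
    using *[of f] *[of "\<lambda>t. f (1 - t)"] by (auto simp: has_integral_Icc_iff_Ioo[symmetric])
qed

lemma square_int_ln_1_minus [intro, simp]: "square_int (\<lambda>t. ln (1 - t))"
  unfolding square_int_def
proof
  have "((\<lambda>t. ln t ^ 2) has_integral 2) {0<..<1::real}"
    using has_integral_ln_square_power[of 0] by simp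
  then have "((\<lambda>t. ln (1 - t) ^ 2) has_integral 2) {0<..<1::real}"
    using has_integral_reflect_unit_interval[of "\<lambda>t. ln t ^ 2" 2] by simp
  then show "(\<lambda>t. ln (1 - t) ^ 2) integrable_on {0<..<1::real}"
    by blast
qed (auto intro!: continuous_intros)

lemma square_int_ln_1_plus [intro, simp]: "square_int (\<lambda>t. ln (1 + t))"
  by (rule square_int_bounded[of _ "ln 2"]) (auto intro!: continuous_intros)

lemma square_int_ln_1_plus_square [intro, simp]: "square_int (\<lambda>t. ln (1 + t ^ 2))"
proof (rule square_int_bounded[of _ "ln 2"])
  show "\<bar>ln (1 + t ^ 2)\<bar> \<le> ln 2" if "0 < t" "t < 1" for t :: real
    using that power_le_one[of t 2] by (simp add: add_pos_nonneg)
  show "continuous_on {0<..<1} (\<lambda>t::real. ln (1 + t ^ 2))"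
    by (intro continuous_intros) (metis add_pos_nonneg less_irrefl zero_le_power2 zero_less_one)
qed

section \<open>The inner product in the half-angle variable\<close>

definition half_angle_weight :: "real \<Rightarrow> real" where
  "half_angle_weight t = 2 / (1 + t ^ 2)"

lemma one_plus_square_pos [simp]: "1 + (t::real) ^ 2 > 0" "1 + (t::real) ^ 2 \<noteq> 0"
  by (simp_all add: add_pos_nonneg add_nonneg_eq_0_iff)

lemma half_angle_weight_bounds: "0 < half_angle_weight t" "half_angle_weight t \<le> 2"
  by (simp_all add: half_angle_weight_def divide_le_eq)

lemma continuous_on_half_angle_weight [continuous_intros]: "continuous_on A half_angle_weight"
  unfolding half_angle_weight_def by (intro continuous_intros) auto

text \<open>With t = tan(phi/2) the weight is dphi/dt, so this is the integral of f g over phi from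
  0 to pi/2.\<close>

definition bracket :: "(real \<Rightarrow> real) \<Rightarrow> (real \<Rightarrow> real) \<Rightarrow> real" where
  "bracket f g = integral {0<..<1} (\<lambda>t. f t * g t * half_angle_weight t)"

lemma square_int_weight: "square_int g \<Longrightarrow> square_int (\<lambda>t. g t * half_angle_weight t)"
  using square_int_bounded_mult[of half_angle_weight 2 g] half_angle_weight_bounds
  by (simp add: continuous_intros mult.commute less_imp_le)

lemma bracket_integrable:
  "square_int f \<Longrightarrow> square_int g \<Longrightarrow> (\<lambda>t. f t * g t * half_angle_weight t) absolutely_integrable_on {0<..<1}"
  using square_int_mult[OF _ square_int_weight, of f g] by (simp add: mult.assoc)

lemma bracket_has_integral:
  "square_int f \<Longrightarrow> square_int g \<Longrightarrow> ((\<lambda>t. f t * g t * half_angle_weight t) has_integral bracket f g) {0<..<1}"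
  unfolding bracket_def using bracket_integrable[of f g]
  by (simp add: integrable_integral set_lebesgue_integral_eq_integral(1))

lemma bracket_commute: "bracket f g = bracket g f"
  by (simp add: bracket_def mult_ac)

lemma bracket_add_left:
  assumes "square_int f" "square_int g" "square_int h"
  shows "bracket (\<lambda>t. f t + g t) h = bracket f h + bracket g h"
  unfolding bracket_def[of "\<lambda>t. f t + g t"]
  by (rule integral_unique)
    (use has_integral_add[OF bracket_has_integral[OF assms(1,3)] bracket_has_integral[OF assms(2,3)]]
     in \<open>simp add: algebra_simps\<close>)

lemma bracket_cmult_left: "bracket (\<lambda>t. c * f t) h = c * bracket f h"
  by (simp add: bracket_def mult.assoc)

lemma bracket_minus_left: "bracket (\<lambda>t. - f t) h = - bracket f h"
  using bracket_cmult_left[of "-1" f h] by simp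

lemma bracket_diff_left:
  assumes "square_int f" "square_int g" "square_int h"
  shows "bracket (\<lambda>t. f t - g t) h = bracket f h - bracket g h"
  using bracket_add_left[of f "\<lambda>t. - g t" h] assms by (simp add: bracket_minus_left square_int_minus)

lemma bracket_right:
  "square_int f \<Longrightarrow> square_int g \<Longrightarrow> square_int h \<Longrightarrow> bracket h (\<lambda>t. f t + g t) = bracket h f + bracket h g"
  "square_int f \<Longrightarrow> square_int g \<Longrightarrow> square_int h \<Longrightarrow> bracket h (\<lambda>t. f t - g t) = bracket h f - bracket h g"
  "bracket h (\<lambda>t. c * f t) = c * bracket h f" "bracket h (\<lambda>t. - f t) = - bracket h f"
  by (simp_all add: bracket_commute[of h] bracket_add_left bracket_diff_left bracket_cmult_left bracket_minus_left)

lemma bracket_cong: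
  assumes "\<And>t. 0 < t \<Longrightarrow> t < 1 \<Longrightarrow> f t = f' t" "\<And>t. 0 < t \<Longrightarrow> t < 1 \<Longrightarrow> g t = g' t"
  shows "bracket f g = bracket f' g'"
  unfolding bracket_def by (rule integral_cong) (use assms in auto)

section \<open>The Cayley map\<close>

lemma cayley_image: "(\<lambda>t. (1 - t) / (1 + t)) ` {0<..<1} = {0<..<1::real}"
proof (intro set_eqI iffI)
  fix x :: real assume "x \<in> {0<..<1}"
  then have "x = (1 - (1 - x) / (1 + x)) / (1 + (1 - x) / (1 + x))" "(1 - x) / (1 + x) \<in> {0<..<1}"
    by (auto simp: field_simps)
  then show "x \<in> (\<lambda>t. (1 - t) / (1 + t)) ` {0<..<1}"
    by (rule image_eqI)
qed (auto simp: field_simps)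

lemma cayley_inj: "inj_on (\<lambda>t. (1 - t) / (1 + t)) {0<..<1::real}"
  by (rule inj_onI) (auto simp: field_simps)

lemma integral_cayley:
  fixes f :: "real \<Rightarrow> real"
  assumes "f absolutely_integrable_on {0<..<1}"
  shows "(\<lambda>t. 2 / (1 + t) ^ 2 * f ((1 - t) / (1 + t))) absolutely_integrable_on {0<..<1}"
    and "integral {0<..<1} (\<lambda>t. 2 / (1 + t) ^ 2 * f ((1 - t) / (1 + t))) = integral {0<..<1} f"
proof -
  have der: "((\<lambda>t. (1 - t) / (1 + t)) has_field_derivative (- 2 / (1 + t) ^ 2)) (at t within {0<..<1})"
    if "t \<in> {0<..<1}" for t :: real
    using that by (auto intro!: derivative_eq_intros simp: field_simps power2_eq_square)
  have "(\<lambda>t. \<bar>- 2 / (1 + t) ^ 2\<bar> * f ((1 - t) / (1 + t))) absolutely_integrable_on {0<..<1} \<and>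
      integral {0<..<1} (\<lambda>t. \<bar>- 2 / (1 + t) ^ 2\<bar> * f ((1 - t) / (1 + t))) = integral {0<..<1} f"
    by (rule iffD2[OF has_absolute_integral_change_of_variables_1'[OF _ der cayley_inj]])
      (use assms in \<open>auto simp: cayley_image\<close>)
  then show "(\<lambda>t. 2 / (1 + t) ^ 2 * f ((1 - t) / (1 + t))) absolutely_integrable_on {0<..<1}"
    "integral {0<..<1} (\<lambda>t. 2 / (1 + t) ^ 2 * f ((1 - t) / (1 + t))) = integral {0<..<1} f"
    by simp_all
qed

text \<open>If t = tan(phi/2), then (1-t)/(1+t) is tan((pi/2 - phi)/2): the map is a reflection of
  the angle and preserves dphi.\<close>

lemma half_angle_weight_cayley:
  assumes "0 < t"
  shows "2 / (1 + t) ^ 2 * half_angle_weight ((1 - t) / (1 + t)) = half_angle_weight t"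
proof -
  have "2 / y ^ 2 * (2 / (1 + (x / y) ^ 2)) = 4 / (y ^ 2 + x ^ 2)" if "y \<noteq> 0" for x y :: real
  proof -
    have "1 + (x / y) ^ 2 = (y ^ 2 + x ^ 2) / y ^ 2"
      using that by (simp add: power_divide add_divide_distrib)
    then show ?thesis
      using that by simp
  qed
  from this[of "1 + t" "1 - t"] have "2 / (1 + t) ^ 2 * half_angle_weight ((1 - t) / (1 + t))
      = 4 / ((1 + t) ^ 2 + (1 - t) ^ 2)"
    using assms by (simp add: half_angle_weight_def)
  also have "(1 + t) ^ 2 + (1 - t) ^ 2 = 2 * (1 + t ^ 2)"
    by (simp add: power2_eq_square algebra_simps)
  also have "4 / (2 * (1 + t ^ 2)) = half_angle_weight t"
    unfolding half_angle_weight_def by (rule frac_eq_eq[THEN iffD2]) (auto simp del: distrib_left_numeral)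
  finally show ?thesis .
qed

lemma bracket_cayley:
  assumes "square_int f" "square_int g"
  shows "bracket f g = bracket (\<lambda>t. f ((1 - t) / (1 + t))) (\<lambda>t. g ((1 - t) / (1 + t)))"
proof -
  have "bracket f g = integral {0<..<1} (\<lambda>t. 2 / (1 + t) ^ 2 * (f ((1 - t) / (1 + t)) * g ((1 - t) / (1 + t))
      * half_angle_weight ((1 - t) / (1 + t))))"
    unfolding bracket_def by (rule integral_cayley(2)[OF bracket_integrable[OF assms], symmetric])
  also have "\<dots> = bracket (\<lambda>t. f ((1 - t) / (1 + t))) (\<lambda>t. g ((1 - t) / (1 + t)))"
    unfolding bracket_def
  proof (rule integral_cong)
    fix t :: real assume "t \<in> {0<..<1}"
    then have t: "0 < t"
      by simp
    show "2 / (1 + t) ^ 2 * (f ((1 - t) / (1 + t)) * g ((1 - t) / (1 + t)) * half_angle_weight ((1 - t) / (1 + t)))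
        = f ((1 - t) / (1 + t)) * g ((1 - t) / (1 + t)) * half_angle_weight t"
      unfolding half_angle_weight_cayley[OF t, symmetric] by (simp only: mult_ac)
  qed
  finally show ?thesis .
qed

section \<open>Trigonometric moments in half-angle form\<close>

text \<open>The sign makes it nonnegative on the unit interval, as the termwise integration in
  \<open>bracket_sums\<close> demands.\<close>

definition neg_ln :: "real \<Rightarrow> real" where
  "neg_ln t = - ln t"

lemma neg_ln_nonneg: "0 < t \<Longrightarrow> t < 1 \<Longrightarrow> 0 \<le> neg_ln t"
  by (simp add: neg_ln_def)

lemma neg_ln_deriv: "0 < t \<Longrightarrow> (neg_ln has_real_derivative - (1 / t)) (at t)"
  unfolding neg_ln_def[abs_def] by (auto intro!: derivative_eq_intros)

lemma square_int_neg_ln: "square_int neg_ln"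
  unfolding neg_ln_def[abs_def] by auto

definition half_sin :: "real \<Rightarrow> real" where
  "half_sin t = 2 * t / (1 + t ^ 2)"

definition half_cos :: "real \<Rightarrow> real" where
  "half_cos t = (1 - t ^ 2) / (1 + t ^ 2)"

lemma half_sin_cos_square: "half_sin t ^ 2 + half_cos t ^ 2 = 1"
proof -
  have "(2 * t) ^ 2 + (1 - t ^ 2) ^ 2 = (1 + t ^ 2) ^ 2"
    by algebra
  then show ?thesis
    by (simp add: half_sin_def half_cos_def power_divide add_divide_distrib[symmetric])
qed

lemma half_sin_bounds: "0 < t \<Longrightarrow> t < 1 \<Longrightarrow> 0 < half_sin t" "0 < t \<Longrightarrow> t < 1 \<Longrightarrow> half_sin t < 1"
proof -
  assume t: "0 < t" "t < 1"
  then show "0 < half_sin t"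
    by (simp add: half_sin_def)
  have "0 < (1 - t) ^ 2"
    using t by simp
  then have "2 * t < 1 + t ^ 2"
    by (simp add: power2_eq_square algebra_simps)
  then show "half_sin t < 1"
    by (simp add: half_sin_def)
qed

lemma half_cos_bounds: "0 < t \<Longrightarrow> t < 1 \<Longrightarrow> 0 < half_cos t" "0 < t \<Longrightarrow> t < 1 \<Longrightarrow> half_cos t < 1"
  by (auto simp: half_cos_def power_less_one_iff)

lemma half_sin_over: "t \<noteq> 0 \<Longrightarrow> half_sin t / t = half_angle_weight t"
  by (simp add: half_sin_def half_angle_weight_def)

lemma half_sin_deriv: "(half_sin has_real_derivative half_cos t * half_angle_weight t) (at t)"
proof -
  have "(half_sin has_real_derivative (2 * (1 + t ^ 2) - 2 * t * (2 * t)) / (1 + t ^ 2) ^ 2) (at t)"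
    unfolding half_sin_def[abs_def] by (auto intro!: derivative_eq_intros simp: power2_eq_square[of "1 + t ^ 2"])
  also have "(2 * (1 + t ^ 2) - 2 * t * (2 * t)) / (1 + t ^ 2) ^ 2 = half_cos t * half_angle_weight t"
    by (simp add: half_cos_def half_angle_weight_def power2_eq_square algebra_simps)
  finally show ?thesis .
qed

lemma half_cos_deriv: "(half_cos has_real_derivative - half_sin t * half_angle_weight t) (at t)"
proof -
  have "(half_cos has_real_derivative (- (2 * t) * (1 + t ^ 2) - (1 - t ^ 2) * (2 * t)) / (1 + t ^ 2) ^ 2) (at t)"
    unfolding half_cos_def[abs_def] by (auto intro!: derivative_eq_intros simp: power2_eq_square[of "1 + t ^ 2"])
  also have "(- (2 * t) * (1 + t ^ 2) - (1 - t ^ 2) * (2 * t)) / (1 + t ^ 2) ^ 2 = - half_sin t * half_angle_weight t"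
    by (simp add: half_sin_def half_angle_weight_def power2_eq_square algebra_simps)
  finally show ?thesis .
qed

lemma half_cos_eq_sqrt: "0 < t \<Longrightarrow> t < 1 \<Longrightarrow> half_cos t = sqrt (1 - half_sin t ^ 2)"
  using half_sin_cos_square[of t] half_cos_bounds[of t] by (intro real_sqrt_unique[symmetric]) auto

lemma continuous_on_half_sin [continuous_intros]: "continuous_on A half_sin"
  and continuous_on_half_cos [continuous_intros]: "continuous_on A half_cos"
  unfolding half_sin_def half_cos_def by (auto intro!: continuous_intros)

lemma square_int_half_sin_power_mult [intro]: "square_int g \<Longrightarrow> square_int (\<lambda>t. half_sin t ^ n * g t)"
proof (rule square_int_bounded_mult)
  show "\<bar>half_sin t ^ n\<bar> \<le> 1" if "0 < t" "t < 1" for t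
    using half_sin_bounds[OF that] by (simp add: power_le_one less_imp_le)
qed (auto intro!: continuous_intros)

lemma square_int_half_sin_power: "square_int (\<lambda>t. half_sin t ^ n)"
  using square_int_half_sin_power_mult[OF square_int_const[of 1], of n] by simp

lemma square_int_half_cos: "square_int half_cos"
  by (rule square_int_bounded[of _ 1])
    (use half_cos_bounds in \<open>auto intro!: continuous_intros simp: less_imp_le\<close>)

lemmas square_int_intros = square_int_const square_int_neg_ln square_int_half_cos square_int_half_sin_power
  square_int_half_sin_power_mult

text \<open>The integrand is the derivative of sin^(n+1) g, and b is its value at phi = pi/2. The
  choices g = 1, cos, -ln t, and cos times -ln t or its square yield the moment identities below.
  Only sin * g has to vanish at 0, so g may have a logarithmic singularity there.\<close>

lemma half_sin_power_integral:
  assumes "\<And>t. 0 < t \<Longrightarrow> t < 1 \<Longrightarrow> (g has_real_derivative g' t) (at t)"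
    and "((\<lambda>t. half_sin t * g t) \<longlongrightarrow> 0) (at_right 0)" and "(g \<longlongrightarrow> b) (at_left 1)"
  shows "((\<lambda>t. half_sin t ^ n * (real (Suc n) * (half_cos t * half_angle_weight t) * g t + half_sin t * g' t)) has_integral b) {0<..<1}"
proof -
  have s0: "(half_sin \<longlongrightarrow> 0) (at_right 0)" and s1: "(half_sin \<longlongrightarrow> 1) (at_left 1)"
    unfolding half_sin_def[abs_def] by real_asymp+
  have "((\<lambda>t. half_sin t ^ n * (real (Suc n) * (half_cos t * half_angle_weight t) * g t + half_sin t * g' t))
      has_integral 1 ^ Suc n * b - 0 ^ n * 0) {0<..<1}"
  proof (rule has_integral_unit_interval)
    show "((\<lambda>t. half_sin t ^ Suc n * g t) has_real_derivative
        half_sin t ^ n * (real (Suc n) * (half_cos t * half_angle_weight t) * g t + half_sin t * g' t)) (at t)"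
      if "0 < t" "t < 1" for t
      using DERIV_mult[OF DERIV_power[OF half_sin_deriv, of "Suc n" t] assms(1)[OF that]]
      by (simp add: algebra_simps del: of_nat_Suc)
    show "((\<lambda>t. half_sin t ^ Suc n * g t) \<longlongrightarrow> 0 ^ n * 0) (at_right 0)"
      using tendsto_mult[OF tendsto_power[OF s0, of n] assms(2)] by (simp add: mult_ac)
    show "((\<lambda>t. half_sin t ^ Suc n * g t) \<longlongrightarrow> 1 ^ Suc n * b) (at_left 1)"
      by (intro tendsto_mult tendsto_power s1 assms)
  qed
  then show ?thesis
    by simp
qed

section \<open>Moments of the powers of the sine\<close>

definition wallis_int :: "nat \<Rightarrow> real" where
  "wallis_int n = bracket (\<lambda>t. half_sin t ^ n) (\<lambda>_. 1)"

definition log_moment :: "nat \<Rightarrow> real" where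
  "log_moment n = bracket (\<lambda>t. half_sin t ^ n) neg_ln"

definition log_cos_moment :: "nat \<Rightarrow> real" where
  "log_cos_moment n = bracket (\<lambda>t. half_sin t ^ n * half_cos t) neg_ln"

definition log2_moment :: "nat \<Rightarrow> real" where
  "log2_moment n = bracket (\<lambda>t. half_sin t ^ n * neg_ln t) neg_ln"

lemma wallis_int_0: "wallis_int 0 = pi / 2"
proof -
  have "(half_angle_weight has_integral (pi / 2 - 0)) {0<..<1}"
  proof (rule has_integral_unit_interval)
    show "((\<lambda>t. 2 * arctan t) has_real_derivative half_angle_weight t) (at t)" for t
      by (auto intro!: derivative_eq_intros simp: half_angle_weight_def inverse_eq_divide)
    have "((\<lambda>t::real. 2 * arctan t) \<longlongrightarrow> 2 * arctan 0) (at_right 0)"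
      by (intro tendsto_intros)
    then show "((\<lambda>t::real. 2 * arctan t) \<longlongrightarrow> 0) (at_right 0)"
      by simp
    have "((\<lambda>t::real. 2 * arctan t) \<longlongrightarrow> 2 * arctan 1) (at_left 1)"
      by (intro tendsto_intros)
    then show "((\<lambda>t::real. 2 * arctan t) \<longlongrightarrow> pi / 2) (at_left 1)"
      by (simp add: arctan_one)
  qed
  then show ?thesis
    by (simp add: wallis_int_def bracket_def integral_unique)
qed

text \<open>The algebra behind four of these choices of g: s and c are sine and cosine, w is the
  weight, u = -ln t, i = 1/t, p = s^n and N = n. The relation s * i = w says that -ln t has
  derivative -1/sin(phi) with respect to phi.\<close>

lemma half_sin_power_identities:
  fixes c s w p N u i :: real
  assumes "c ^ 2 = 1 - s ^ 2"
  shows "p * ((N + 1) * (c * w) * c + s * (- s * w)) = (N + 1) * (p * 1 * w) - (N + 2) * ((p * s ^ 2) * 1 * w)"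
    and "s * i = w \<Longrightarrow> p * ((N + 1) * (c * w) * u + s * - i) = (N + 1) * (p * c * u * w) - p * 1 * w"
    and "s * i = w \<Longrightarrow> p * ((N + 1) * (c * w) * (c * u) + s * (- s * w * u + - i * c))
      = (N + 1) * (p * u * w) - (N + 2) * ((p * s ^ 2) * u * w) - p * c * w"
    and "s * i = w \<Longrightarrow> p * ((N + 1) * (c * w) * (c * u * u) + s * ((- s * w * u + - i * c) * u + - i * (c * u)))
      = (N + 1) * (p * u * u * w) - (N + 2) * ((p * s ^ 2) * u * u * w) - 2 * (p * c * u * w)"
proof -
  show "p * ((N + 1) * (c * w) * c + s * (- s * w)) = (N + 1) * (p * 1 * w) - (N + 2) * ((p * s ^ 2) * 1 * w)"
    using assms by algebra
  assume si: "s * i = w"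
  show "p * ((N + 1) * (c * w) * u + s * - i) = (N + 1) * (p * c * u * w) - p * 1 * w"
    "p * ((N + 1) * (c * w) * (c * u) + s * (- s * w * u + - i * c))
      = (N + 1) * (p * u * w) - (N + 2) * ((p * s ^ 2) * u * w) - p * c * w"
    "p * ((N + 1) * (c * w) * (c * u * u) + s * ((- s * w * u + - i * c) * u + - i * (c * u)))
      = (N + 1) * (p * u * u * w) - (N + 2) * ((p * s ^ 2) * u * u * w) - 2 * (p * c * u * w)"
    subgoal using si by (auto simp: algebra_simps)
    subgoal using assms si by algebra
    subgoal using assms si by algebra
    done
qed

lemma half_cos_square: "half_cos t ^ 2 = 1 - half_sin t ^ 2"
  using half_sin_cos_square[of t] by (simp add: algebra_simps)

lemma half_sin_times_inverse: "0 < t \<Longrightarrow> half_sin t * (1 / t) = half_angle_weight t"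
  using half_sin_over[of t] by simp

lemma Suc_power_expand:
  "real (Suc n) = real n + 1" "real (n + 1) = real n + 1" "real (n + 2) = real n + 2"
  "(x::real) ^ (n + 2) = x ^ n * x ^ 2"
  by (simp_all add: power2_eq_square)

lemma wallis_int_Suc_Suc: "real (n + 2) * wallis_int (n + 2) = real (n + 1) * wallis_int n"
proof -
  have "((\<lambda>t. half_sin t ^ n * (real (Suc n) * (half_cos t * half_angle_weight t) * half_cos t
      + half_sin t * (- half_sin t * half_angle_weight t))) has_integral 0) {0<..<1}"
    by (rule half_sin_power_integral[OF half_cos_deriv]) (unfold half_sin_def half_cos_def, real_asymp+)
  moreover have "half_sin t ^ n * (real (Suc n) * (half_cos t * half_angle_weight t) * half_cos t
      + half_sin t * (- half_sin t * half_angle_weight t))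
    = real (n + 1) * (half_sin t ^ n * 1 * half_angle_weight t) - real (n + 2) * (half_sin t ^ (n + 2) * 1 * half_angle_weight t)" for t
    unfolding Suc_power_expand by (rule half_sin_power_identities(1)[OF half_cos_square])
  ultimately have "((\<lambda>t. real (n + 1) * (half_sin t ^ n * 1 * half_angle_weight t)
      - real (n + 2) * (half_sin t ^ (n + 2) * 1 * half_angle_weight t)) has_integral 0) {0<..<1}"
    by simp
  moreover have "((\<lambda>t. real (n + 1) * (half_sin t ^ n * 1 * half_angle_weight t)
      - real (n + 2) * (half_sin t ^ (n + 2) * 1 * half_angle_weight t))
      has_integral (real (n + 1) * wallis_int n - real (n + 2) * wallis_int (n + 2))) {0<..<1}"
    unfolding wallis_int_def by (intro has_integral_diff has_integral_mult_right bracket_has_integral square_int_intros)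
  ultimately have "0 = real (n + 1) * wallis_int n - real (n + 2) * wallis_int (n + 2)"
    by (rule has_integral_unique)
  then show ?thesis
    by simp
qed

lemma half_sin_power_half_cos_integral:
  "((\<lambda>t. half_sin t ^ n * half_cos t * half_angle_weight t) has_integral 1 / real (Suc n)) {0<..<1}"
proof -
  have "((\<lambda>t. half_sin t ^ n * (real (Suc n) * (half_cos t * half_angle_weight t) * 1 + half_sin t * 0)) has_integral 1) {0<..<1}"
    by (rule half_sin_power_integral) (unfold half_sin_def half_cos_def, auto, real_asymp)
  from has_integral_mult_right[OF this, of "1 / real (Suc n)"] show ?thesis
    by (simp add: mult_ac del: of_nat_Suc)
qed

lemma half_cos_log_deriv:
  "0 < t \<Longrightarrow> ((\<lambda>t. half_cos t * neg_ln t) has_real_derivative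
     (- half_sin t * half_angle_weight t * neg_ln t + - (1 / t) * half_cos t)) (at t)"
  by (rule DERIV_mult[OF half_cos_deriv neg_ln_deriv])

lemma log_cos_moment_eq: "real (Suc n) * log_cos_moment n = wallis_int n"
proof -
  have "((\<lambda>t. half_sin t ^ n * (real (Suc n) * (half_cos t * half_angle_weight t) * neg_ln t + half_sin t * - (1 / t)))
      has_integral 0) {0<..<1}"
  proof (rule half_sin_power_integral[OF neg_ln_deriv])
    show "((\<lambda>t. half_sin t * neg_ln t) \<longlongrightarrow> 0) (at_right 0)" "(neg_ln \<longlongrightarrow> 0) (at_left 1)"
      unfolding half_sin_def neg_ln_def[abs_def] by real_asymp+
  qed
  then have "((\<lambda>t. real (Suc n) * (half_sin t ^ n * half_cos t * neg_ln t * half_angle_weight t) - half_sin t ^ n * 1 * half_angle_weight t)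
      has_integral 0) {0<..<1}"
  proof (rule has_integral_eq[rotated])
    fix t :: real assume t: "t \<in> {0<..<1}"
    show "half_sin t ^ n * (real (Suc n) * (half_cos t * half_angle_weight t) * neg_ln t + half_sin t * - (1 / t))
      = real (Suc n) * (half_sin t ^ n * half_cos t * neg_ln t * half_angle_weight t) - half_sin t ^ n * 1 * half_angle_weight t"
      unfolding Suc_power_expand
      by (rule half_sin_power_identities(2)[OF half_cos_square half_sin_times_inverse]) (use t in simp)
  qed
  moreover have "((\<lambda>t. real (Suc n) * (half_sin t ^ n * half_cos t * neg_ln t * half_angle_weight t) - half_sin t ^ n * 1 * half_angle_weight t)
      has_integral (real (Suc n) * log_cos_moment n - wallis_int n)) {0<..<1}"
    unfolding wallis_int_def log_cos_moment_def
    by (intro has_integral_diff has_integral_mult_right bracket_has_integral square_int_intros)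
  ultimately have "0 = real (Suc n) * log_cos_moment n - wallis_int n"
    by (rule has_integral_unique)
  then show ?thesis
    by simp
qed

lemma log_moment_Suc_Suc: "real (n + 2) * log_moment (n + 2) = real (n + 1) * log_moment n - 1 / real (n + 1)"
proof -
  have "((\<lambda>t. half_sin t ^ n * (real (Suc n) * (half_cos t * half_angle_weight t) * (half_cos t * neg_ln t)
      + half_sin t * (- half_sin t * half_angle_weight t * neg_ln t + - (1 / t) * half_cos t))) has_integral 0) {0<..<1}"
  proof (rule half_sin_power_integral[OF half_cos_log_deriv])
    show "((\<lambda>t. half_sin t * (half_cos t * neg_ln t)) \<longlongrightarrow> 0) (at_right 0)" "((\<lambda>t. half_cos t * neg_ln t) \<longlongrightarrow> 0) (at_left 1)"
      unfolding half_sin_def half_cos_def neg_ln_def by real_asymp+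
  qed
  then have "((\<lambda>t. real (n + 1) * (half_sin t ^ n * neg_ln t * half_angle_weight t)
      - real (n + 2) * (half_sin t ^ (n + 2) * neg_ln t * half_angle_weight t)
      - half_sin t ^ n * half_cos t * half_angle_weight t) has_integral 0) {0<..<1}"
  proof (rule has_integral_eq[rotated])
    fix t :: real assume t: "t \<in> {0<..<1}"
    show "half_sin t ^ n * (real (Suc n) * (half_cos t * half_angle_weight t) * (half_cos t * neg_ln t)
      + half_sin t * (- half_sin t * half_angle_weight t * neg_ln t + - (1 / t) * half_cos t)) =
      real (n + 1) * (half_sin t ^ n * neg_ln t * half_angle_weight t)
      - real (n + 2) * (half_sin t ^ (n + 2) * neg_ln t * half_angle_weight t)
      - half_sin t ^ n * half_cos t * half_angle_weight t"
      unfolding Suc_power_expand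
      by (rule half_sin_power_identities(3)[OF half_cos_square half_sin_times_inverse]) (use t in simp)
  qed
  moreover have "((\<lambda>t. real (n + 1) * (half_sin t ^ n * neg_ln t * half_angle_weight t)
      - real (n + 2) * (half_sin t ^ (n + 2) * neg_ln t * half_angle_weight t)
      - half_sin t ^ n * half_cos t * half_angle_weight t)
      has_integral (real (n + 1) * log_moment n - real (n + 2) * log_moment (n + 2) - 1 / real (Suc n))) {0<..<1}"
    unfolding log_moment_def
    by (intro has_integral_diff has_integral_mult_right bracket_has_integral half_sin_power_half_cos_integral square_int_intros)
  ultimately have "0 = real (n + 1) * log_moment n - real (n + 2) * log_moment (n + 2) - 1 / real (Suc n)"
    by (rule has_integral_unique)
  then show ?thesis
    by simp
qed

lemma log2_moment_Suc_Suc: "real (n + 2) * log2_moment (n + 2) = real (n + 1) * log2_moment n - 2 * log_cos_moment n"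
proof -
  have "((\<lambda>t. half_sin t ^ n * (real (Suc n) * (half_cos t * half_angle_weight t) * (half_cos t * neg_ln t * neg_ln t)
      + half_sin t * ((- half_sin t * half_angle_weight t * neg_ln t + - (1 / t) * half_cos t) * neg_ln t + - (1 / t) * (half_cos t * neg_ln t))))
      has_integral 0) {0<..<1}"
  proof (rule half_sin_power_integral[OF DERIV_mult[OF half_cos_log_deriv neg_ln_deriv]])
    show "((\<lambda>t. half_sin t * (half_cos t * neg_ln t * neg_ln t)) \<longlongrightarrow> 0) (at_right 0)" "((\<lambda>t. half_cos t * neg_ln t * neg_ln t) \<longlongrightarrow> 0) (at_left 1)"
      unfolding half_sin_def half_cos_def neg_ln_def by real_asymp+
  qed
  then have "((\<lambda>t. real (n + 1) * (half_sin t ^ n * neg_ln t * neg_ln t * half_angle_weight t)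
      - real (n + 2) * (half_sin t ^ (n + 2) * neg_ln t * neg_ln t * half_angle_weight t)
      - 2 * (half_sin t ^ n * half_cos t * neg_ln t * half_angle_weight t)) has_integral 0) {0<..<1}"
  proof (rule has_integral_eq[rotated])
    fix t :: real assume t: "t \<in> {0<..<1}"
    show "half_sin t ^ n * (real (Suc n) * (half_cos t * half_angle_weight t) * (half_cos t * neg_ln t * neg_ln t)
      + half_sin t * ((- half_sin t * half_angle_weight t * neg_ln t + - (1 / t) * half_cos t) * neg_ln t + - (1 / t) * (half_cos t * neg_ln t))) =
      real (n + 1) * (half_sin t ^ n * neg_ln t * neg_ln t * half_angle_weight t)
      - real (n + 2) * (half_sin t ^ (n + 2) * neg_ln t * neg_ln t * half_angle_weight t)
      - 2 * (half_sin t ^ n * half_cos t * neg_ln t * half_angle_weight t)"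
      unfolding Suc_power_expand
      by (rule half_sin_power_identities(4)[OF half_cos_square half_sin_times_inverse]) (use t in simp)
  qed
  moreover have "((\<lambda>t. real (n + 1) * (half_sin t ^ n * neg_ln t * neg_ln t * half_angle_weight t)
      - real (n + 2) * (half_sin t ^ (n + 2) * neg_ln t * neg_ln t * half_angle_weight t)
      - 2 * (half_sin t ^ n * half_cos t * neg_ln t * half_angle_weight t))
      has_integral (real (n + 1) * log2_moment n - real (n + 2) * log2_moment (n + 2) - 2 * log_cos_moment n)) {0<..<1}"
    unfolding log2_moment_def log_cos_moment_def
    by (intro has_integral_diff has_integral_mult_right bracket_has_integral square_int_intros)
  ultimately have "0 = real (n + 1) * log2_moment n - real (n + 2) * log2_moment (n + 2) - 2 * log_cos_moment n"
    by (rule has_integral_unique)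
  then show ?thesis
    by simp
qed

lemma log_moment_1: "log_moment 1 = ln 2"
proof -
  \<comment> \<open>Integration by parts with 1 - cos as primitive of sin: the constant 1 makes it
    vanish at t = 0, where the logarithm is singular.\<close>
  define F where "F = (\<lambda>t. (1 - half_cos t) * neg_ln t + ln (1 + t ^ 2))"
  have "((\<lambda>t. half_sin t ^ 1 * neg_ln t * half_angle_weight t) has_integral (ln 2 - 0)) {0<..<1}"
  proof (rule has_integral_unit_interval)
    show "(F has_real_derivative half_sin t ^ 1 * neg_ln t * half_angle_weight t) (at t)" if "0 < t" "t < 1" for t
    proof -
      have "((\<lambda>t. ln (1 + t ^ 2)) has_real_derivative 2 * t / (1 + t ^ 2)) (at t)"
        by (auto intro!: derivative_eq_intros)
      moreover have "((\<lambda>t. 1 - half_cos t) has_real_derivative 0 - (- half_sin t * half_angle_weight t)) (at t)"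
        by (intro DERIV_diff DERIV_const half_cos_deriv)
      ultimately have "(F has_real_derivative (0 - (- half_sin t * half_angle_weight t)) * neg_ln t
          + - (1 / t) * (1 - half_cos t) + 2 * t / (1 + t ^ 2)) (at t)"
        unfolding F_def by (intro DERIV_add DERIV_mult neg_ln_deriv) (use that in auto)
      moreover have "(1 / t) * (1 - half_cos t) = 2 * t / (1 + t ^ 2)"
      proof -
        have "1 - half_cos t = 2 * t ^ 2 / (1 + t ^ 2)"
          unfolding half_cos_def by (simp add: field_simps)
        then show ?thesis
          using that by (simp add: power2_eq_square)
      qed
      ultimately show ?thesis
        by (simp add: algebra_simps)
    qed
    show "(F \<longlongrightarrow> 0) (at_right 0)" "(F \<longlongrightarrow> ln 2) (at_left 1)"
      unfolding F_def half_cos_def neg_ln_def by real_asymp+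
  qed
  then show ?thesis
    by (simp add: log_moment_def bracket_def integral_unique)
qed

text \<open>From -ln t <= (1-t)/t one factor sin/t becomes the weight, and (1-t)(1+t) produces the
  cosine. Two powers of the sine thus trade the logarithm for a cosine, whose integrals against
  sin^n are explicit; this gives the decay of both kinds of logarithmic moments.\<close>

lemma half_sin_square_log_le:
  assumes "0 < t" "t < 1"
  shows "half_sin t ^ 2 * neg_ln t \<le> 2 * half_cos t"
proof -
  have "ln (1 / t) \<le> 1 / t - 1"
    using assms by (intro ln_le_minus_one) auto
  then have "half_sin t ^ 2 * neg_ln t \<le> half_sin t ^ 2 * (1 / t - 1)"
    using assms by (intro mult_left_mono) (auto simp: ln_div neg_ln_def)
  also have "\<dots> = half_sin t * (1 - t) * (half_sin t / t)"
    using assms by (simp add: power2_eq_square field_simps)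
  also have "\<dots> = half_sin t * (1 - t) * half_angle_weight t"
    using assms by (simp add: half_sin_over)
  also have "\<dots> \<le> 1 * ((1 - t) * (1 + t)) * half_angle_weight t"
    unfolding mult.assoc using assms half_sin_bounds[of t] half_angle_weight_bounds(1)[of t]
    by (intro mult_mono) (auto intro: less_imp_le)
  also have "\<dots> = 2 * half_cos t"
    by (simp add: half_cos_def half_angle_weight_def power2_eq_square algebra_simps)
  finally show ?thesis .
qed

lemma log_moment_nonneg: "log_moment n \<ge> 0"
  unfolding log_moment_def
  by (rule has_integral_nonneg[OF bracket_has_integral])
    (auto intro!: square_int_intros mult_nonneg_nonneg simp: less_imp_le half_sin_bounds half_angle_weight_bounds neg_ln_nonneg)

lemma log_moment_le: "log_moment (n + 2) \<le> 2 / real (Suc n)"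
proof (rule has_integral_le)
  show "((\<lambda>t. half_sin t ^ (n + 2) * neg_ln t * half_angle_weight t) has_integral log_moment (n + 2)) {0<..<1}"
    unfolding log_moment_def by (intro bracket_has_integral square_int_intros)
  show "((\<lambda>t. 2 * (half_sin t ^ n * half_cos t * half_angle_weight t)) has_integral 2 / real (Suc n)) {0<..<1}"
    using has_integral_mult_right[OF half_sin_power_half_cos_integral, of 2 n] by simp
  fix t :: real assume "t \<in> {0<..<1}"
  then have "half_sin t ^ n * (half_sin t ^ 2 * neg_ln t) * half_angle_weight t
      \<le> half_sin t ^ n * (2 * half_cos t) * half_angle_weight t"
    using half_sin_square_log_le[of t] half_sin_bounds[of t] half_angle_weight_bounds(1)[of t]
    by (intro mult_right_mono mult_left_mono) auto
  then show "half_sin t ^ (n + 2) * neg_ln t * half_angle_weight t \<le> 2 * (half_sin t ^ n * half_cos t * half_angle_weight t)"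
    by (simp add: power_add mult_ac power2_eq_square)
qed

text \<open>The recurrence of the logarithmic moments makes \<open>m\<^sub>n / n\<close> a difference of consecutive terms of \<open>n m\<^bsub>n-1\<^esub> m\<^sub>n\<close>.\<close>

lemma log_moment_sums: "(\<lambda>n. log_moment (Suc n) / real (Suc n)) sums (log_moment 0 * ln 2)"
proof -
  define v where "v = (\<lambda>n. real (Suc n) * log_moment n * log_moment (Suc n))"
  \<comment> \<open>The index is shifted because \<open>log_moment_le\<close> bounds the moments
    from index 2 on.\<close>
  have le: "v (n + 2) \<le> real (n + 3) * (2 / real (n + 1)) * (2 / real (n + 2))" for n
    unfolding v_def
    using log_moment_le[of n] log_moment_le[of "Suc n"]
    by (intro mult_mono mult_left_mono) (auto simp: log_moment_nonneg add_ac simp del: of_nat_Suc)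
  have nonneg: "0 \<le> v n" for n
    by (simp add: v_def log_moment_nonneg)
  have lim: "(\<lambda>n. real (n + 3) * (2 / real (n + 1)) * (2 / real (n + 2))) \<longlonglongrightarrow> 0"
    by real_asymp
  have "(\<lambda>n. v (n + 2)) \<longlonglongrightarrow> 0"
    by (rule tendsto_sandwich[OF _ _ tendsto_const lim]) (use le nonneg in \<open>auto intro: always_eventually\<close>)
  then have "v \<longlonglongrightarrow> 0"
    by (rule LIMSEQ_offset)
  from telescope_sums'[OF this] have "(\<lambda>n. v n - v (Suc n)) sums (log_moment 0 * ln 2)"
    by (simp add: v_def log_moment_1[unfolded One_nat_def])
  moreover have "v n - v (Suc n) = log_moment (Suc n) / real (Suc n)" for n
  proof -
    have "v n - v (Suc n) = log_moment (Suc n) * (real (n + 1) * log_moment n - real (n + 2) * log_moment (n + 2))"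
      by (simp add: v_def algebra_simps)
    then show ?thesis
      unfolding log_moment_Suc_Suc by (simp add: add_ac)
  qed
  ultimately show ?thesis
    by simp
qed

lemma wallis_int_pos: "wallis_int (2 * n) > 0"
proof (induction n)
  case (Suc n)
  have "real (2 * n + 2) * wallis_int (2 * n + 2) > 0"
    unfolding wallis_int_Suc_Suc using Suc by simp
  then show ?case
    by (simp add: zero_less_mult_iff)
qed (simp add: wallis_int_0)

lemma log2_moment_nonneg: "log2_moment n \<ge> 0"
  unfolding log2_moment_def
  by (rule has_integral_nonneg[OF bracket_has_integral])
    (auto intro!: square_int_intros mult_nonneg_nonneg simp: less_imp_le half_sin_bounds half_angle_weight_bounds neg_ln_nonneg)

text \<open>Squaring \<open>half_sin_square_log_le\<close> trades sin^4 ln(t)^2 for 4 cos^2 = 4 (1 -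
  sin^2).\<close>

lemma log2_moment_le: "log2_moment (n + 4) \<le> 4 * (wallis_int n - wallis_int (n + 2))"
proof (rule has_integral_le)
  show "((\<lambda>t. half_sin t ^ (n + 4) * neg_ln t * neg_ln t * half_angle_weight t) has_integral log2_moment (n + 4)) {0<..<1}"
    unfolding log2_moment_def by (intro bracket_has_integral square_int_intros)
  show "((\<lambda>t. 4 * (half_sin t ^ n * 1 * half_angle_weight t - half_sin t ^ (n + 2) * 1 * half_angle_weight t))
      has_integral 4 * (wallis_int n - wallis_int (n + 2))) {0<..<1}"
    unfolding wallis_int_def by (intro has_integral_diff has_integral_mult_right bracket_has_integral square_int_intros)
  fix t :: real assume t: "t \<in> {0<..<1}"
  then have "(half_sin t ^ 2 * neg_ln t) ^ 2 \<le> (2 * half_cos t) ^ 2"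
    using half_sin_square_log_le[of t] neg_ln_nonneg[of t] by (intro power_mono mult_nonneg_nonneg) auto
  also have "\<dots> = 4 * (1 - half_sin t ^ 2)"
    using half_sin_cos_square[of t] by (simp add: power_mult_distrib algebra_simps)
  finally have "half_sin t ^ n * (half_sin t ^ 2 * neg_ln t) ^ 2 * half_angle_weight t
      \<le> half_sin t ^ n * (4 * (1 - half_sin t ^ 2)) * half_angle_weight t"
    using t half_sin_bounds[of t] half_angle_weight_bounds(1)[of t]
    by (intro mult_right_mono mult_left_mono) auto
  then show "half_sin t ^ (n + 4) * neg_ln t * neg_ln t * half_angle_weight t
      \<le> 4 * (half_sin t ^ n * 1 * half_angle_weight t - half_sin t ^ (n + 2) * 1 * half_angle_weight t)"
    by (simp add: power_add algebra_simps power2_eq_square power4_eq_xxxx)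
qed

section \<open>Integral representations of the series\<close>

text \<open>The square root c_n of a_n. It occurs both as a normalised Wallis integral
  (\<open>wallis_int_even\<close>) and as a coefficient of 1/sqrt(1 - x)
  (\<open>central_coeff_sums\<close>), and a_n is assembled from one occurrence of each.\<close>

definition central_coeff :: "nat \<Rightarrow> real" where
  "central_coeff n = real ((2 * n) choose n) / 4 ^ n"

lemma central_sq_eq: "central_sq n = central_coeff n ^ 2"
proof -
  have "(16::real) ^ n = (4 ^ n) ^ 2"
    by (simp add: power_mult[symmetric] mult.commute[of n 2]) (simp add: power_mult)
  then show ?thesis
    by (simp add: central_sq_def central_coeff_def power_divide)
qed

lemma central_coeff_pos: "central_coeff n > 0"
  by (simp add: central_coeff_def)

lemma central_coeff_0 [simp]: "central_coeff 0 = 1"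
  by (simp add: central_coeff_def)

lemma central_coeff_Suc: "central_coeff (Suc n) = central_coeff n * ((2 * real n + 1) / (2 * real n + 2))"
proof (rule power2_eq_imp_eq)
  show "central_coeff (Suc n) ^ 2 = (central_coeff n * ((2 * real n + 1) / (2 * real n + 2))) ^ 2"
    unfolding power_mult_distrib central_sq_eq[symmetric] by (rule central_sq_Suc)
qed (use central_coeff_pos[of n] central_coeff_pos[of "Suc n"] in auto)

lemma wallis_int_even: "wallis_int (2 * n) = pi / 2 * central_coeff n"
proof (induction n)
  case (Suc n)
  have "real (2 * n + 2) * wallis_int (2 * n + 2) = real (2 * n + 1) * wallis_int (2 * n)"
    by (rule wallis_int_Suc_Suc)
  then show ?case
    unfolding Suc by (simp add: central_coeff_Suc field_simps)
qed (simp add: wallis_int_0)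

lemma summable_norm_power_bounded:
  fixes c :: "nat \<Rightarrow> real" and x :: real
  assumes "\<And>n. \<bar>c n\<bar> \<le> 1" "\<bar>x\<bar> < 1"
  shows "summable (\<lambda>n. norm (c n * x ^ n))"
proof (rule summable_comparison_test')
  show "summable (\<lambda>n. \<bar>x\<bar> ^ n)"
    using assms by (intro summable_geometric) auto
  show "norm (norm (c n * x ^ n)) \<le> \<bar>x\<bar> ^ n" for n
    using assms(1)[of n] by (simp add: abs_mult power_abs mult_left_le_one_le)
qed

lemma central_coeff_le_1: "central_coeff n \<le> 1"
proof (induction n)
  case (Suc n)
  have "central_coeff n * ((2 * real n + 1) / (2 * real n + 2)) \<le> 1 * 1"
    using Suc by (intro mult_mono) auto
  then show ?case
    by (simp add: central_coeff_Suc)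
qed simp

section \<open>Generating functions of c_n and c_n O_n\<close>

lemma central_coeff_sums:
  assumes "0 \<le> x" "x < 1"
  shows "(\<lambda>n. central_coeff n * x ^ n) sums (1 / sqrt (1 - x))"
proof -
  have "((-1/2) gchoose n) * (-1) ^ n = central_coeff n" for n
  proof (induction n)
    case (Suc n)
    have e: "((-1/2) gchoose (Suc n)) = ((-1/2) gchoose n) * ((-1/2 - real n) / real (Suc n))"
      by (simp add: gbinomial_Suc_rec gbinomial_absorption' gbinomial_pochhammer pochhammer_Suc field_simps)
    have q: "(-1/2 - real n) / real (Suc n) = - ((2 * real n + 1) / (2 * real n + 2))"
      by (simp add: field_simps)
    show ?case
      unfolding central_coeff_Suc Suc[symmetric] e q by simp
  qed simp
  then have "((-1/2) gchoose n) * (-x) ^ n = central_coeff n * x ^ n" for n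
    by (metis (no_types) mult.assoc power_mult_distrib mult_minus1)
  then have "(\<lambda>n. central_coeff n * x ^ n) sums (1 + - x) powr (-1/2)"
    using gen_binomial_real[of "-x" "-1/2"] assms by simp
  moreover have "(1 + - x) powr (-1/2) = 1 / sqrt (1 - x)"
    using assms by (simp add: powr_minus_divide powr_half_sqrt)
  ultimately show ?thesis
    by simp
qed

text \<open>The operator x d/dx multiplies the n-th coefficient by n, so recurrences with
  coefficients polynomial in n become equations between power series.\<close>

definition fps_euler :: "real fps \<Rightarrow> real fps" where
  "fps_euler f = fps_X * fps_deriv f"

lemma fps_euler_nth: "fps_nth (fps_euler f) n = real n * fps_nth f n"
  by (cases n) (simp_all add: fps_euler_def)

lemma fps_euler_mult: "fps_euler (f * g) = fps_euler f * g + f * fps_euler g"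
  by (simp add: fps_euler_def algebra_simps)

lemma fps_euler_add: "fps_euler (f + g) = fps_euler f + fps_euler g"
  by (simp add: fps_euler_def algebra_simps)

lemma fps_euler_X: "fps_euler fps_X = fps_X"
  by (simp add: fps_euler_def)

text \<open>The power series of \<open>- ln (1 - x)\<close>; its constant term is the junk value \<open>1 / 0 = 0\<close>.\<close>

definition fps_neg_log :: "real fps" where
  "fps_neg_log = Abs_fps (\<lambda>n. 1 / real n)"

lemma fps_euler_neg_log: "fps_euler fps_neg_log = fps_X + fps_X * fps_euler fps_neg_log"
proof (rule fps_ext)
  fix n
  show "fps_nth (fps_euler fps_neg_log) n = fps_nth (fps_X + fps_X * fps_euler fps_neg_log) n"
  proof (cases n)
    case (Suc m)
    then show ?thesis
      by (cases m) (simp_all add: fps_euler_nth fps_neg_log_def del: of_nat_Suc)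
  qed (simp add: fps_euler_nth)
qed

text \<open>Coefficient form of -ln(1-x)/sqrt(1-x) = sum 2 c_n O_n x^n. With D = x d/dx, the series
  Y of c_n satisfies D Y = x (D + 1/2) Y; its product Z with the logarithm then satisfies D Z = x (D
  + 1/2) Z + x Y, a recurrence that the right-hand side also obeys. The summand k = n is 1/0 =
  0.\<close>

lemma central_coeff_convolution:
  "(\<Sum>k\<le>n. central_coeff k * (1 / real (n - k))) = 2 * central_coeff n * odd_harm n"
proof -
  define Y L :: "real fps" where "Y = Abs_fps central_coeff" and "L = fps_neg_log"
  define D where "D = fps_euler"
  note D_nth = fps_euler_nth[folded D_def] and D_mult = fps_euler_mult[folded D_def]
  define c :: "real fps" where "c = fps_const (1 / 2)"
  have Y: "D Y = fps_X * (D Y + c * Y)"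
  proof (rule fps_ext)
    fix n
    show "fps_nth (D Y) n = fps_nth (fps_X * (D Y + c * Y)) n"
    proof (cases n)
      case (Suc m)
      have "real (Suc m) * central_coeff (Suc m) = (real m + 1 / 2) * central_coeff m"
        unfolding central_coeff_Suc by (simp add: field_simps)
      then show ?thesis
        unfolding Suc by (simp add: D_nth Y_def c_def algebra_simps del: of_nat_Suc)
    qed (simp add: D_nth)
  qed
  define u where "u = D L"
  have u: "u = fps_X + fps_X * u"
    unfolding u_def D_def L_def by (rule fps_euler_neg_log)
  define Z where "Z = Y * L"
  have DZ: "D Z = D Y * L + Y * u"
    by (simp add: Z_def D_mult u_def)
  have "fps_X * (D Z + c * Z) + fps_X * Y = fps_X * (D Y + c * Y) * L + Y * (fps_X + fps_X * u)"
    unfolding DZ unfolding Z_def by (simp add: algebra_simps)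
  then have "D Z = fps_X * (D Z + c * Z) + fps_X * Y"
    by (simp only: Y[symmetric] u[symmetric] DZ)
  then have Z_rec: "fps_nth (D Z) (Suc n) = fps_nth (fps_X * (D Z + c * Z) + fps_X * Y) (Suc n)" for n
    by simp
  have "fps_nth Z n = 2 * central_coeff n * odd_harm n" for n
  proof (induction n)
    case 0
    show ?case
      by (simp add: Z_def L_def fps_neg_log_def)
  next
    case (Suc n)
    have "real (Suc n) * fps_nth Z (Suc n) = (real n + 1 / 2) * fps_nth Z n + central_coeff n"
      using Z_rec[of n] by (simp add: D_nth c_def Y_def algebra_simps del: of_nat_Suc)
    also have "\<dots> = 2 * ((real n + 1 / 2) * central_coeff n) * odd_harm (Suc n)"
    proof -
      have "2 * (real n + 1 / 2) * (1 / (2 * real n + 1)) = 1"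
        by (simp add: field_simps)
      then show ?thesis
        unfolding Suc odd_harm_Suc by algebra
    qed
    also have "(real n + 1 / 2) * central_coeff n = real (Suc n) * central_coeff (Suc n)"
      unfolding central_coeff_Suc by (simp add: field_simps)
    also have "2 * (real (Suc n) * central_coeff (Suc n)) * odd_harm (Suc n)
        = real (Suc n) * (2 * central_coeff (Suc n) * odd_harm (Suc n))"
      by simp
    finally show ?case
      by (simp del: of_nat_Suc)
  qed
  moreover have "fps_nth Z n = (\<Sum>k\<le>n. central_coeff k * (1 / real (n - k)))"
    unfolding Z_def by (simp add: fps_mult_nth Y_def L_def fps_neg_log_def atLeast0AtMost)
  ultimately show ?thesis
    by simp
qed

lemma minus_ln_sums: "0 \<le> x \<Longrightarrow> x < 1 \<Longrightarrow> (\<lambda>n. 1 / real n * x ^ n) sums (- ln (1 - x))" for x :: real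
  using sums_minus[OF ln_series'[of "-x"]] by simp

lemma central_coeff_odd_harm_sums:
  assumes "0 \<le> x" "x < 1"
  shows "(\<lambda>n. central_coeff n * odd_harm n * x ^ n) sums (- ln (1 - x) / 2 / sqrt (1 - x))"
proof -
  have "summable (\<lambda>n. norm (central_coeff n * x ^ n))" "summable (\<lambda>n. norm (1 / real n * x ^ n))"
  proof -
    have "\<bar>central_coeff n\<bar> \<le> 1" "\<bar>1 / real n\<bar> \<le> 1" for n
      using central_coeff_le_1[of n] central_coeff_pos[of n] by (simp, cases n) auto
    then show "summable (\<lambda>n. norm (central_coeff n * x ^ n))" "summable (\<lambda>n. norm (1 / real n * x ^ n))"
      using assms by (intro summable_norm_power_bounded; simp)+
  qed
  from Cauchy_product_sums[OF this]
  have "(\<lambda>n. \<Sum>k\<le>n. (central_coeff k * x ^ k) * (1 / real (n - k) * x ^ (n - k)))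
      sums (1 / sqrt (1 - x) * - ln (1 - x))"
    using central_coeff_sums[OF assms] minus_ln_sums[OF assms] by (simp add: sums_iff)
  moreover have "(\<Sum>k\<le>n. (central_coeff k * x ^ k) * (1 / real (n - k) * x ^ (n - k)))
      = 2 * (central_coeff n * odd_harm n * x ^ n)" for n
  proof -
    have "(\<Sum>k\<le>n. (central_coeff k * x ^ k) * (1 / real (n - k) * x ^ (n - k)))
        = (\<Sum>k\<le>n. central_coeff k * (1 / real (n - k))) * x ^ n"
      unfolding sum_distrib_right
      by (rule sum.cong) (auto simp: power_add[symmetric] mult_ac)
    then show ?thesis
      by (simp only: central_coeff_convolution mult.assoc)
  qed
  ultimately have "(\<lambda>n. 2 * (central_coeff n * odd_harm n * x ^ n)) sums (1 / sqrt (1 - x) * - ln (1 - x))"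
    by simp
  from sums_mult[OF this, of "1 / 2"] show ?thesis
    by (simp add: mult_ac)
qed

section \<open>Catalan's constant and termwise integration\<close>

lemma has_integral_power_neg_ln:
  "((\<lambda>t. t ^ n * neg_ln t) has_integral 1 / real (Suc n) ^ 2) {0<..<1}"
proof -
  define c where "c = real (Suc n)"
  have c: "c > 0"
    by (simp add: c_def)
  have "((\<lambda>t. t ^ n * neg_ln t) has_integral (1 / c ^ 2 - 0)) {0<..<1}"
  proof (rule has_integral_unit_interval)
    show "((\<lambda>t. t ^ Suc n * (neg_ln t / c + 1 / c ^ 2)) has_real_derivative t ^ n * neg_ln t) (at t)" if "0 < t" "t < 1" for t
    proof -
      have "((\<lambda>t. neg_ln t / c + 1 / c ^ 2) has_real_derivative - (1 / t) / c) (at t)"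
        using DERIV_add[OF DERIV_cdivide[OF neg_ln_deriv[OF that(1)], of c] DERIV_const[of "1 / c ^ 2"]] by simp
      from DERIV_mult[OF DERIV_pow[of "Suc n" t] this] show ?thesis
        using that c by (simp add: c_def[symmetric] field_simps power2_eq_square del: of_nat_Suc)
    qed
    have "((\<lambda>t. t * (neg_ln t / c + 1 / c ^ 2)) \<longlongrightarrow> 0) (at_right 0)"
      using c unfolding neg_ln_def by real_asymp
    then have "((\<lambda>t. t ^ n * (t * (neg_ln t / c + 1 / c ^ 2))) \<longlongrightarrow> 0 ^ n * 0) (at_right 0)"
      by (intro tendsto_mult tendsto_power tendsto_ident_at)
    then show "((\<lambda>t. t ^ Suc n * (neg_ln t / c + 1 / c ^ 2)) \<longlongrightarrow> 0) (at_right 0)"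
      by (simp add: mult_ac)
    have "((\<lambda>t. neg_ln t / c + 1 / c ^ 2) \<longlongrightarrow> 1 / c ^ 2) (at_left 1)"
      using c unfolding neg_ln_def by real_asymp
    then have "((\<lambda>t. t ^ Suc n * (neg_ln t / c + 1 / c ^ 2)) \<longlongrightarrow> 1 ^ Suc n * (1 / c ^ 2)) (at_left 1)"
      by (intro tendsto_mult tendsto_power tendsto_ident_at)
    then show "((\<lambda>t. t ^ Suc n * (neg_ln t / c + 1 / c ^ 2)) \<longlongrightarrow> 1 / c ^ 2) (at_left 1)"
      by simp
  qed
  then show ?thesis
    by (simp add: c_def)
qed

text \<open>Expanding 1/(1+t^2) gives alternating signs, so convergence must be dominated rather
  than monotone: the partial geometric sums are at most 2 in absolute value, whence the majorant -2
  ln t.\<close>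

lemma bracket_neg_ln_1: "bracket neg_ln (\<lambda>_. 1) = 2 * catalan_const"
proof -
  define S where "S = (\<lambda>N t. \<Sum>k<N. (-1) ^ k * (t ^ (2 * k) * neg_ln t))"
  have S: "(S N has_integral (\<Sum>k<N. (-1) ^ k * (1 / real (Suc (2 * k)) ^ 2))) {0<..<1}" for N
    unfolding S_def by (intro has_integral_sum has_integral_mult_right has_integral_power_neg_ln) auto
  have "(\<lambda>N. integral {0<..<1} (S N)) \<longlonglongrightarrow> integral {0<..<1} (\<lambda>t. neg_ln t / (1 + t ^ 2))"
  proof (rule dominated_convergence(2))
    show "S N integrable_on {0<..<1}" for N
      using S by blast
    show "(\<lambda>t. 2 * neg_ln t) integrable_on {0<..<1}"
      using has_integral_mult_right[OF has_integral_power_neg_ln[of 0], of 2] by (auto simp: integrable_on_def)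
    fix t :: real assume t: "t \<in> {0<..<1}"
    then have t2: "\<bar>t ^ 2\<bar> < 1"
      by (simp add: power_less_one_iff)
    have S_eq: "S N t = neg_ln t * (\<Sum>k<N. (- (t ^ 2)) ^ k)" for N
      unfolding S_def sum_distrib_left
      by (intro sum.cong refl) (simp only: power_mult power_minus[of "t ^ 2"], simp only: mult_ac)
    have geom: "(\<Sum>k<N. (- (t ^ 2)) ^ k) = (1 - (- (t ^ 2)) ^ N) / (1 + t ^ 2)" for N
      using sum_gp_strict[of "- (t ^ 2)" N] by (simp add: eq_neg_iff_add_eq_0 add_ac)
    show "norm (S N t) \<le> 2 * neg_ln t" for N
    proof -
      have "\<bar>- (t ^ 2)\<bar> ^ N \<le> 1"
        using t2 by (intro power_le_one) auto
      then have "\<bar>1 - (- (t ^ 2)) ^ N\<bar> \<le> 2"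
        by (metis abs_triangle_ineq4 abs_one power_abs one_add_one add_left_mono order_trans)
      moreover have "1 \<le> 1 + t ^ 2"
        by simp
      ultimately have "\<bar>(1 - (- (t ^ 2)) ^ N) / (1 + t ^ 2)\<bar> \<le> 2 / 1"
        unfolding abs_divide by (intro frac_le) auto
      then have "neg_ln t * \<bar>(1 - (- (t ^ 2)) ^ N) / (1 + t ^ 2)\<bar> \<le> neg_ln t * 2"
        using t neg_ln_nonneg[of t] by (intro mult_left_mono) auto
      then show ?thesis
        unfolding S_eq geom using t neg_ln_nonneg[of t] by (simp add: abs_mult mult.commute)
    qed
    have "(\<lambda>N. \<Sum>k<N. (- (t ^ 2)) ^ k) \<longlonglongrightarrow> 1 / (1 - - (t ^ 2))"
      using geometric_sums[of "- (t ^ 2)"] t2 by (simp add: sums_def)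
    then have "(\<lambda>N. S N t) \<longlonglongrightarrow> neg_ln t * (1 / (1 - - (t ^ 2)))"
      unfolding S_eq by (intro tendsto_mult tendsto_const)
    then show "(\<lambda>N. S N t) \<longlonglongrightarrow> neg_ln t / (1 + t ^ 2)"
      by simp
  qed
  then have "(\<lambda>k. (-1) ^ k * (1 / real (Suc (2 * k)) ^ 2)) sums integral {0<..<1} (\<lambda>t. neg_ln t / (1 + t ^ 2))"
    using integral_unique[OF S] by (simp add: sums_def del: of_nat_Suc)
  then have "catalan_const = integral {0<..<1} (\<lambda>t. neg_ln t / (1 + t ^ 2))"
    unfolding catalan_const_def Let_def by (intro sums_unique[symmetric]) (simp add: add_ac)
  moreover have "bracket neg_ln (\<lambda>_. 1) = 2 * integral {0<..<1} (\<lambda>t. neg_ln t / (1 + t ^ 2))"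
    unfolding bracket_def half_angle_weight_def integral_mult_right[symmetric] by (simp add: mult.commute)
  ultimately show ?thesis
    by simp
qed

lemma bracket_sums:
  assumes f: "\<And>n. square_int (f n)" and F: "square_int F" and g: "square_int g"
    and nonneg: "\<And>n t. 0 < t \<Longrightarrow> t < 1 \<Longrightarrow> 0 \<le> f n t" "\<And>t. 0 < t \<Longrightarrow> t < 1 \<Longrightarrow> 0 \<le> g t"
    and sums: "\<And>t. 0 < t \<Longrightarrow> t < 1 \<Longrightarrow> (\<lambda>n. f n t) sums F t"
  shows "(\<lambda>n. bracket (f n) g) sums bracket F g"
  unfolding bracket_def[of F]
proof (rule integral_sums_nonneg)
  show "((\<lambda>t. f n t * g t * half_angle_weight t) has_integral bracket (f n) g) {0<..<1}" for n
    by (intro bracket_has_integral f g)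
  show "(\<lambda>t. F t * g t * half_angle_weight t) integrable_on {0<..<1}"
    by (intro set_lebesgue_integral_eq_integral(1) bracket_integrable F g)
qed (auto intro!: mult_nonneg_nonneg nonneg sums_mult2 sums simp: less_imp_le half_angle_weight_bounds)

lemma two_over_pi_mult: "2 / pi * (x * (pi / 2 * y / z)) = x * y / z"
  by simp

lemma log_cos_moment_even: "log_cos_moment (2 * n) = pi / 2 * central_coeff n / (2 * real n + 1)"
  using log_cos_moment_eq[of "2 * n"] wallis_int_even[of n] by (simp add: field_simps)

text \<open>The logarithm of cos(phi), written as a sum so that square integrability and the Cayley
  and doubling relations apply to each summand.\<close>

definition log_half_cos :: "real \<Rightarrow> real" where
  "log_half_cos t = ln (1 - t) + ln (1 + t) - ln (1 + t ^ 2)"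

lemma log_half_cos: "0 < t \<Longrightarrow> t < 1 \<Longrightarrow> log_half_cos t = ln (half_cos t)"
proof -
  assume t: "0 < t" "t < 1"
  have "half_cos t = (1 - t) * (1 + t) / (1 + t ^ 2)"
    by (simp add: half_cos_def power2_eq_square algebra_simps)
  moreover have "ln ((1 - t) * (1 + t) / (1 + t ^ 2)) = ln ((1 - t) * (1 + t)) - ln (1 + t ^ 2)"
    using t by (intro ln_divide_pos) auto
  ultimately show ?thesis
    using t by (simp add: log_half_cos_def ln_mult_pos)
qed

lemma square_int_log_half_cos: "square_int log_half_cos"
  unfolding log_half_cos_def[abs_def]
  by (intro square_int_diff square_int_add square_int_ln_1_minus square_int_ln_1_plus square_int_ln_1_plus_square)

text \<open>The series of 1/sqrt(1-x) at x = sin^2 gives sum c_n sin^(2n) cos = 1. Integrated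
  against -ln t, the terms become (pi/2) a_n/(2n+1) and the right-hand side 2G.\<close>

lemma central_sq_over_odd_sums: "(\<lambda>n. central_sq n / (2 * real n + 1)) sums (4 * catalan_const / pi)"
proof -
  have "(\<lambda>n. bracket (\<lambda>t. central_coeff n * (half_sin t ^ (2 * n) * half_cos t)) neg_ln) sums bracket (\<lambda>_. 1) neg_ln"
  proof (rule bracket_sums)
    fix t :: real assume t: "0 < t" "t < 1"
    have "half_sin t ^ 2 < 1"
      using half_sin_bounds[OF t] by (simp add: power_less_one_iff)
    then have "(\<lambda>n. central_coeff n * (half_sin t ^ 2) ^ n * half_cos t) sums (1 / sqrt (1 - half_sin t ^ 2) * half_cos t)"
      by (intro sums_mult2 central_coeff_sums) auto
    moreover have "1 / sqrt (1 - half_sin t ^ 2) * half_cos t = 1"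
      using half_cos_bounds[OF t] by (simp add: half_cos_eq_sqrt[OF t, symmetric])
    ultimately show "(\<lambda>n. central_coeff n * (half_sin t ^ (2 * n) * half_cos t)) sums 1"
      by (simp only: power_mult mult.assoc)
  qed (use half_sin_bounds half_cos_bounds central_coeff_pos neg_ln_nonneg in
      \<open>auto intro!: square_int_intros square_int_cmult mult_nonneg_nonneg simp: less_imp_le\<close>)
  then have "(\<lambda>n. central_coeff n * log_cos_moment (2 * n)) sums (2 * catalan_const)"
    by (simp add: bracket_cmult_left log_cos_moment_def bracket_commute[of "\<lambda>_. 1"] bracket_neg_ln_1)
  from sums_mult[OF this, of "2 / pi"] show ?thesis
    unfolding log_cos_moment_even two_over_pi_mult by (simp add: central_sq_eq power2_eq_square)
qed

text \<open>As before, but the factor O_n replaces the constant 1 by -ln cos(phi), by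
  \<open>central_coeff_odd_harm_sums\<close> at x = sin^2.\<close>

lemma central_sq_odd_harm_over_odd_sums:
  "(\<lambda>n. central_sq n * odd_harm n / (2 * real n + 1)) sums (2 / pi * bracket ln log_half_cos)"
proof -
  have "(\<lambda>n. bracket (\<lambda>t. central_coeff n * odd_harm n * (half_sin t ^ (2 * n) * half_cos t)) neg_ln)
      sums bracket (\<lambda>t. - log_half_cos t) neg_ln"
  proof (rule bracket_sums)
    fix t :: real assume t: "0 < t" "t < 1"
    have s: "half_sin t ^ 2 < 1"
      using half_sin_bounds[OF t] by (simp add: power_less_one_iff)
    then have "(\<lambda>n. central_coeff n * odd_harm n * (half_sin t ^ 2) ^ n * half_cos t)
        sums (- ln (1 - half_sin t ^ 2) / 2 / sqrt (1 - half_sin t ^ 2) * half_cos t)"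
      by (intro sums_mult2 central_coeff_odd_harm_sums) auto
    moreover have "- ln (1 - half_sin t ^ 2) / 2 / sqrt (1 - half_sin t ^ 2) * half_cos t = - log_half_cos t"
    proof -
      have "ln (1 - half_sin t ^ 2) = 2 * ln (half_cos t)"
        using half_cos_bounds[OF t] by (simp add: half_cos_square[symmetric] ln_realpow)
      then show ?thesis
        using half_cos_bounds[OF t] by (simp add: half_cos_eq_sqrt[OF t, symmetric] log_half_cos[OF t])
    qed
    ultimately show "(\<lambda>n. central_coeff n * odd_harm n * (half_sin t ^ (2 * n) * half_cos t)) sums - log_half_cos t"
      by (simp only: power_mult mult.assoc)
  qed (use half_sin_bounds half_cos_bounds central_coeff_pos neg_ln_nonneg in
      \<open>auto intro!: square_int_intros square_int_cmult square_int_minus square_int_log_half_cos mult_nonneg_nonneg simp: less_imp_le\<close>)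
  moreover have "bracket (\<lambda>t. - log_half_cos t) neg_ln = bracket ln log_half_cos"
    by (simp add: bracket_def neg_ln_def mult_ac)
  ultimately have "(\<lambda>n. central_coeff n * odd_harm n * log_cos_moment (2 * n)) sums bracket ln log_half_cos"
    by (simp add: bracket_cmult_left log_cos_moment_def)
  from sums_mult[OF this, of "2 / pi"]
  have "(\<lambda>n. 2 / pi * (central_coeff n * odd_harm n * log_cos_moment (2 * n))) sums (2 / pi * bracket ln log_half_cos)" .
  moreover have "2 / pi * (central_coeff n * odd_harm n * log_cos_moment (2 * n))
      = central_sq n * odd_harm n / (2 * real n + 1)" for n
    unfolding log_cos_moment_even central_sq_eq two_over_pi_mult by (simp add: power2_eq_square mult_ac)
  ultimately show ?thesis
    by simp
qed

section \<open>Evaluation of the logarithmic integrals\<close>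

text \<open>Divided by the Wallis integrals, the even second moments drop by 2/(2k+1)^2 at each step
  and tend to 0, so the initial ratio is twice pi^2/8; the Wallis integral of index 0 contributes
  pi/2.\<close>

lemma log2_moment_0: "log2_moment 0 = pi ^ 3 / 8"
proof -
  define r where "r = (\<lambda>k. log2_moment (2 * k) / wallis_int (2 * k))"
  have W: "wallis_int (2 * k) \<noteq> 0" for k
    using wallis_int_pos[of k] by simp
  have step: "r (Suc k) = r k - 2 / (2 * real k + 1) ^ 2" for k
  proof -
    define x where "x = 2 * real k + 1"
    have x: "x > 0"
      by (simp add: x_def)
    have "(x + 1) * log2_moment (2 * Suc k) = x * log2_moment (2 * k) - 2 * log_cos_moment (2 * k)"
      using log2_moment_Suc_Suc[of "2 * k"] by (simp add: x_def add_ac)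
    moreover have "x * log_cos_moment (2 * k) = wallis_int (2 * k)"
      using log_cos_moment_eq[of "2 * k"] by (simp add: x_def add_ac)
    then have "log_cos_moment (2 * k) = wallis_int (2 * k) / x"
      using x by (simp add: field_simps)
    moreover have "(x + 1) * wallis_int (2 * Suc k) = x * wallis_int (2 * k)"
      using wallis_int_Suc_Suc[of "2 * k"] by (simp add: x_def add_ac)
    moreover have "r (Suc k) = ((x + 1) * log2_moment (2 * Suc k)) / ((x + 1) * wallis_int (2 * Suc k))"
      using x by (simp add: r_def)
    ultimately have "r (Suc k) = (x * log2_moment (2 * k) - 2 * (wallis_int (2 * k) / x)) / (x * wallis_int (2 * k))"
      by simp
    also have "\<dots> = r k - 2 / x ^ 2"
      using W[of k] x by (simp add: r_def field_simps power2_eq_square)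
    finally show ?thesis
      by (simp add: x_def)
  qed
  have r_eq: "r k = r 0 - 2 * odd_harm2 k" for k
    by (induction k) (simp_all add: step odd_harm2_Suc algebra_simps)
  have r_le: "r (k + 2) \<le> 4 * (2 * real k + 4) / ((2 * real k + 1) * (2 * real k + 3))" for k
  proof -
    define x where "x = 2 * real k + 1"
    have x: "x > 0"
      by (simp add: x_def)
    have 1: "(x + 1) * wallis_int (2 * k + 2) = x * wallis_int (2 * k)"
      using wallis_int_Suc_Suc[of "2 * k"] by (simp add: x_def add_ac)
    have 2: "(x + 3) * wallis_int (2 * k + 4) = (x + 2) * wallis_int (2 * k + 2)"
    proof -
      have "2 * k + 2 + 2 = 2 * k + 4"
        by simp
      then show ?thesis
        using wallis_int_Suc_Suc[of "2 * k + 2"] by (simp only:) (simp add: x_def add_ac)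
    qed
    have k2: "2 * (k + 2) = 2 * k + 4"
      by simp
    have W4: "wallis_int (2 * k + 4) > 0"
      using wallis_int_pos[of "k + 2"] by (simp only: k2)
    have "r (k + 2) = log2_moment (2 * k + 4) / wallis_int (2 * k + 4)"
      by (simp only: r_def k2)
    also have "\<dots> \<le> 4 * (wallis_int (2 * k) - wallis_int (2 * k + 2)) / wallis_int (2 * k + 4)"
      using W4 log2_moment_le[of "2 * k"] by (intro divide_right_mono) auto
    also have "wallis_int (2 * k) - wallis_int (2 * k + 2) = (x + 3) / (x * (x + 2)) * wallis_int (2 * k + 4)"
    proof -
      have a: "wallis_int (2 * k) - wallis_int (2 * k + 2) = wallis_int (2 * k + 2) / x"
        using 1 x by (simp add: field_simps)
      have b: "wallis_int (2 * k + 2) = (x + 3) * wallis_int (2 * k + 4) / (x + 2)"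
        using 2 x by (simp add: field_simps)
      show ?thesis
        unfolding a unfolding b by (simp add: mult.commute)
    qed
    also have "4 * ((x + 3) / (x * (x + 2)) * wallis_int (2 * k + 4)) / wallis_int (2 * k + 4) = 4 * (x + 3) / (x * (x + 2))"
      using W4 by simp
    finally show ?thesis
      by (simp add: x_def add_ac)
  qed
  have "(\<lambda>k. r (k + 2)) \<longlonglongrightarrow> 0"
  proof (rule tendsto_sandwich[OF _ _ tendsto_const])
    show "(\<lambda>k. 4 * (2 * real k + 4) / ((2 * real k + 1) * (2 * real k + 3))) \<longlonglongrightarrow> 0"
      by real_asymp
    show "\<forall>\<^sub>F k in sequentially. 0 \<le> r (k + 2)"
      unfolding r_def by (intro always_eventually allI divide_nonneg_pos log2_moment_nonneg wallis_int_pos)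
    show "\<forall>\<^sub>F k in sequentially. r (k + 2) \<le> 4 * (2 * real k + 4) / ((2 * real k + 1) * (2 * real k + 3))"
      by (intro always_eventually allI r_le)
  qed
  then have "r \<longlonglongrightarrow> 0"
    by (rule LIMSEQ_offset)
  moreover have "r \<longlonglongrightarrow> r 0 - 2 * (pi ^ 2 / 8)"
    by (subst r_eq[abs_def]) (intro tendsto_intros odd_harm2_tendsto)
  ultimately have "r 0 = pi ^ 2 / 4"
    using LIMSEQ_unique by fastforce
  then have "log2_moment 0 = pi ^ 2 / 4 * (pi / 2)"
    by (simp add: r_def wallis_int_0 field_simps)
  then show ?thesis
    by (simp add: power2_eq_square power3_eq_cube)
qed

lemma log_moment_0: "log_moment 0 = 2 * catalan_const"
  unfolding log_moment_def using bracket_neg_ln_1 by (simp add: bracket_commute)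

text \<open>Since 1 - sin(phi) = (1-t)^2/(1+t^2), the first function is -ln(1 - sin(phi)) = sum
  sin^n / n, whose moments \<open>log_moment_sums\<close> adds up.\<close>

lemma bracket_ln_1_minus_half_sin:
  "bracket (\<lambda>t. ln (1 + t ^ 2) - 2 * ln (1 - t)) neg_ln = 2 * catalan_const * ln 2"
proof -
  have "(\<lambda>n. bracket (\<lambda>t. 1 / real (Suc n) * half_sin t ^ Suc n) neg_ln)
      sums bracket (\<lambda>t. ln (1 + t ^ 2) - 2 * ln (1 - t)) neg_ln"
  proof (rule bracket_sums)
    fix t :: real assume t: "0 < t" "t < 1"
    have "(\<lambda>n. 1 / real (Suc n) * half_sin t ^ Suc n) sums - ln (1 - half_sin t)"
      using minus_ln_sums[of "half_sin t"] half_sin_bounds[OF t]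
      by (subst sums_Suc_iff) simp
    moreover have "ln (1 - half_sin t) = 2 * ln (1 - t) - ln (1 + t ^ 2)"
    proof -
      have "1 - half_sin t = (1 - t) ^ 2 / (1 + t ^ 2)"
      proof -
        have "1 - x / y = (y - x) / y" if "y \<noteq> 0" for x y :: real
          using that by (simp add: diff_divide_distrib)
        from this[of "1 + t ^ 2" "2 * t"] show ?thesis
          unfolding half_sin_def by (simp add: power2_diff add_ac)
      qed
      then show ?thesis
        using t by (simp add: ln_div ln_realpow)
    qed
    ultimately show "(\<lambda>n. 1 / real (Suc n) * half_sin t ^ Suc n) sums (ln (1 + t ^ 2) - 2 * ln (1 - t))"
      by simp
    show "0 \<le> 1 / real (Suc n) * half_sin t ^ Suc n" for n
      using half_sin_bounds[OF t] by (intro mult_nonneg_nonneg zero_le_power) auto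
  next
    show "square_int (\<lambda>t. 1 / real (Suc n) * half_sin t ^ Suc n)" for n
      by (intro square_int_cmult square_int_half_sin_power)
    show "square_int (\<lambda>t. ln (1 + t ^ 2) - 2 * ln (1 - t))"
      by (intro square_int_diff square_int_cmult square_int_ln_1_plus_square square_int_ln_1_minus)
  qed (simp_all add: square_int_neg_ln neg_ln_nonneg)
  then have "(\<lambda>n. log_moment (Suc n) / real (Suc n)) sums bracket (\<lambda>t. ln (1 + t ^ 2) - 2 * ln (1 - t)) neg_ln"
    unfolding bracket_cmult_left log_moment_def by simp
  with log_moment_sums show ?thesis
    by (simp add: sums_unique2 log_moment_0)
qed

text \<open>1/(n+1)^3 is half the integral of t^n ln(t)^2, so Li_3(z) is half the integral of
  ln(t)^2 z/(1 - z t). At z = (1+i)/2 the imaginary part of the kernel is 1/((1-t)^2 + 1). The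
  numbers Im(z^n) change sign, so the geometric bound from |z| < 1 supplies a majorant.\<close>

lemma im_trilog_integral:
  "((\<lambda>t. 1 / 2 * ln t ^ 2 / ((1 - t) ^ 2 + 1)) has_integral im_trilog) {0<..<1}"
proof -
  define z where "z = (1 + \<i>) / 2"
  define p where "p = (\<lambda>n. Im (z ^ Suc n))"
  have "norm z < 1"
    by (simp add: z_def norm_divide norm_complex_def[of "1 + \<i>"] real_less_lsqrt)
  define S where "S = (\<lambda>N t. \<Sum>n<N. p n / 2 * (t ^ n * ln t ^ 2))"
  have S: "(S N has_integral (\<Sum>n<N. p n / 2 * (2 / real (Suc n) ^ 3))) {0<..<1}" for N
    unfolding S_def by (intro has_integral_sum has_integral_mult_right has_integral_ln_square_power) auto
  have p_le: "\<bar>p n\<bar> \<le> norm z ^ n" for n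
  proof -
    have "\<bar>p n\<bar> \<le> norm z ^ Suc n"
      unfolding p_def norm_power[symmetric] by (rule abs_Im_le_cmod)
    also have "\<dots> \<le> norm z ^ n"
      using \<open>norm z < 1\<close> by (intro power_decreasing) auto
    finally show ?thesis .
  qed
  define g where "g = (\<lambda>t::real. 1 / 2 * ln t ^ 2 / ((1 - t) ^ 2 + 1))"
  have S_int: "S N integrable_on {0<..<1}" for N
    using S by blast
  have h_int: "(\<lambda>t. 1 / (1 - norm z) * ln t ^ 2) integrable_on {0<..<1}"
    using has_integral_mult_right[OF has_integral_ln_square_power[of 0], of "1 / (1 - norm z)"]
    by (auto simp: integrable_on_def)
  have S_le: "norm (S N t) \<le> 1 / (1 - norm z) * ln t ^ 2" if "t \<in> {0<..<1}" for N t
  proof -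
    have "norm (S N t) \<le> (\<Sum>n<N. norm (p n / 2 * (t ^ n * ln t ^ 2)))"
      unfolding S_def by (rule norm_sum)
    also have "\<dots> \<le> (\<Sum>n<N. norm z ^ n * ln t ^ 2)"
    proof (rule sum_mono)
      fix n
      have "\<bar>p n\<bar> / 2 * t ^ n \<le> norm z ^ n * 1"
        using p_le[of n] that by (intro mult_mono power_le_one) auto
      then have "\<bar>p n\<bar> / 2 * t ^ n * ln t ^ 2 \<le> norm z ^ n * ln t ^ 2"
        by (intro mult_right_mono) auto
      then show "norm (p n / 2 * (t ^ n * ln t ^ 2)) \<le> norm z ^ n * ln t ^ 2"
        using that by (simp add: abs_mult mult_ac)
    qed
    also have "\<dots> = (\<Sum>n<N. norm z ^ n) * ln t ^ 2"
      by (simp add: sum_distrib_right)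
    also have "\<dots> \<le> 1 / (1 - norm z) * ln t ^ 2"
    proof (rule mult_right_mono)
      have "(\<Sum>n<N. norm z ^ n) \<le> (\<Sum>n. norm z ^ n)"
        using \<open>norm z < 1\<close> by (intro sum_le_suminf summable_geometric) auto
      then show "(\<Sum>n<N. norm z ^ n) \<le> 1 / (1 - norm z)"
        using \<open>norm z < 1\<close> by (simp add: suminf_geometric)
    qed simp
    finally show ?thesis .
  qed
  have S_lim: "(\<lambda>N. S N t) \<longlonglongrightarrow> g t" if t: "t \<in> {0<..<1}" for t
  proof -
    have "norm (z * of_real t) < 1"
      using mult_strict_mono[of "norm z" 1 t 1] \<open>norm z < 1\<close> t by (simp add: norm_mult)
    then have "(\<lambda>n. z * (z * of_real t) ^ n) sums (z * (1 / (1 - z * of_real t)))"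
      by (intro sums_mult geometric_sums)
    then have "(\<lambda>n. Im (z * (z * of_real t) ^ n)) sums Im (z * (1 / (1 - z * of_real t)))"
      by (rule bounded_linear.sums[OF bounded_linear_Im])
    moreover have "Im (z * (z * of_real t) ^ n) = p n * t ^ n" for n
    proof -
      have "z * (z * of_real t) ^ n = z ^ Suc n * of_real (t ^ n)"
        by (simp add: power_mult_distrib)
      then show ?thesis
        unfolding p_def by (simp only: times_complex.sel Re_complex_of_real Im_complex_of_real mult_zero_right add_0)
    qed
    moreover have "Im (z * (1 / (1 - z * of_real t))) = 1 / ((1 - t) ^ 2 + 1)"
    proof -
      have z: "Re z = 1 / 2" "Im z = 1 / 2"
        by (simp_all add: z_def)
      have "Im (z / (1 - z * of_real t)) = (1 / 2) / ((1 - t / 2) ^ 2 + (t / 2) ^ 2)"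
      proof -
        have "Im (z / (1 - z * of_real t)) = ((1 - t / 2) / 2 + t / 4) / ((1 - t / 2) ^ 2 + (t / 2) ^ 2)"
          by (simp add: Im_divide z)
        also have "(1 - t / 2) / 2 + t / 4 = 1 / 2"
          by (simp add: field_simps)
        finally show ?thesis .
      qed
      also have "(1 - t / 2) ^ 2 + (t / 2) ^ 2 = ((1 - t) ^ 2 + 1) / 2"
        by (simp add: power2_eq_square field_simps)
      finally show ?thesis
        by simp
    qed
    ultimately have "(\<lambda>n. p n * t ^ n) sums (1 / ((1 - t) ^ 2 + 1))"
      by simp
    from sums_mult2[OF this, of "ln t ^ 2 / 2"] have "(\<lambda>n. p n / 2 * (t ^ n * ln t ^ 2)) sums g t"
      by (simp add: g_def mult_ac)
    then show ?thesis
      by (simp add: sums_def S_def)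
  qed
  note dom = dominated_convergence[OF S_int h_int S_le S_lim]
  have "(\<lambda>n. p n / real (Suc n) ^ 3) sums integral {0<..<1} g"
    using dom(2) integral_unique[OF S] by (simp add: sums_def del: of_nat_Suc)
  moreover have "(\<lambda>n. p n / real (Suc n) ^ 3) sums im_trilog"
  proof -
    have "summable (\<lambda>n. z ^ Suc n / of_nat (Suc n) ^ 3)"
    proof (rule summable_norm_cancel, rule summable_comparison_test')
      show "summable (\<lambda>n. norm z ^ n)"
        using \<open>norm z < 1\<close> by (intro summable_geometric) auto
      show "norm (norm (z ^ Suc n / of_nat (Suc n) ^ 3)) \<le> norm z ^ n" for n
      proof -
        have "norm z ^ Suc n / real (Suc n) ^ 3 \<le> norm z ^ n / 1"
          using \<open>norm z < 1\<close> by (intro frac_le power_decreasing one_le_power) auto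
        then show ?thesis
          by (simp add: norm_divide norm_power norm_mult del: of_nat_Suc)
      qed
    qed
    then have "(\<lambda>n. z ^ Suc n / of_nat (Suc n) ^ 3) sums polylog 3 z"
      unfolding polylog_def by (rule summable_sums)
    then have "(\<lambda>n. Im (z ^ Suc n / of_nat (Suc n) ^ 3)) sums Im (polylog 3 z)"
      by (rule bounded_linear.sums[OF bounded_linear_Im])
    moreover have "Im (z ^ Suc n / of_nat (Suc n) ^ 3) = p n / real (Suc n) ^ 3" for n
    proof -
      have "(of_nat (Suc n) :: complex) ^ 3 = of_real (real (Suc n) ^ 3)"
        by simp
      then show ?thesis
        unfolding p_def by (simp only: Im_divide_of_real)
    qed
    ultimately show ?thesis
      by (simp add: im_trilog_def z_def)
  qed
  ultimately have "integral {0<..<1} g = im_trilog"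
    by (rule sums_unique2)
  then show ?thesis
    using dom(1) unfolding g_def by (metis integrable_integral)
qed

lemma bracket_ln_1_minus: "bracket (\<lambda>t. ln (1 - t)) (\<lambda>t. ln (1 - t)) = 4 * im_trilog"
proof -
  have "((\<lambda>t. 1 / 2 * ln (1 - t) ^ 2 / ((1 - (1 - t)) ^ 2 + 1)) has_integral im_trilog) {0<..<1}"
    using has_integral_reflect_unit_interval[of "\<lambda>t. 1 / 2 * ln t ^ 2 / ((1 - t) ^ 2 + 1)" im_trilog] im_trilog_integral
    by simp
  from has_integral_mult_right[OF this, of 4]
  have "((\<lambda>t. ln (1 - t) * ln (1 - t) * half_angle_weight t) has_integral 4 * im_trilog) {0<..<1}"
  proof (rule has_integral_eq[rotated])
    fix t :: real
    have "4 * (1 / 2 * x ^ 2 / y) = x * x * (2 / y)" for x y :: real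
      by (simp add: power2_eq_square)
    moreover have "(1 - (1 - t)) ^ 2 + 1 = 1 + t ^ 2"
      by simp
    ultimately show "4 * (1 / 2 * ln (1 - t) ^ 2 / ((1 - (1 - t)) ^ 2 + 1)) = ln (1 - t) * ln (1 - t) * half_angle_weight t"
      by (simp only: half_angle_weight_def)
  qed
  then show ?thesis
    unfolding bracket_def by (rule integral_unique)
qed

text \<open>The weight hypothesis says that g doubles dphi up to sign. Only the square of f is
  compared with that of ln g, since ln u and ln(1/u) have equal squares; this admits a doubling map
  followed by a reciprocal.\<close>

lemma doubling_change_of_variables:
  fixes S :: "real set" and g g' :: "real \<Rightarrow> real"
  assumes "S \<in> sets lebesgue" "inj_on g S" "g ` S = {0<..<1}"
    and "\<And>t. t \<in> S \<Longrightarrow> (g has_field_derivative g' t) (at t)"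
    and weight: "\<And>t. t \<in> S \<Longrightarrow> \<bar>g' t\<bar> * half_angle_weight (g t) = 2 * half_angle_weight t"
    and f: "\<And>t. t \<in> S \<Longrightarrow> f t ^ 2 = ln (g t) ^ 2"
  shows "((\<lambda>t. f t ^ 2 * half_angle_weight t) has_integral (bracket ln ln / 2)) S"
proof -
  have "(\<lambda>t. \<bar>g' t\<bar> * (ln (g t) * ln (g t) * half_angle_weight (g t))) absolutely_integrable_on S \<and>
      integral S (\<lambda>t. \<bar>g' t\<bar> * (ln (g t) * ln (g t) * half_angle_weight (g t))) = bracket ln ln"
    by (rule iffD2[OF has_absolute_integral_change_of_variables_1'[of S g g']])
      (use assms bracket_integrable[OF square_int_ln square_int_ln] in
        \<open>auto simp: bracket_def intro: has_field_derivative_at_within\<close>)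
  then have "((\<lambda>t. \<bar>g' t\<bar> * (ln (g t) * ln (g t) * half_angle_weight (g t))) has_integral bracket ln ln) S"
    by (metis integrable_integral set_lebesgue_integral_eq_integral(1))
  from has_integral_mult_right[OF this, of "1 / 2"]
  have "((\<lambda>t. 1 / 2 * (\<bar>g' t\<bar> * (ln (g t) * ln (g t) * half_angle_weight (g t)))) has_integral (bracket ln ln / 2)) S"
    by simp
  then show ?thesis
  proof (rule has_integral_eq[rotated])
    fix t assume "t \<in> S"
    have "1 / 2 * (\<bar>g' t\<bar> * (ln (g t) * ln (g t) * half_angle_weight (g t)))
        = 1 / 2 * (\<bar>g' t\<bar> * half_angle_weight (g t)) * ln (g t) ^ 2"
      by (simp add: power2_eq_square)
    then show "1 / 2 * (\<bar>g' t\<bar> * (ln (g t) * ln (g t) * half_angle_weight (g t))) = f t ^ 2 * half_angle_weight t"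
      using weight[OF \<open>t \<in> S\<close>] f[OF \<open>t \<in> S\<close>] by simp
  qed
qed

definition log_tan_double :: "real \<Rightarrow> real" where
  "log_tan_double t = ln 2 + ln t - (ln (1 - t) + ln (1 + t))"

lemma log_tan_double: "0 < t \<Longrightarrow> t < 1 \<Longrightarrow> log_tan_double t = ln (2 * t / (1 - t ^ 2))"
proof -
  assume t: "0 < t" "t < 1"
  have "1 - t ^ 2 = (1 - t) * (1 + t)"
    by (simp add: power2_eq_square algebra_simps)
  then have "ln (2 * t / (1 - t ^ 2)) = ln (2 * t) - ln ((1 - t) * (1 + t))"
    using t by (simp add: ln_divide_pos)
  then show ?thesis
    using t by (simp add: log_tan_double_def ln_mult_pos)
qed

text \<open>The tangent doubling map \<open>t \<mapsto> 2 t / (1 - t\<^sup>2)\<close> and its reciprocal each cover the unit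
  interval once.\<close>

lemma bracket_log_tan_double: "bracket log_tan_double log_tan_double = bracket ln ln"
proof -
  define S1 S2 :: "real set" where "S1 = {0<..<1} \<inter> {t. 2 * t < 1 - t ^ 2}" and "S2 = {0<..<1} \<inter> {t. 1 - t ^ 2 < 2 * t}"
  have "open S1" "open S2"
    unfolding S1_def S2_def by (intro open_Int open_Collect_less continuous_intros; simp)+
  then have meas: "S1 \<in> sets lebesgue" "S2 \<in> sets lebesgue"
    by auto
  have t2: "t ^ 2 < 1" if "0 < t" "t < 1" for t :: real
    using that by (simp add: power_less_one_iff)
  have I1: "((\<lambda>t. log_tan_double t ^ 2 * half_angle_weight t) has_integral (bracket ln ln / 2)) S1"
  proof (rule doubling_change_of_variables[OF meas(1)])
    let ?g = "\<lambda>t::real. 2 * t / (1 - t ^ 2)"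
    show "inj_on ?g S1"
    proof (rule inj_onI)
      fix x y assume "x \<in> S1" "y \<in> S1" and eq: "?g x = ?g y"
      then have xy: "0 < x" "x < 1" "0 < y" "y < 1"
        by (auto simp: S1_def)
      then have "2 * x * (1 - y ^ 2) = 2 * y * (1 - x ^ 2)"
        using eq t2[of x] t2[of y] by (simp add: field_simps)
      then have "(x - y) * (1 + x * y) = 0"
        by algebra
      moreover have "1 + x * y > 0"
        using xy by (simp add: add_pos_pos)
      ultimately show "x = y"
        by simp
    qed
    show "?g ` S1 = {0<..<1}"
    proof (intro set_eqI iffI)
      fix u :: real assume u: "u \<in> {0<..<1}"
      define r where "r = sqrt (1 + u ^ 2)"
      have r: "r ^ 2 = 1 + u ^ 2" "r > 1"
        using u by (simp_all add: r_def)
      \<comment> \<open>The positive root of u t^2 + 2 t - u = 0, rationalised; it is the half-angle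
        formula for the tangent.\<close>
      define t where "t = u / (1 + r)"
      have t: "0 < t" "t < 1"
        using u r by (auto simp: t_def)
      have "(1 + r) ^ 2 - u ^ 2 = 2 * (1 + r)"
        using r by (simp add: power2_eq_square algebra_simps)
      then have "1 - t ^ 2 = 2 / (1 + r)"
      proof -
        have "1 - (x / y) ^ 2 = (y ^ 2 - x ^ 2) / y ^ 2" if "y \<noteq> 0" for x y :: real
          using that by (simp add: power_divide diff_divide_distrib)
        from this[of "1 + r" u] have "1 - t ^ 2 = 2 * (1 + r) / (1 + r) ^ 2"
          using \<open>(1 + r) ^ 2 - u ^ 2 = 2 * (1 + r)\<close> r(2) by (simp add: t_def)
        then show ?thesis
          using r(2) by (simp add: power2_eq_square[of "1 + r"] del: distrib_left_numeral)
      qed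
      then have "u = ?g t" "2 * t < 1 - t ^ 2"
        using u r by (auto simp: t_def divide_strict_right_mono)
      then show "u \<in> ?g ` S1"
        using t by (auto simp: S1_def)
    qed (use t2 in \<open>auto simp: S1_def\<close>)
    fix t assume "t \<in> S1"
    then have t: "0 < t" "t < 1"
      by (auto simp: S1_def)
    show "(?g has_field_derivative 2 * (1 + t ^ 2) / (1 - t ^ 2) ^ 2) (at t)"
      using t2[OF t] by (auto intro!: derivative_eq_intros simp: power2_eq_square[of "1 - t ^ 2"]) (simp add: power2_eq_square algebra_simps)
    have "1 + (x / y) ^ 2 = (y ^ 2 + x ^ 2) / y ^ 2" if "y \<noteq> 0" for x y :: real
      using that by (simp add: power_divide add_divide_distrib)
    from this[of "1 - t ^ 2" "2 * t"] have "1 + ?g t ^ 2 = ((1 - t ^ 2) ^ 2 + (2 * t) ^ 2) / (1 - t ^ 2) ^ 2"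
      using t2[OF t] by simp
    also have "(1 - t ^ 2) ^ 2 + (2 * t) ^ 2 = (1 + t ^ 2) ^ 2"
      by algebra
    finally have "half_angle_weight (?g t) = 2 * (1 - t ^ 2) ^ 2 / (1 + t ^ 2) ^ 2"
      by (simp add: half_angle_weight_def)
    then show "\<bar>2 * (1 + t ^ 2) / (1 - t ^ 2) ^ 2\<bar> * half_angle_weight (?g t) = 2 * half_angle_weight t"
      using t2[OF t] by (simp add: half_angle_weight_def abs_mult power2_eq_square[of "1 + t ^ 2"] del: distrib_left_numeral)
    show "log_tan_double t ^ 2 = ln (?g t) ^ 2"
      by (simp add: log_tan_double[OF t])
  qed
  have I2: "((\<lambda>t. log_tan_double t ^ 2 * half_angle_weight t) has_integral (bracket ln ln / 2)) S2"
  proof (rule doubling_change_of_variables[OF meas(2)])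
    let ?g = "\<lambda>t::real. (1 - t ^ 2) / (2 * t)"
    show "inj_on ?g S2"
    proof (rule inj_onI)
      fix x y assume "x \<in> S2" "y \<in> S2" and eq: "?g x = ?g y"
      then have xy: "0 < x" "x < 1" "0 < y" "y < 1"
        by (auto simp: S2_def)
      then have "2 * x * (1 - y ^ 2) = 2 * y * (1 - x ^ 2)"
        using eq by (simp add: field_simps)
      then have "(x - y) * (1 + x * y) = 0"
        by algebra
      moreover have "1 + x * y > 0"
        using xy by (simp add: add_pos_pos)
      ultimately show "x = y"
        by simp
    qed
    show "?g ` S2 = {0<..<1}"
    proof (intro set_eqI iffI)
      fix u :: real assume u: "u \<in> {0<..<1}"
      define r where "r = sqrt (1 + u ^ 2)"
      have r: "r ^ 2 = 1 + u ^ 2" "r > u"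
        using u by (auto simp: r_def intro!: real_less_rsqrt)
      have "r < 1 + u"
        unfolding r_def using u by (intro real_less_lsqrt) (auto simp: power2_eq_square algebra_simps)
      \<comment> \<open>The positive root of t^2 + 2 u t - 1 = 0.\<close>
      define t where "t = r - u"
      have t: "0 < t" "t < 1"
        using r \<open>r < 1 + u\<close> by (auto simp: t_def)
      have "1 - t ^ 2 = 2 * u * t"
        using r(1) by (simp add: t_def power2_eq_square algebra_simps)
      then have "u = ?g t" "1 - t ^ 2 < 2 * t"
        using u t by auto
      then show "u \<in> ?g ` S2"
        using t by (auto simp: S2_def)
    qed (use t2 in \<open>auto simp: S2_def\<close>)
    fix t assume "t \<in> S2"
    then have t: "0 < t" "t < 1"
      by (auto simp: S2_def)
    show "(?g has_field_derivative - ((1 + t ^ 2) / (2 * t ^ 2))) (at t)"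
      using t by (auto intro!: derivative_eq_intros simp: field_simps power2_eq_square)
    have "1 + (x / y) ^ 2 = (y ^ 2 + x ^ 2) / y ^ 2" if "y \<noteq> 0" for x y :: real
      using that by (simp add: power_divide add_divide_distrib)
    from this[of "2 * t" "1 - t ^ 2"] have "1 + ?g t ^ 2 = ((2 * t) ^ 2 + (1 - t ^ 2) ^ 2) / (2 * t) ^ 2"
      using t by simp
    also have "(2 * t) ^ 2 + (1 - t ^ 2) ^ 2 = (1 + t ^ 2) ^ 2"
      by algebra
    finally have w: "half_angle_weight (?g t) = 2 * (2 * t) ^ 2 / (1 + t ^ 2) ^ 2"
      by (simp add: half_angle_weight_def)
    have "(y / (2 * t ^ 2)) * (2 * (2 * t) ^ 2 / y ^ 2) = 2 * (2 / y)" if "y \<noteq> 0" for y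
      using that t by (simp add: power2_eq_square)
    from this[of "1 + t ^ 2"] show "\<bar>- ((1 + t ^ 2) / (2 * t ^ 2))\<bar> * half_angle_weight (?g t) = 2 * half_angle_weight t"
      unfolding w by (simp add: half_angle_weight_def abs_mult)
    have "ln (?g t) = - ln (2 * t / (1 - t ^ 2))"
      using t t2[OF t] by (simp add: ln_divide_pos)
    then show "log_tan_double t ^ 2 = ln (?g t) ^ 2"
      by (simp add: log_tan_double[OF t])
  qed
  have "((\<lambda>t. log_tan_double t ^ 2 * half_angle_weight t) has_integral (bracket ln ln / 2 + bracket ln ln / 2)) (S1 \<union> S2)"
  proof (rule has_integral_Un[OF I1 I2])
    have "S1 \<inter> S2 = {}"
      by (auto simp: S1_def S2_def)
    then show "negligible (S1 \<inter> S2)"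
      by simp
  qed
  moreover have "((\<lambda>t. log_tan_double t ^ 2 * half_angle_weight t) has_integral y) (S1 \<union> S2)
      \<longleftrightarrow> ((\<lambda>t. log_tan_double t ^ 2 * half_angle_weight t) has_integral y) {0<..<1}" for y
  proof (rule has_integral_spike_set_eq)
    \<comment> \<open>The two pieces miss only t = tan(pi/8) = sqrt 2 - 1, where the doubled tangent
      equals 1.\<close>
    show "negligible {x \<in> {0<..<1} - (S1 \<union> S2). log_tan_double x ^ 2 * half_angle_weight x \<noteq> 0}"
    proof (rule negligible_subset[OF negligible_finite[of "{sqrt 2 - 1}"]])
      show "{x \<in> {0<..<1} - (S1 \<union> S2). log_tan_double x ^ 2 * half_angle_weight x \<noteq> 0} \<subseteq> {sqrt 2 - 1}"
      proof
        fix x assume "x \<in> {x \<in> {0<..<1} - (S1 \<union> S2). log_tan_double x ^ 2 * half_angle_weight x \<noteq> 0}"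
        then have "0 < x" "2 * x = 1 - x ^ 2"
          by (auto simp: S1_def S2_def)
        then have "(x + 1) ^ 2 = 2"
          by (simp add: power2_eq_square algebra_simps)
        then have "sqrt 2 = x + 1"
          using \<open>0 < x\<close> by (intro real_sqrt_unique) auto
        then show "x \<in> {sqrt 2 - 1}"
          by simp
      qed
    qed simp
    show "negligible {x \<in> S1 \<union> S2 - {0<..<1}. log_tan_double x ^ 2 * half_angle_weight x \<noteq> 0}"
      by (rule negligible_subset[OF negligible_empty]) (auto simp: S1_def S2_def)
  qed
  ultimately show ?thesis
    unfolding bracket_def[of log_tan_double] by (intro integral_unique) (simp add: power2_eq_square)
qed

section \<open>Linear relations among the logarithmic integrals\<close>

lemma bracket_const: "bracket (\<lambda>_. c) g = c * bracket (\<lambda>_. 1) g"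
  using bracket_cmult_left[of c "\<lambda>_. 1" g] by simp

lemma bracket_square_diff:
  assumes "square_int f" "square_int g"
  shows "bracket (\<lambda>t. f t - g t) (\<lambda>t. f t - g t) = bracket f f - 2 * bracket f g + bracket g g"
  using assms by (simp add: bracket_diff_left bracket_right square_int_diff bracket_commute[of g f])

lemma bracket_square_add:
  assumes "square_int f" "square_int g"
  shows "bracket (\<lambda>t. f t + g t) (\<lambda>t. f t + g t) = bracket f f + 2 * bracket f g + bracket g g"
  using assms by (simp add: bracket_add_left bracket_right square_int_add bracket_commute[of g f])

lemma ln_cayley:
  fixes t :: real
  assumes "0 < t" "t < 1"
  shows "ln ((1 - t) / (1 + t)) = ln (1 - t) - ln (1 + t)"
    and "ln (1 - (1 - t) / (1 + t)) = ln 2 + ln t - ln (1 + t)"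
    and "ln (1 + (1 - t) / (1 + t)) = ln 2 - ln (1 + t)"
proof -
  have "1 - (1 - t) / (1 + t) = 2 * t / (1 + t)" "1 + (1 - t) / (1 + t) = 2 / (1 + t)"
    using assms by (simp_all add: field_simps)
  then show "ln ((1 - t) / (1 + t)) = ln (1 - t) - ln (1 + t)"
    "ln (1 - (1 - t) / (1 + t)) = ln 2 + ln t - ln (1 + t)" "ln (1 + (1 - t) / (1 + t)) = ln 2 - ln (1 + t)"
    using assms by (simp_all add: ln_divide_pos ln_mult_pos)
qed

text \<open>With \<open>a = ln t\<close>, \<open>b = ln (1 - t)\<close>, \<open>c = ln (1 + t)\<close> and \<open>d = ln (1 + t\<^sup>2)\<close>, the integrals of
  \<open>a a\<close> and \<open>b b\<close> are known and the other products are not; the relations coming from the Cayley map,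
  from tangent doubling and from the telescoped moments determine the combination \<open>a (b + c - d)\<close>.\<close>

lemma bracket_ln_log_half_cos:
  "bracket ln log_half_cos = - 8 * im_trilog + 3 * pi ^ 3 / 16 + pi * ln 2 ^ 2 / 4 - 2 * ln 2 * catalan_const"
proof -
  define b c d o1 p e :: "real \<Rightarrow> real" where "b = (\<lambda>t. ln (1 - t))" and "c = (\<lambda>t. ln (1 + t))"
    and "d = (\<lambda>t. ln (1 + t ^ 2))" and "o1 = (\<lambda>_. 1)" and "p = (\<lambda>t. ln 2 + ln t)"
    and "e = (\<lambda>t. b t + c t)"
  have sq: "square_int ln" "square_int b" "square_int c" "square_int d" "square_int o1"
    by (simp_all add: b_def c_def d_def o1_def)
  then have sq': "square_int p" "square_int e"
    unfolding p_def e_def by (intro square_int_add square_int_const; simp)+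
  have oo: "bracket o1 o1 = pi / 2"
    using wallis_int_0 by (simp add: wallis_int_def o1_def)
  have ao: "bracket ln o1 = - 2 * catalan_const"
    using bracket_neg_ln_1 bracket_minus_left[of ln o1] by (simp add: neg_ln_def[abs_def] o1_def)
  have aa: "bracket ln ln = pi ^ 3 / 8"
    using log2_moment_0 bracket_minus_left[of ln "\<lambda>t. - ln t"] bracket_right(4)[of ln ln]
    by (simp add: log2_moment_def neg_ln_def[abs_def])
  have pg: "bracket p g = ln 2 * bracket g o1 + bracket ln g" if "square_int g" for g
  proof -
    have "bracket p g = bracket (\<lambda>_. ln 2) g + bracket ln g"
      unfolding p_def by (rule bracket_add_left[OF square_int_const sq(1) that])
    then show ?thesis
      unfolding bracket_const[of "ln 2"] o1_def bracket_commute[of g "\<lambda>_. 1"] .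
  qed
  have pp: "bracket p p = ln 2 ^ 2 * bracket o1 o1 + 2 * ln 2 * bracket ln o1 + bracket ln ln"
    unfolding pg[OF sq'(1)] pg[OF sq(5)] bracket_commute[of ln p] pg[OF sq(1)]
    by (simp add: power2_eq_square algebra_simps)
  have cay_b: "bracket b g = bracket (\<lambda>t. p t - c t) (\<lambda>t. g ((1 - t) / (1 + t)))" if "square_int g" for g
    unfolding bracket_cayley[OF sq(2) that] by (rule bracket_cong) (simp_all add: ln_cayley b_def c_def p_def)
  \<comment> \<open>The reflection sends c to ln 2 - c, so the integral is ln 2 times pi/2 minus
    itself.\<close>
  have co: "bracket c o1 = pi * ln 2 / 4"
  proof -
    have "bracket c o1 = bracket (\<lambda>t. ln 2 - c t) o1"
      unfolding bracket_cayley[OF sq(3,5)] by (rule bracket_cong) (simp_all add: ln_cayley c_def o1_def)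
    also have "\<dots> = ln 2 * bracket o1 o1 - bracket c o1"
      using sq by (simp add: bracket_diff_left bracket_const[of "ln 2"] o1_def)
    finally show ?thesis
      by (simp add: oo field_simps)
  qed
  have bo: "bracket b o1 = ln 2 * bracket o1 o1 + bracket ln o1 - bracket c o1"
    unfolding cay_b[OF sq(5)] using sq sq' pg[OF sq(5)]
    by (simp add: bracket_diff_left o1_def)
  have bb: "bracket b b = bracket p p - 2 * bracket p c + bracket c c"
  proof -
    have "bracket b b = bracket (\<lambda>t. p t - c t) (\<lambda>t. p t - c t)"
      unfolding cay_b[OF sq(2)] by (rule bracket_cong) (simp_all add: ln_cayley b_def c_def p_def)
    then show ?thesis
      using sq sq' by (simp add: bracket_square_diff)
  qed
  have aa': "bracket ln ln = bracket b b - 2 * bracket b c + bracket c c"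
  proof -
    have "bracket ln ln = bracket (\<lambda>t. b t - c t) (\<lambda>t. b t - c t)"
      unfolding bracket_cayley[OF sq(1) sq(1)] by (rule bracket_cong) (simp_all add: ln_cayley b_def c_def)
    then show ?thesis
      using sq by (simp add: bracket_square_diff)
  qed
  have dbl: "bracket ln ln = bracket p p - 2 * bracket p e + bracket e e"
  proof -
    have "log_tan_double = (\<lambda>t. p t - e t)"
      by (simp add: fun_eq_iff log_tan_double_def p_def e_def b_def c_def)
    with bracket_log_tan_double have "bracket (\<lambda>t. p t - e t) (\<lambda>t. p t - e t) = bracket ln ln"
      by simp
    then show ?thesis
      unfolding bracket_square_diff[OF sq'] by simp
  qed
  have ge: "bracket g e = bracket g b + bracket g c" if "square_int g" for g
    unfolding e_def using sq that by (simp add: bracket_right)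
  have ee: "bracket e e = bracket b b + 2 * bracket b c + bracket c c"
    unfolding e_def using sq by (simp add: bracket_square_add)
  have eo: "bracket e o1 = bracket b o1 + bracket c o1"
    unfolding e_def using sq by (simp add: bracket_add_left)
  have q: "2 * bracket ln b - bracket ln d = 2 * catalan_const * ln 2"
  proof -
    have "bracket (\<lambda>t. d t - 2 * b t) neg_ln = 2 * catalan_const * ln 2"
      using bracket_ln_1_minus_half_sin by (simp add: d_def b_def)
    moreover have "bracket (\<lambda>t. d t - 2 * b t) neg_ln = bracket d neg_ln - 2 * bracket b neg_ln"
      using sq by (simp add: bracket_diff_left bracket_cmult_left square_int_cmult square_int_neg_ln)
    moreover have "bracket g neg_ln = - bracket ln g" for g
      unfolding neg_ln_def[abs_def] bracket_right(4) bracket_commute[of g ln] ..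
    ultimately show ?thesis
      by simp
  qed
  have ed: "log_half_cos = (\<lambda>t. e t - d t)"
    by (simp add: fun_eq_iff log_half_cos_def e_def b_def c_def d_def)
  have "bracket ln log_half_cos = bracket ln b + bracket ln c - bracket ln d"
    unfolding ed bracket_right(2)[OF sq'(2) sq(4) sq(1)] ge[OF sq(1)] ..
  \<comment> \<open>In the notation above, writing ab for the bracket of a and b: the target is (ac
    - ab) + (2ab - ad), and \<open>q\<close> gives the second bracket. Twice \<open>bb\<close> minus
    \<open>dbl\<close> isolates 2(ac - ab) at the cost of cc - 2bc, which \<open>aa'\<close>
    replaces by aa - bb.\<close>
  also have "\<dots> = - 2 * bracket b b + 3 / 2 * bracket ln ln + ln 2 ^ 2 * bracket o1 o1 / 2 + ln 2 * bracket ln o1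
      + ln 2 * (bracket b o1 - bracket c o1) + 2 * catalan_const * ln 2"
    using bb aa' dbl q unfolding pp pg[OF sq(3)] pg[OF sq'(2)] ge[OF sq(1)] ee eo
    by (simp add: algebra_simps)
  also have "bracket b b = 4 * im_trilog"
    using bracket_ln_1_minus by (simp add: b_def)
  finally show ?thesis
    unfolding bo oo ao co aa by (simp add: power2_eq_square algebra_simps)
qed

text \<open>Expanding 1/(1-t) gives sum 1/(n+1)^2, the value Li_2(1). The majorant 1 - ln t rests on
  -t ln t <= 1 - t.\<close>

lemma integral_neg_ln_over_1_minus:
  "(\<lambda>t. neg_ln t / (1 - t)) absolutely_integrable_on {0<..<1}"
  "integral {0<..<1} (\<lambda>t. neg_ln t / (1 - t)) = pi ^ 2 / 6"
proof -
  show int: "(\<lambda>t. neg_ln t / (1 - t)) absolutely_integrable_on {0<..<1}"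
  proof (rule absolutely_integrable_unit_interval)
    show "continuous_on {0<..<1} (\<lambda>t. neg_ln t / (1 - t))"
      unfolding neg_ln_def by (auto intro!: continuous_intros)
    have "((\<lambda>t. 1 + t ^ 0 * neg_ln t) has_integral 1 + 1 / real (Suc 0) ^ 2) {0<..<1}"
      using has_integral_add[OF _ has_integral_power_neg_ln[of 0], of "\<lambda>_. 1" 1] has_integral_const_real[of "1::real" 0 1]
      by (simp add: has_integral_Icc_iff_Ioo)
    then show "(\<lambda>t. 1 + neg_ln t) integrable_on {0<..<1}"
      by (auto simp: integrable_on_def)
    show "\<bar>neg_ln t / (1 - t)\<bar> \<le> 1 + neg_ln t" if t: "0 < t" "t < 1" for t
    proof -
      have "ln (1 / t) \<le> 1 / t - 1"
        using t by (intro ln_le_minus_one) auto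
      then have "neg_ln t * t \<le> (1 / t - 1) * t"
        using t by (intro mult_right_mono) (auto simp: neg_ln_def ln_div)
      then have "neg_ln t \<le> (1 + neg_ln t) * (1 - t)"
        using t by (simp add: algebra_simps)
      then show ?thesis
        using t neg_ln_nonneg[OF t] by (simp add: pos_divide_le_eq)
    qed
  qed
  have "(\<lambda>n. 1 / real (Suc n) ^ 2) sums integral {0<..<1} (\<lambda>t. neg_ln t / (1 - t))"
  proof (rule integral_sums_nonneg[OF has_integral_power_neg_ln])
    show "(\<lambda>n. t ^ n * neg_ln t) sums (neg_ln t / (1 - t))" if "t \<in> {0<..<1}" for t
      using sums_mult2[OF geometric_sums[of t], of "neg_ln t"] that by simp
  qed (use int neg_ln_nonneg in \<open>auto intro: set_lebesgue_integral_eq_integral(1)\<close>)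
  then show "integral {0<..<1} (\<lambda>t. neg_ln t / (1 - t)) = pi ^ 2 / 6"
    using sums_unique2[OF _ inverse_squares_sums] by (simp add: add.commute)
qed

section \<open>Generating function of the odd harmonic numbers\<close>

lemma odd_harm_Suc_eq_sum: "odd_harm (Suc n) = (\<Sum>i\<le>n. 1 / (2 * real i + 1))"
  by (induction n) (simp_all add: odd_harm_Suc)

text \<open>Multiplying the artanh series by a geometric series in x^2 accumulates the odd
  reciprocals. The factor 2(1-x) prepares the integration over x: it turns x^(2n) into 2/(2n+1) -
  1/(n+1), the negative of the kernel in \<open>odd_harm_dilog_sums\<close>.\<close>

lemma odd_harm_power_sums:
  assumes "0 < x" "x < 1"
  shows "(\<lambda>n. odd_harm (Suc n) * (2 * (x ^ (2 * n) * (1 - x)))) sums (ln ((1 + x) / (1 - x)) / (x * (1 + x)))"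
proof -
  have x2: "x ^ 2 < 1"
    using assms by (simp add: power_less_one_iff)
  have "((1 + x) / (1 - x) - 1) / ((1 + x) / (1 - x) + 1) = x"
    using assms by (simp add: field_simps)
  then have "(\<lambda>n. 2 * x ^ (2 * n + 1) / real (2 * n + 1)) sums ln ((1 + x) / (1 - x))"
    using ln_series_quadratic[of "(1 + x) / (1 - x)"] assms by simp
  from sums_divide[OF this, of "2 * x"]
  have L: "(\<lambda>n. 1 / (2 * real n + 1) * (x ^ 2) ^ n) sums (ln ((1 + x) / (1 - x)) / (2 * x))"
    using assms by (simp add: power_mult add.commute)
  have "summable (\<lambda>n. norm (1 / (2 * real n + 1) * (x ^ 2) ^ n))" "summable (\<lambda>n. norm (1 * (x ^ 2) ^ n))"
    using x2 by (intro summable_norm_power_bounded; simp)+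
  from Cauchy_product_sums[OF this]
  have "(\<lambda>n. \<Sum>i\<le>n. 1 / (2 * real i + 1) * (x ^ 2) ^ i * (x ^ 2) ^ (n - i))
      sums (ln ((1 + x) / (1 - x)) / (2 * x) * (1 / (1 - x ^ 2)))"
    using sums_unique[OF L] sums_unique[OF geometric_sums[of "x ^ 2"]] x2 by simp
  moreover have "(\<Sum>i\<le>n. 1 / (2 * real i + 1) * (x ^ 2) ^ i * (x ^ 2) ^ (n - i)) = odd_harm (Suc n) * x ^ (2 * n)" for n
    unfolding odd_harm_Suc_eq_sum sum_distrib_right
    by (rule sum.cong) (auto simp: power_mult power_add[symmetric])
  ultimately have "(\<lambda>n. odd_harm (Suc n) * x ^ (2 * n)) sums (ln ((1 + x) / (1 - x)) / (2 * x) * (1 / (1 - x ^ 2)))"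
    by simp
  from sums_mult2[OF this, of "2 * (1 - x)"]
  have "(\<lambda>n. odd_harm (Suc n) * (2 * (x ^ (2 * n) * (1 - x)))) sums
      (ln ((1 + x) / (1 - x)) / (2 * x) * (1 / (1 - x ^ 2)) * (2 * (1 - x)))"
    by (simp only: mult_ac)
  moreover have "l / (2 * x) * (1 / (1 - x ^ 2)) * (2 * (1 - x)) = l / (x * (1 + x))" for l
  proof -
    have eq: "1 - x ^ 2 = (1 + x) * (1 - x)"
      by (simp add: power2_eq_square algebra_simps)
    have *: "l / (2 * x) * (1 / (w * y)) * (2 * y) = l / (x * w)" if "y \<noteq> 0" for w y
      using that by simp
    show ?thesis
      unfolding eq by (rule *) (use assms in simp)
  qed
  ultimately show ?thesis
    by simp
qed

text \<open>The sum of \<open>odd_harm_power_sums\<close> is the function into which the Cayley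
  substitution transforms -ln t/(1-t), so termwise integration gives the dilogarithm value
  pi^2/6.\<close>

lemma odd_harm_dilog_sums:
  "(\<lambda>j. odd_harm (Suc j) * (1 / real (Suc j) - 2 / (2 * real (Suc j) - 1))) sums (- (pi ^ 2 / 6))"
proof -
  define F where "F = (\<lambda>x::real. ln ((1 + x) / (1 - x)) / (x * (1 + x)))"
  have F_eq: "2 / (1 + x) ^ 2 * (neg_ln ((1 - x) / (1 + x)) / (1 - (1 - x) / (1 + x))) = F x" if "x \<in> {0<..<1}" for x
  proof -
    have "1 - (1 - x) / (1 + x) = 2 * x / (1 + x)" "neg_ln ((1 - x) / (1 + x)) = ln ((1 + x) / (1 - x))"
      using that by (simp_all add: field_simps neg_ln_def ln_divide_pos)
    moreover have "2 / y ^ 2 * (l / (2 * x / y)) = l / (x * y)" if "y \<noteq> 0" for l y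
      using that by (simp add: power2_eq_square)
    ultimately show ?thesis
      using that by (simp add: F_def)
  qed
  note cayley = integral_cayley[OF integral_neg_ln_over_1_minus(1)]
  have "(\<lambda>x. 2 / (1 + x) ^ 2 * (neg_ln ((1 - x) / (1 + x)) / (1 - (1 - x) / (1 + x)))) integrable_on {0<..<1}"
    by (rule set_lebesgue_integral_eq_integral(1)[OF cayley(1)])
  then have F_int: "F integrable_on {0<..<1}"
    by (rule integrable_eq) (rule F_eq)
  have "integral {0<..<1} F = integral {0<..<1} (\<lambda>x. 2 / (1 + x) ^ 2 * (neg_ln ((1 - x) / (1 + x)) / (1 - (1 - x) / (1 + x))))"
    by (rule integral_cong) (simp only: F_eq)
  also have "\<dots> = pi ^ 2 / 6"
    using cayley(2) integral_neg_ln_over_1_minus(2) by simp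
  finally have F: "integral {0<..<1} F = pi ^ 2 / 6" .
  have power: "((\<lambda>x. x ^ n) has_integral 1 / real (Suc n)) {0<..<1}" for n
  proof -
    have "((\<lambda>x::real. x ^ n) has_integral (1 / real (Suc n) - 0)) {0<..<1}"
    proof (rule has_integral_unit_interval)
      show "((\<lambda>x. x ^ Suc n / real (Suc n)) has_real_derivative x ^ n) (at x)" for x
        using DERIV_cdivide[OF DERIV_pow[of "Suc n" x], of "real (Suc n)"] by (simp del: of_nat_Suc)
      show "((\<lambda>x::real. x ^ Suc n / real (Suc n)) \<longlongrightarrow> 0) (at_right 0)"
        using tendsto_divide[OF tendsto_power[OF tendsto_ident_at[of 0 "{0<..}"], of "Suc n"] tendsto_const[of "real (Suc n)"]]
        by (simp del: of_nat_Suc)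
      show "((\<lambda>x::real. x ^ Suc n / real (Suc n)) \<longlongrightarrow> 1 / real (Suc n)) (at_left 1)"
        using tendsto_divide[OF tendsto_power[OF tendsto_ident_at[of 1 "{..<1}"], of "Suc n"] tendsto_const[of "real (Suc n)"]]
        by (simp del: of_nat_Suc)
    qed
    then show ?thesis
      by simp
  qed
  have "(\<lambda>j. odd_harm (Suc j) * (2 * (1 / real (Suc (2 * j)) - 1 / real (Suc (2 * j + 1))))) sums integral {0<..<1} F"
  proof (rule integral_sums_nonneg[OF _ F_int])
    show "((\<lambda>x. odd_harm (Suc j) * (2 * (x ^ (2 * j) * (1 - x)))) has_integral
        odd_harm (Suc j) * (2 * (1 / real (Suc (2 * j)) - 1 / real (Suc (2 * j + 1))))) {0<..<1}" for j
      using has_integral_mult_right[OF has_integral_diff[OF power[of "2 * j"] power[of "2 * j + 1"]], of "odd_harm (Suc j) * 2"]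
      by (simp add: algebra_simps)
    show "(\<lambda>j. odd_harm (Suc j) * (2 * (x ^ (2 * j) * (1 - x)))) sums F x" if "x \<in> {0<..<1}" for x
      using odd_harm_power_sums[of x] that by (simp add: F_def)
  qed auto
  from sums_minus[OF this] have "(\<lambda>j. - (odd_harm (Suc j) * (2 * (1 / real (Suc (2 * j)) - 1 / real (Suc (2 * j + 1)))))) sums (- (pi ^ 2 / 6))"
    unfolding F .
  moreover have "- (odd_harm (Suc j) * (2 * (1 / real (Suc (2 * j)) - 1 / real (Suc (2 * j + 1)))))
      = odd_harm (Suc j) * (1 / real (Suc j) - 2 / (2 * real (Suc j) - 1))" for j
  proof -
    have "real (Suc (2 * j)) = 2 * real (Suc j) - 1" "real (Suc (2 * j + 1)) = 2 * real (Suc j)"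
      by simp_all
    then show ?thesis
      by (simp only:) (simp add: algebra_simps del: of_nat_Suc)
  qed
  ultimately show ?thesis
    by simp
qed

section \<open>Convolution with the harmonic kernel\<close>

text \<open>Tonelli for series: nonnegativity turns the ordered sums into unconditional ones over
  pairs of indices, which can be read by rows or by columns.\<close>

lemma nonneg_sums_swap:
  fixes F :: "nat \<Rightarrow> nat \<Rightarrow> real"
  assumes nonneg: "\<And>k n. F k n \<ge> 0"
    and cols: "\<And>n. (\<lambda>k. F k n) sums h n" and "h sums s"
    and rows: "\<And>k. F k sums g k"
  shows "g sums s"
proof -
  have h_nonneg: "h n \<ge> 0" for n
    by (rule sums_le[OF _ sums_zero cols]) (rule nonneg)
  have cols': "((\<lambda>k. F k n) has_sum h n) UNIV" for n
    by (rule sums_nonneg_imp_has_sum[OF cols]) (rule nonneg)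
  have h': "(h has_sum s) UNIV"
    by (rule sums_nonneg_imp_has_sum[OF \<open>h sums s\<close>]) (rule h_nonneg)
  have "((\<lambda>(n, k). F k n) has_sum s) (UNIV \<times> UNIV)"
  proof (rule has_sum_SigmaI)
    show "(\<lambda>(n, k). F k n) summable_on UNIV \<times> UNIV"
      by (rule summable_on_SigmaI[where g = h])
        (use cols' h' nonneg in \<open>auto simp: summable_on_def\<close>)
  qed (use cols' h' in auto)
  then have "((\<lambda>(k, n). F k n) has_sum s) (UNIV \<times> UNIV)"
    by (subst (asm) has_sum_swap) (simp add: case_prod_unfold)
  then have "(g has_sum s) UNIV"
  proof (rule has_sum_SigmaD)
    fix k
    show "((\<lambda>n. case (k, n) of (k, n) \<Rightarrow> F k n) has_sum g k) UNIV"
      using sums_nonneg_imp_has_sum[OF rows nonneg] by simp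
  qed
  then show ?thesis
    by (rule has_sum_imp_sums)
qed

text \<open>In terms of elliptic integrals this is
  \<open>\<Sum> 4 a\<^sub>n O\<^sub>n x\<^sup>n = - ln (1 - x) \<Sum> a\<^sub>n x\<^sup>n\<close>. With \<open>Y\<close> for the last sum and \<open>D = x d/dx\<close>, both sides
  satisfy \<open>D\<^sup>2 Z = x (D + 1/2)\<^sup>2 Z + 2 x D Y + x Y\<close>.\<close>

lemma central_sq_convolution:
  "(\<Sum>k<n. central_sq k / real (n - k)) = 4 * central_sq n * odd_harm n"
proof -
  define Y L :: "real fps" where "Y = Abs_fps central_sq" and "L = fps_neg_log"
  define D where "D = fps_euler"
  note D_nth = fps_euler_nth[folded D_def] and D_mult = fps_euler_mult[folded D_def]
    and D_add = fps_euler_add[folded D_def] and D_X = fps_euler_X[folded D_def]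
  define c :: "real fps" where "c = fps_const (1 / 4)"
  have Y: "D (D Y) = fps_X * (D (D Y) + D Y + c * Y)"
  proof (rule fps_ext)
    fix n
    show "fps_nth (D (D Y)) n = fps_nth (fps_X * (D (D Y) + D Y + c * Y)) n"
    proof (cases n)
      case (Suc m)
      have "real (Suc m) * (real (Suc m) * central_sq (Suc m)) = (real m + 1 / 2) ^ 2 * central_sq m"
        using square_mult_central_sq_Suc[of m] by (simp only: power2_eq_square mult.assoc)
      also have "\<dots> = real m * (real m * central_sq m) + real m * central_sq m + 1 / 4 * central_sq m"
        by (simp add: power2_eq_square algebra_simps)
      finally show ?thesis
        unfolding Suc by (simp add: D_nth Y_def c_def del: of_nat_Suc)
    qed (simp add: D_nth)
  qed
  define u where "u = D L"
  have u: "u = fps_X + fps_X * u"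
    unfolding u_def D_def L_def by (rule fps_euler_neg_log)
  have Du: "D u = fps_X + fps_X * u + fps_X * D u"
    by (subst u) (simp add: D_add D_mult D_X)
  define Z where "Z = L * Y"
  have DZ: "D Z = L * D Y + u * Y"
    by (simp add: Z_def D_mult u_def)
  have DDZ: "D (D Z) = L * D (D Y) + 2 * (u * D Y) + D u * Y"
    unfolding DZ by (simp add: D_mult D_add u_def algebra_simps)
  have "D (D Z) = fps_X * (D (D Z) + D Z + c * Z) + 2 * (fps_X * D Y) + fps_X * Y"
  proof -
    have "fps_X * (D (D Z) + D Z + c * Z) + 2 * (fps_X * D Y) + fps_X * Y
        = L * (fps_X * (D (D Y) + D Y + c * Y)) + 2 * ((fps_X + fps_X * u) * D Y)
          + (fps_X + fps_X * u + fps_X * D u) * Y"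
      unfolding DDZ unfolding DZ unfolding Z_def by (simp add: algebra_simps)
    then show ?thesis
      by (simp only: Du[symmetric]) (simp only: Y[symmetric] u[symmetric] DDZ mult.assoc)
  qed
  then have Z_rec: "fps_nth (D (D Z)) (Suc n)
      = fps_nth (fps_X * (D (D Z) + D Z + c * Z) + 2 * (fps_X * D Y) + fps_X * Y) (Suc n)" for n
    by simp
  have "fps_nth Z n = 4 * central_sq n * odd_harm n" for n
  proof (induction n)
    case 0
    show ?case
      by (simp add: Z_def L_def fps_neg_log_def)
  next
    case (Suc n)
    have "real (Suc n) ^ 2 * fps_nth Z (Suc n)
        = (real n + 1 / 2) ^ 2 * fps_nth Z n + (2 * real n + 1) * central_sq n"
      using Z_rec[of n]
      by (simp add: D_nth c_def Y_def numeral_fps_const power2_eq_square algebra_simps del: of_nat_Suc)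
    also have "\<dots> = 4 * ((real n + 1 / 2) ^ 2 * central_sq n) * odd_harm (Suc n)"
    proof -
      have "4 * (real n + 1 / 2) ^ 2 * (1 / (2 * real n + 1)) = 2 * real n + 1"
        using two_n_plus_1_nonzero[of n] by (simp add: power2_eq_square field_simps)
      then show ?thesis
        unfolding Suc odd_harm_Suc by algebra
    qed
    also have "\<dots> = real (Suc n) ^ 2 * (4 * central_sq (Suc n) * odd_harm (Suc n))"
      unfolding square_mult_central_sq_Suc[symmetric] by simp
    finally show ?case
      by (simp del: of_nat_Suc)
  qed
  moreover have "fps_nth Z n = (\<Sum>k<n. central_sq k / real (n - k))"
    unfolding Z_def
    by (subst mult.commute) (simp add: fps_mult_nth Y_def L_def fps_neg_log_def atLeast0AtMost lessThan_Suc_atMost[symmetric])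
  ultimately show ?thesis
    by simp
qed

text \<open>Insert \<open>central_sq_convolution\<close> for a_n O_n and sum over n = k + j + 1
  first. Nonnegativity of g starts at 1 because the weight 1/(2n-1) is negative at 0, and no pair k
  < n has n = 0.\<close>

lemma central_sq_convolution_swap:
  assumes g: "\<And>n. 1 \<le> n \<Longrightarrow> g n \<ge> 0"
    and s: "(\<lambda>n. central_sq n * odd_harm n * g n) sums s"
    and r: "\<And>k. (\<lambda>j. g (k + Suc j) / real (Suc j)) sums r k"
  shows "(\<lambda>k. central_sq k * r k) sums (4 * s)"
proof -
  define F where "F = (\<lambda>k n. if k < n then central_sq k / real (n - k) * g n else 0)"
  show ?thesis
  proof (rule nonneg_sums_swap)
    show "F k n \<ge> 0" for k n
      using g[of n] by (simp add: F_def)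
    show "(\<lambda>k. F k n) sums (4 * (central_sq n * odd_harm n * g n))" for n
    proof -
      have "(\<lambda>k. F k n) sums (\<Sum>k<n. F k n)"
        by (rule sums_finite) (auto simp: F_def)
      also have "(\<Sum>k<n. F k n) = (\<Sum>k<n. central_sq k / real (n - k)) * g n"
        by (simp add: F_def sum_distrib_right)
      finally show ?thesis
        by (simp only: central_sq_convolution mult.assoc)
    qed
    show "(\<lambda>n. 4 * (central_sq n * odd_harm n * g n)) sums (4 * s)"
      by (intro sums_mult s)
    show "F k sums (central_sq k * r k)" for k
    proof -
      have "(\<lambda>j. F k (j + Suc k)) sums (central_sq k * r k)"
        using sums_mult[OF r[of k], of "central_sq k"] by (simp add: F_def add.commute)
      then show ?thesis
        by (subst (asm) sums_zero_iff_shift) (auto simp: F_def)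
    qed
  qed
qed

section \<open>Kernel sums and the values they determine\<close>

lemma odd_harm_over_linear_tendsto: "(\<lambda>n. odd_harm n / (2 * real n - 1)) \<longlonglongrightarrow> 0"
proof (rule tendsto_sandwich[OF _ _ tendsto_const])
  show "\<forall>\<^sub>F n in sequentially. 0 \<le> odd_harm n / (2 * real n - 1)"
    using eventually_ge_at_top[of 1] by eventually_elim auto
  show "\<forall>\<^sub>F n in sequentially. odd_harm n / (2 * real n - 1) \<le> (1 + ln (real n + 1)) / (2 * real n - 1)"
    using eventually_ge_at_top[of 1] by eventually_elim (auto intro!: divide_right_mono odd_harm_le)
  show "(\<lambda>n. (1 + ln (real n + 1)) / (2 * real n - 1)) \<longlonglongrightarrow> 0"
    by real_asymp
qed

lemma odd_nonzero: "2 * real n - 1 \<noteq> 0"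
  using odd_denominator_nonzero[of n 1] by simp

text \<open>The sum is psi(k + 1/2) + gamma. The base case is -2 times the alternating harmonic
  series; raising k by one shifts the denominators and telescopes to 2/(2k+1).\<close>

lemma digamma_half_sums:
  "(\<lambda>j. 1 / real (Suc j) - 2 / (2 * real (k + Suc j) - 1)) sums (2 * (odd_harm k - ln 2))"
proof (induction k)
  case 0
  from sums_mult[OF alternating_harmonic_series_sums', of "-2"]
  have "(\<lambda>j. - 2 * (inverse (real (2 * j + 1)) - inverse (real (2 * j + 2)))) sums (- 2 * ln 2)" .
  moreover have "- 2 * (inverse (real (2 * j + 1)) - inverse (real (2 * j + 2)))
      = 1 / real (Suc j) - 2 / (2 * real (0 + Suc j) - 1)" for j
  proof -
    have "real (2 * j + 2) = 2 * real (Suc j)" "2 * real (0 + Suc j) - 1 = real (2 * j + 1)"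
      by simp_all
    then show ?thesis
      by (simp only: inverse_eq_divide) (simp del: of_nat_Suc)
  qed
  ultimately show ?case
    by simp
next
  case (Suc k)
  have "(\<lambda>j. 2 / (2 * real (k + Suc j) - 1)) \<longlonglongrightarrow> 0"
    by real_asymp
  from sums_add[OF Suc telescope_sums'[OF this]] show ?case
    by (simp add: odd_harm_Suc algebra_simps)
qed

text \<open>Partial fractions: the two poles in j differ by k - 1/2, so the product is the digamma
  difference divided by 2k-1.\<close>

lemma harm_kernel_sums:
  "(\<lambda>j. 1 / (2 * real (k + Suc j) - 1) / real (Suc j)) sums (2 * (odd_harm k - ln 2) / (2 * real k - 1))"
proof -
  have "(1 / real (Suc j) - 2 / (2 * real (k + Suc j) - 1)) / (2 * real k - 1)
      = 1 / (2 * real (k + Suc j) - 1) / real (Suc j)" for j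
  proof -
    have *: "(1 / x - 2 / (2 * (y + x) - 1)) / (2 * y - 1) = 1 / (2 * (y + x) - 1) / x"
      if "x \<noteq> 0" "2 * (y + x) - 1 \<noteq> 0" "2 * y - 1 \<noteq> 0" for x y :: real
      using that by (simp add: divide_simps)
    show ?thesis
      unfolding of_nat_add by (rule *) (use odd_nonzero[of "k + Suc j"] odd_nonzero[of k] in simp_all)
  qed
  then show ?thesis
    using sums_divide[OF digamma_half_sums, of k "2 * real k - 1"] by simp
qed

text \<open>The kernel is used at k+1, as 2n+1 = 2(n+1) - 1, and O_(k+1) = O_k + 1/(2k+1) brings in
  the sum with squared denominator. Two of the four copies of the series return, so the equation can
  be solved for it.\<close>

lemma central_series_1_1_0:
  "central_series 1 1 0 = central_series 0 2 0 - ln 2 * central_series 0 1 0"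
proof -
  have "(\<lambda>k. central_sq k * (2 * (odd_harm (Suc k) - ln 2) / (2 * real k + 1))) sums (4 * central_series 1 1 0)"
  proof (rule central_sq_convolution_swap)
    show "(\<lambda>n. central_sq n * odd_harm n * (1 / (2 * real n + 1))) sums central_series 1 1 0"
      using central_term_sums[of 1 1 0] by (simp add: central_term_def[abs_def] add.commute)
    show "(\<lambda>j. 1 / (2 * real (k + Suc j) + 1) / real (Suc j)) sums (2 * (odd_harm (Suc k) - ln 2) / (2 * real k + 1))" for k
      using harm_kernel_sums[of "Suc k"] by (simp add: add_ac)
  qed simp
  moreover have "(\<lambda>k. 2 * central_term 1 1 0 k + 2 * central_term 0 2 0 k - 2 * ln 2 * central_term 0 1 0 k)
      sums (2 * central_series 1 1 0 + 2 * central_series 0 2 0 - 2 * ln 2 * central_series 0 1 0)"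
    by (intro sums_add sums_diff sums_mult central_term_sums) auto
  moreover have "central_sq k * (2 * (odd_harm (Suc k) - ln 2) / (2 * real k + 1))
      = 2 * central_term 1 1 0 k + 2 * central_term 0 2 0 k - 2 * ln 2 * central_term 0 1 0 k" for k
    by (simp add: central_term_inv_odd inv_odd_def odd_harm_Suc divide_inverse power2_eq_square algebra_simps)
  ultimately have "4 * central_series 1 1 0 = 2 * central_series 1 1 0 + 2 * central_series 0 2 0 - 2 * ln 2 * central_series 0 1 0"
    by (simp add: sums_unique2)
  then show ?thesis
    by simp
qed

lemma central_series_0_1_1: "central_series 0 1 1 = - 2 / pi"
  using central_series_0_1_Suc[of 0] by simp

text \<open>At shift 1 the kernel involves O_k itself, so besides the returning series only the
  explicit value \<open>central_series_0_1_1\<close> is left.\<close>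

lemma central_series_1_1_1: "central_series 1 1 1 = 2 * ln 2 / pi"
proof -
  have "(\<lambda>k. central_sq k * (2 * (odd_harm k - ln 2) / (2 * real k - 1))) sums (4 * central_series 1 1 1)"
  proof (rule central_sq_convolution_swap)
    show "(\<lambda>n. central_sq n * odd_harm n * (1 / (2 * real n - 1))) sums central_series 1 1 1"
      using central_term_sums[of 1 1 1] by (simp add: central_term_def[abs_def])
    show "(\<lambda>j. 1 / (2 * real (k + Suc j) - 1) / real (Suc j)) sums (2 * (odd_harm k - ln 2) / (2 * real k - 1))" for k
      by (rule harm_kernel_sums)
  qed simp
  moreover have "(\<lambda>k. 2 * central_term 1 1 1 k - 2 * ln 2 * central_term 0 1 1 k)
      sums (2 * central_series 1 1 1 - 2 * ln 2 * central_series 0 1 1)"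
    by (intro sums_diff sums_mult central_term_sums) auto
  moreover have "central_sq k * (2 * (odd_harm k - ln 2) / (2 * real k - 1))
      = 2 * central_term 1 1 1 k - 2 * ln 2 * central_term 0 1 1 k" for k
    by (simp add: central_term_def algebra_simps diff_divide_distrib)
  ultimately have "4 * central_series 1 1 1 = 2 * central_series 1 1 1 - 2 * ln 2 * central_series 0 1 1"
    by (simp add: sums_unique2)
  then show ?thesis
    using central_series_0_1_1 by simp
qed

text \<open>Summation by parts: -4 times the boundary term has difference a_n/(2n-1), while its next
  value times the increment 1/(2n+1)^2 of \<open>odd_harm2\<close> is -a_n/(2n+1). The limit of the
  product is -(2/pi)(pi^2/8) = -pi/4.\<close>

lemma central_odd_harm2_sums:
  "(\<lambda>n. central_sq n * (odd_harm2 n / (2 * real n - 1))) sums (central_series 0 1 0 - pi / 4)"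
proof -
  define v where "v = (\<lambda>n. - 4 * boundary 0 1 0 n * odd_harm2 n)"
  have "v \<longlonglongrightarrow> - 4 * (1 / (2 * pi)) * (pi ^ 2 / 8)"
    unfolding v_def by (intro tendsto_intros boundary_0_1_tendsto odd_harm2_tendsto)
  then have "(\<lambda>n. v (Suc n) - v n) sums (- (pi / 4))"
    using telescope_sums[of v] by (simp add: v_def power2_eq_square)
  moreover have "v (Suc n) - v n = central_sq n * (odd_harm2 n / (2 * real n - 1)) - central_term 0 1 0 n" for n
  proof -
    define i where "i = 1 / (2 * real n - 1)"
    define h where "h = 1 / (2 * real n + 1)"
    have "real n * i = 1 / 2 + i / 2" "real n * h = 1 / 2 - h / 2"
      using odd_nonzero[of n] two_n_plus_1_nonzero[of n] by (simp_all add: i_def h_def field_simps)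
    moreover have "boundary 0 1 0 n = real n ^ 2 * central_sq n * i"
      by (simp add: boundary_def central_term_def i_def)
    moreover have "boundary 0 1 0 (Suc n) = (real n + 1 / 2) ^ 2 * central_sq n * h"
      by (simp add: boundary_Suc h_def add.commute)
    moreover have "odd_harm2 (Suc n) = odd_harm2 n + h ^ 2"
      by (simp add: odd_harm2_Suc h_def power_divide)
    moreover have "central_term 0 1 0 n = central_sq n * h"
      by (simp add: central_term_def h_def add.commute)
    moreover have "central_sq n * (odd_harm2 n / (2 * real n - 1)) = central_sq n * odd_harm2 n * i"
      by (simp add: i_def)
    ultimately show ?thesis
      unfolding v_def by algebra
  qed
  ultimately have "(\<lambda>n. central_sq n * (odd_harm2 n / (2 * real n - 1)) - central_term 0 1 0 n) sums (- (pi / 4))"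
    by simp
  from sums_add[OF this central_term_sums[of 0 1 0]] show ?thesis
    by simp
qed

text \<open>Raising k by one changes the odd harmonic number, which \<open>harm_kernel_sums\<close>
  accounts for, and shifts the denominator, which telescopes through \<open>f\<close>. The squares
  of the increments collect in \<open>odd_harm2\<close>; the base case is
  \<open>odd_harm_dilog_sums\<close>.\<close>

lemma odd_harm_digamma_sums:
  "(\<lambda>j. odd_harm (k + Suc j) * (1 / real (Suc j) - 2 / (2 * real (k + Suc j) - 1)))
     sums (- (pi ^ 2 / 6) + 2 * odd_harm k ^ 2 + 2 * odd_harm2 k - 2 * ln 2 * odd_harm k)"
proof (induction k)
  case 0
  then show ?case
    using odd_harm_dilog_sums by simp
next
  case (Suc k)
  define f where "f = (\<lambda>j. 2 * (odd_harm (k + Suc j) / (2 * real (k + Suc j) - 1)))"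
  have "(\<lambda>j. odd_harm (j + Suc k) / (2 * real (j + Suc k) - 1)) \<longlonglongrightarrow> 0"
    by (rule LIMSEQ_ignore_initial_segment[OF odd_harm_over_linear_tendsto])
  then have "f \<longlonglongrightarrow> 2 * 0"
    unfolding f_def by (intro tendsto_mult tendsto_const) (simp add: add_ac)
  then have f: "(\<lambda>j. f j - f (Suc j)) sums f 0"
    using telescope_sums'[of f 0] by simp
  have D: "(\<lambda>j. 1 / (2 * real (k + Suc j) + 1) / real (Suc j)) sums (2 * (odd_harm (Suc k) - ln 2) / (2 * real k + 1))"
    using harm_kernel_sums[of "Suc k"] by (simp add: add_ac)
  have "odd_harm (k + Suc j) * (1 / real (Suc j) - 2 / (2 * real (k + Suc j) - 1))
      + 1 / (2 * real (k + Suc j) + 1) / real (Suc j) + (f j - f (Suc j))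
      = odd_harm (Suc k + Suc j) * (1 / real (Suc j) - 2 / (2 * real (Suc k + Suc j) - 1))" for j
  proof -
    define x q p h where "x = 1 / (2 * real (k + Suc j) + 1)" and "q = 1 / (2 * real (k + Suc j) - 1)"
      and "p = 1 / real (Suc j)" and "h = odd_harm (k + Suc j)"
    have eqs: "odd_harm (Suc k + Suc j) = h + x" "odd_harm (k + Suc j) = h" "f j = 2 * (h * q)" "f (Suc j) = 2 * ((h + x) * x)"
      "2 / (2 * real (k + Suc j) - 1) = 2 * q" "2 / (2 * real (Suc k + Suc j) - 1) = 2 * x"
      "1 / (2 * real (k + Suc j) + 1) / real (Suc j) = x * p" "1 / real (Suc j) = p"
      using odd_harm_Suc[of "k + Suc j"] by (simp_all add: f_def x_def q_def p_def h_def)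
    show ?thesis
      unfolding eqs by (simp add: algebra_simps)
  qed
  moreover have "- (pi ^ 2 / 6) + 2 * odd_harm k ^ 2 + 2 * odd_harm2 k - 2 * ln 2 * odd_harm k
      + 2 * (odd_harm (Suc k) - ln 2) / (2 * real k + 1) + f 0
      = - (pi ^ 2 / 6) + 2 * odd_harm (Suc k) ^ 2 + 2 * odd_harm2 (Suc k) - 2 * ln 2 * odd_harm (Suc k)"
  proof -
    define h where "h = 1 / (2 * real k + 1)"
    have "odd_harm (Suc k) = odd_harm k + h" "odd_harm2 (Suc k) = odd_harm2 k + h ^ 2"
      "f 0 = 2 * (odd_harm k + h) * h" "2 * (odd_harm (Suc k) - ln 2) / (2 * real k + 1) = 2 * (odd_harm k + h - ln 2) * h"
      by (simp_all add: odd_harm_Suc odd_harm2_Suc h_def power_divide f_def add.commute)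
    then show ?thesis
      by algebra
  qed
  ultimately show ?case
    using sums_add[OF sums_add[OF Suc D] f] by (simp only:)
qed

lemma odd_harm_kernel_sums:
  "(\<lambda>j. odd_harm (k + Suc j) / (2 * real (k + Suc j) - 1) / real (Suc j)) sums
     ((- (pi ^ 2 / 6) + 2 * odd_harm k ^ 2 + 2 * odd_harm2 k - 2 * ln 2 * odd_harm k) / (2 * real k - 1))"
proof -
  have "odd_harm (k + Suc j) * (1 / real (Suc j) - 2 / (2 * real (k + Suc j) - 1)) / (2 * real k - 1)
      = odd_harm (k + Suc j) / (2 * real (k + Suc j) - 1) / real (Suc j)" for j
  proof -
    have *: "h * (1 / x - 2 / (2 * (y + x) - 1)) / (2 * y - 1) = h / (2 * (y + x) - 1) / x"
      if "x \<noteq> 0" "2 * (y + x) - 1 \<noteq> 0" "2 * y - 1 \<noteq> 0" for x y h :: real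
      using that by (simp add: divide_simps)
    show ?thesis
      unfolding of_nat_add by (rule *) (use odd_nonzero[of "k + Suc j"] odd_nonzero[of k] in simp_all)
  qed
  then show ?thesis
    using sums_divide[OF odd_harm_digamma_sums, of k "2 * real k - 1"] by simp
qed

text \<open>The kernel for the weight O_n/(2n-1) is quadratic in O_k, so again two of four copies of
  the series return. In the rest, pi/3 from the dilogarithm and -pi/2 from
  \<open>central_odd_harm2_sums\<close> halve to -pi/12.\<close>

lemma central_series_2_1_1:
  "central_series 2 1 1 = central_series 0 1 0 - pi / 12 - 2 * ln 2 ^ 2 / pi"
proof -
  have "(\<lambda>k. central_sq k * ((- (pi ^ 2 / 6) + 2 * odd_harm k ^ 2 + 2 * odd_harm2 k - 2 * ln 2 * odd_harm k) / (2 * real k - 1)))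
      sums (4 * central_series 2 1 1)"
  proof (rule central_sq_convolution_swap)
    show "(\<lambda>n. central_sq n * odd_harm n * (odd_harm n / (2 * real n - 1))) sums central_series 2 1 1"
      using central_term_sums[of 2 1 1] by (simp add: central_term_def[abs_def] power2_eq_square mult.assoc)
    show "(\<lambda>j. odd_harm (k + Suc j) / (2 * real (k + Suc j) - 1) / real (Suc j)) sums
     ((- (pi ^ 2 / 6) + 2 * odd_harm k ^ 2 + 2 * odd_harm2 k - 2 * ln 2 * odd_harm k) / (2 * real k - 1))" for k
      by (rule odd_harm_kernel_sums)
  qed simp
  moreover have "(\<lambda>k. - (pi ^ 2 / 6) * central_term 0 1 1 k + 2 * central_term 2 1 1 k
        + 2 * (central_sq k * (odd_harm2 k / (2 * real k - 1))) - 2 * ln 2 * central_term 1 1 1 k)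
      sums (- (pi ^ 2 / 6) * central_series 0 1 1 + 2 * central_series 2 1 1
        + 2 * (central_series 0 1 0 - pi / 4) - 2 * ln 2 * central_series 1 1 1)"
    by (intro sums_add sums_diff sums_mult central_term_sums central_odd_harm2_sums) auto
  moreover have "central_sq k * ((- (pi ^ 2 / 6) + 2 * odd_harm k ^ 2 + 2 * odd_harm2 k - 2 * ln 2 * odd_harm k) / (2 * real k - 1))
      = - (pi ^ 2 / 6) * central_term 0 1 1 k + 2 * central_term 2 1 1 k
        + 2 * (central_sq k * (odd_harm2 k / (2 * real k - 1))) - 2 * ln 2 * central_term 1 1 1 k" for k
    by (simp add: central_term_def algebra_simps diff_divide_distrib add_divide_distrib)
  ultimately have "4 * central_series 2 1 1 = - (pi ^ 2 / 6) * central_series 0 1 1 + 2 * central_series 2 1 1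
        + 2 * (central_series 0 1 0 - pi / 4) - 2 * ln 2 * central_series 1 1 1"
    by (simp add: sums_unique2)
  then show ?thesis
    unfolding central_series_0_1_1 central_series_1_1_1 by (simp add: power2_eq_square field_simps)
qed

text \<open>At m = 0 the recurrence loses every term with a factor m and expresses this value by
  series already reduced to the (0,1) and (0,2) sums at shift 0.\<close>

lemma central_series_2_2_1:
  "central_series 2 2 1 = 3 * central_series 0 2 0 - 2 * (1 + ln 2) * central_series 0 1 0 + pi / 6 + 4 * ln 2 ^ 2 / pi"
  using central_series_2_2_Suc[of 0] unfolding One_nat_def[symmetric] central_series_2_1_1 central_series_1_1_0
  by (simp add: field_simps)

section \<open>Constants at shift 0 and summation of the recurrence\<close>

lemma central_series_0_1_0: "central_series 0 1 0 = 4 * catalan_const / pi"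
proof -
  have "central_term 0 1 0 sums (4 * catalan_const / pi)"
    using central_sq_over_odd_sums by (simp add: central_term_def[abs_def] add.commute)
  then show ?thesis
    using central_term_sums[of 0 1 0] by (simp add: sums_unique2)
qed

lemma central_series_0_2_0:
  "central_series 0 2 0 = - (16 * im_trilog / pi) + 3 * pi ^ 2 / 8 + ln 2 ^ 2 / 2"
proof -
  have "central_term 1 1 0 sums (2 / pi * bracket ln log_half_cos)"
    using central_sq_odd_harm_over_odd_sums by (simp add: central_term_def[abs_def] add.commute)
  then have "central_series 1 1 0 = 2 / pi * bracket ln log_half_cos"
    using central_term_sums[of 1 1 0] by (simp add: sums_unique2)
  then have "central_series 0 2 0 = 2 / pi * bracket ln log_half_cos + ln 2 * (4 * catalan_const / pi)"
    using central_series_1_1_0 unfolding central_series_0_1_0 by linarith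
  then show ?thesis
    unfolding bracket_ln_log_half_cos by (simp add: field_simps power2_eq_square power3_eq_cube)
qed

lemma central_series_2_2_eq:
  assumes "l \<ge> 1"
  shows "real l ^ 2 * central_sq l * central_series 2 2 l = K_const + (\<Sum>k=1..<l. central_sq k * H_seq k)"
  using \<open>l \<ge> 1\<close>
proof (induction l rule: dec_induct)
  case base
  have c: "central_sq (Suc 0) = 1 / 4"
    by (simp add: central_sq_def power2_eq_square)
  \<comment> \<open>The prefactor 1/4 of K is a_1.\<close>
  have "4 * K_const = central_series 2 2 1"
    unfolding central_series_2_2_1 central_series_0_1_0 central_series_0_2_0 K_const_def by (simp add: field_simps)
  then show ?case
    by (simp add: c)
next
  case (step m)
  have H: "H_seq m = (2 * real m + 1) ^ 2 / 4 * central_series 2 2 (Suc m) - real m ^ 2 * central_series 2 2 m"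
  proof -
    define x where "x = 2 * real m + 1"
    have x: "x \<noteq> 0" "real m = (x - 1) / 2"
      unfolding x_def using two_n_plus_1_nonzero by simp_all
    \<comment> \<open>The right-hand side of \<open>central_series_2_1_Suc\<close>, free of m; 2 L /
      (2m+1) is the explicit constant part of H.\<close>
    define L where "L = (central_series 0 1 0 - central_series 2 1 1) / 4"
    have L: "L = pi / 48 + ln 2 ^ 2 / (2 * pi)"
      unfolding L_def central_series_2_1_1 by (simp add: field_simps)
    have G: "x ^ 2 * central_series 2 1 (Suc m) = 4 * (real m ^ 2 * central_series 2 1 m + real m * central_series 1 1 m
        + central_series 0 1 m / 4 - L)"
      using central_series_2_1_Suc[of m] unfolding x_def L_def by (simp add: field_simps)
    have "H_seq m = (2 * real m * (central_series 2 1 m - central_series 1 1 m) + central_series 1 1 m - central_series 0 1 m) / (2 * x)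
        + 2 * L / x + central_series 0 2 m / 4 + real m * central_series 1 2 m"
    proof -
      have "(pi ^ 2 + 24 * (ln 2) ^ 2) / (24 * x * pi) = 2 * L / x"
        unfolding L using x(1) by (simp add: field_simps power2_eq_square)
      then show ?thesis
        unfolding H_seq_def x_def[symmetric] using step(1)
        by (simp add: A_seq_eq B_seq_eq C_series_eq E_series_eq G_series_eq)
    qed
    also have "\<dots> = real m * central_series 2 1 m - x / 2 * central_series 2 1 (Suc m) + central_series 1 1 m / 2
        + real m * central_series 1 2 m + central_series 0 2 m / 4"
    proof -
      \<comment> \<open>H contains no series of shift m+1: \<open>central_series_2_1_Suc\<close>
        eliminates the one that \<open>central_series_2_2_Suc\<close> leaves over, at the price of
        the denominators 2m+1 in H.\<close>
      have "x * (x / 2 * central_series 2 1 (Suc m)) = 2 * (real m ^ 2 * central_series 2 1 m + real m * central_series 1 1 m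
        + central_series 0 1 m / 4 - L)"
        using G by (simp add: power2_eq_square)
      then have "x / 2 * central_series 2 1 (Suc m) = 2 * (real m ^ 2 * central_series 2 1 m + real m * central_series 1 1 m
        + central_series 0 1 m / 4 - L) / x"
        using x(1) by (simp add: eq_divide_eq mult.commute)
      then show ?thesis
        unfolding x(2) using x(1) by (simp add: field_simps power2_eq_square)
    qed
    finally show ?thesis
      using central_series_2_2_Suc[of m] by (simp add: x_def)
  qed
  have "real (Suc m) ^ 2 * central_sq (Suc m) * central_series 2 2 (Suc m)
      = central_sq m * ((2 * real m + 1) ^ 2 / 4 * central_series 2 2 (Suc m))"
    unfolding square_mult_central_sq_Suc by (simp add: power2_eq_square algebra_simps)
  also have "\<dots> = real m ^ 2 * central_sq m * central_series 2 2 m + central_sq m * H_seq m"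
    unfolding H by (simp add: algebra_simps)
  finally show ?case
    using step by simp
qed

theorem theorem5:
  fixes l :: nat
  assumes "l \<ge> 1"
  shows "(\<lambda>n. let k = Suc n in
            central_sq k * (odd_harm k ^ 2 / (1 + 2 * real k - 2 * real l) ^ 2))
         sums (16 ^ l / (real l ^ 2 * real ((2 * l) choose l) ^ 2) *
               (K_const + (\<Sum>k=1..<l. central_sq k * H_seq k)))"
proof -
  have *: "u / (x * b) * (x * (v * b) * s) = u * v * s" if "x \<noteq> 0" "b \<noteq> 0" for u v x b s :: real
    using that by simp
  have "16 ^ l * (1 / 16) ^ l = (1 :: real)"
    by (simp add: power_mult_distrib[symmetric])
  with *[of "real l ^ 2" "real ((2 * l) choose l) ^ 2" "16 ^ l" "(1 / 16) ^ l" "central_series 2 2 l"] assms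
  \<comment> \<open>The prefactor of the theorem is the reciprocal of the summation factor l^2
    a_l.\<close>
  have "16 ^ l / (real l ^ 2 * real ((2 * l) choose l) ^ 2) * (real l ^ 2 * central_sq l * central_series 2 2 l)
      = central_series 2 2 l"
    unfolding central_sq_def by simp
  then have "16 ^ l / (real l ^ 2 * real ((2 * l) choose l) ^ 2) * (K_const + (\<Sum>k=1..<l. central_sq k * H_seq k))
      = central_series 2 2 l"
    unfolding central_series_2_2_eq[OF assms] .
  then show ?thesis
    using central_term_Suc_sums[of 2 2 l] by (simp only: central_term_def Let_def)
qed

end
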